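(* Let $p\neq 1$ be a positive integer. For $\alpha\geq0$ and $q\in(0,1)$ let $$s_\alpha(q)=\sum_{l=0}^\infty(2l+1)^\alpha\frac{(1-q)q^l}{1-q^{2l+1}}.$$ For $\alpha\geq 0$, let $r_1(\alpha)>0$ be the unique solution $q\in(0,1)$ to the equation $$s_\alpha(q)=2+\frac{p^\alpha(1-q)q^{\frac{p^2-1}{2}}}{2(1-q^{p^2})}.$$ Let $$\mathtt{T}_1=\left\{\{q_n\}_{n=1}^\infty\in(0,1)^\infty:\ \sup_n q_n<r_1(\alpha)\ \text{ and }\ q_n=q_{pn}\ \ \forall n\in\mathbb{N}\right\}.$$ Then the set of eigenfunctions $\{u_n(\cdot,\mu_n)\}_{n=1}^\infty$ of the Gross–Pitaevskii eigenvalue problem $$u''-u^3+\eta u=0,\qquad u(0)=u(1)=0,$$ is a basis of $\mathrm{H}^\alpha$ for all sequences of moduli $\{\mu_n\}_{n=1}^\infty$ associated to nomes $\{q_n\}\in\mathtt{T}_1$.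
   Context: For $n\in\mathbb{N}=\{1,2,\ldots\}$ and modulus $\mu\in(0,1)$, the eigenfunctions are $$u_n(x,\mu)=2^{3/2}n\mu K(\mu)\operatorname{sn}\big(2K(\mu)nx,\mu\big),$$ with eigenvalue $\eta=4n^2(1+\mu^2)K(\mu)^2$. Here $K(\mu)=\int_0^1(1-t^2)^{-1/2}(1-\mu^2t^2)^{-1/2}\,dt$ and $\operatorname{sn}(\cdot,\mu)$ is the Jacobi elliptic function of modulus $\mu$, i.e. the odd $4K(\mu)$-periodic extension of the inverse of $z\mapsto\int_0^z(1-t^2)^{-1/2}(1-\mu^2t^2)^{-1/2}\,dt$. The nome associated to $\mu$ is $q=\exp\left[-\pi K(\sqrt{1-\mu^2})/K(\mu)\right]\in(0,1)$. For $\alpha\geq0$, $\mathrm{H}^\alpha=\mathrm{H}^\alpha(0,1)$ denotes the Hilbert space of functions $f\in L^2(0,1)$ with $\sum_{n=1}^\infty n^{2\alpha}|\hat f(n)|^2<\infty$, where $\hat f(n)=\sqrt2\int_0^1f(x)\sin(n\pi x)\,dx$, with inner product $\langle f,g\rangle_\alpha=\sum_{n=1}^\infty n^{2\alpha}\hat f(n)\overline{\hat g(n)}$. Here $(0,1)^\infty$ denotes the set of sequences with entries in $(0,1)$.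
   Formalization: The value p = 2 is excluded, because the claim fails there: for p = 2, α = 2 and the constant nome sequence q_n = 0.097, which lies in T_1, some nonzero element of H^2 is orthogonal to all eigenfunctions. All p ≥ 3 are covered. *)

theory Defs
  imports "HOL-Analysis.Analysis"
begin

section \<open>Jacobi's elliptic sine and the nome\<close>

text \<open>
  The integrand is singular at \<open>t = 1\<close> when \<open>z = 1\<close>; there it takes the (irrelevant) value \<open>0\<close>,
  because \<open>0 powr a = 0\<close>.
\<close>

definition arcsn :: "real \<Rightarrow> real \<Rightarrow> real" where
  "arcsn \<mu> z = integral {0..z} (\<lambda>t. (1 - t\<^sup>2) powr (-1/2) * (1 - \<mu>\<^sup>2 * t\<^sup>2) powr (-1/2))"

definition ellK :: "real \<Rightarrow> real" where
  "ellK \<mu> = arcsn \<mu> 1"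

text \<open>
  The inverse of \<^term>\<open>arcsn \<mu>\<close> lives on \<open>[0, K]\<close>. It is reflected evenly about \<open>K\<close> to
  \<open>[0, 2K]\<close>, then oddly to \<open>[-2K, 2K]\<close>, then continued with period \<open>4K\<close>; \<open>y\<close> is the
  representative of \<open>x\<close> modulo \<open>4K\<close> in \<open>[-2K, 2K)\<close>. Oddness and periodicity alone would not
  determine the values on \<open>(K, 2K)\<close>; the even reflection is the one which gives the Jacobi
  function.
\<close>

definition jacobi_sn :: "real \<Rightarrow> real \<Rightarrow> real" where
  "jacobi_sn x \<mu> =
     (let K = ellK \<mu>;
          y = x - 4 * K * of_int \<lfloor>(x + 2 * K) / (4 * K)\<rfloor>
      in sgn y * the_inv_into {0..1} (arcsn \<mu>) (min \<bar>y\<bar> (2 * K - \<bar>y\<bar>)))"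

definition nome :: "real \<Rightarrow> real" where
  "nome \<mu> = exp (- pi * ellK (sqrt (1 - \<mu>\<^sup>2)) / ellK \<mu>)"


section \<open>The Gross--Pitaevskii eigenfunctions\<close>

definition gp_u :: "nat \<Rightarrow> real \<Rightarrow> real \<Rightarrow> real" where
  "gp_u n \<mu> x = 2 powr (3/2) * real n * \<mu> * ellK \<mu> * jacobi_sn (2 * ellK \<mu> * real n * x) \<mu>"

definition gp_eta :: "nat \<Rightarrow> real \<Rightarrow> real" where
  "gp_eta n \<mu> = 4 * (real n)\<^sup>2 * (1 + \<mu>\<^sup>2) * (ellK \<mu>)\<^sup>2"

text \<open>Derivatives at the end points of \<open>[0, 1]\<close> are one-sided; \<open>v\<close> and \<open>w\<close> are \<open>u'\<close> and \<open>u''\<close>.\<close>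

definition gp_eigenfunction :: "real \<Rightarrow> (real \<Rightarrow> real) \<Rightarrow> bool" where
  "gp_eigenfunction \<eta> u \<longleftrightarrow>
     (\<exists>x\<in>{0..1}. u x \<noteq> 0) \<and> u 0 = 0 \<and> u 1 = 0 \<and>
     (\<exists>v w. \<forall>x\<in>{0..1}.
        (u has_real_derivative v x) (at x within {0..1}) \<and>
        (v has_real_derivative w x) (at x within {0..1}) \<and>
        w x - (u x) ^ 3 + \<eta> * u x = 0)"


section \<open>The spaces \<open>H\<^sup>\<alpha>(0,1)\<close> and their bases\<close>

text \<open>
  Elements of \<open>L\<^sup>2(0,1)\<close> and \<open>H\<^sup>\<alpha>(0,1)\<close> are represented by functions \<open>real \<Rightarrow> complex\<close>; only the
  values on \<open>(0,1)\<close>, up to null sets, matter. Sequences over \<open>n \<ge> 1\<close> are summed as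
  \<open>\<Sum>n. a (Suc n)\<close>.
\<close>

definition L2_unit :: "(real \<Rightarrow> complex) set" where
  "L2_unit = {f. f \<in> borel_measurable (lebesgue_on {0<..<1}) \<and>
                 integrable (lebesgue_on {0<..<1}) (\<lambda>x. (cmod (f x))\<^sup>2)}"

definition sine_coeff :: "(real \<Rightarrow> complex) \<Rightarrow> nat \<Rightarrow> complex" where
  "sine_coeff f n =
     of_real (sqrt 2) * (LINT x|lebesgue_on {0<..<1}. f x * of_real (sin (real n * pi * x)))"

definition H_space :: "real \<Rightarrow> (real \<Rightarrow> complex) set" where
  "H_space \<alpha> = {f \<in> L2_unit.
     summable (\<lambda>n. real (Suc n) powr (2 * \<alpha>) * (cmod (sine_coeff f (Suc n)))\<^sup>2)}"

definition H_inner :: "real \<Rightarrow> (real \<Rightarrow> complex) \<Rightarrow> (real \<Rightarrow> complex) \<Rightarrow> complex" where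
  "H_inner \<alpha> f g =
     (\<Sum>n. of_real (real (Suc n) powr (2 * \<alpha>)) *
            sine_coeff f (Suc n) * cnj (sine_coeff g (Suc n)))"

definition H_norm :: "real \<Rightarrow> (real \<Rightarrow> complex) \<Rightarrow> real" where
  "H_norm \<alpha> f = sqrt (Re (H_inner \<alpha> f f))"

text \<open>
  Schauder bases \<open>\<phi>\<^sub>1, \<phi>\<^sub>2, \<dots>\<close> of \<open>H\<^sup>\<alpha>\<close>. The value \<open>\<phi> 0\<close> is not used, and \<open>c n\<close> is the coefficient
  of \<open>\<phi> (Suc n)\<close>.
\<close>

definition H_basis :: "real \<Rightarrow> (nat \<Rightarrow> real \<Rightarrow> complex) \<Rightarrow> bool" where
  "H_basis \<alpha> \<phi> \<longleftrightarrow>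
     (\<forall>n\<ge>1. \<phi> n \<in> H_space \<alpha>) \<and>
     (\<forall>f\<in>H_space \<alpha>. \<exists>!c :: nat \<Rightarrow> complex.
        (\<lambda>N. H_norm \<alpha> (\<lambda>x. f x - (\<Sum>n<N. c n * \<phi> (Suc n) x))) \<longlonglongrightarrow> 0)"


section \<open>The threshold \<open>r\<^sub>1(\<alpha>)\<close> and the class \<open>T\<^sub>1\<close>\<close>

definition s_fun :: "real \<Rightarrow> real \<Rightarrow> real" where
  "s_fun \<alpha> q = (\<Sum>l. real (2 * l + 1) powr \<alpha> * ((1 - q) * q ^ l / (1 - q ^ (2 * l + 1))))"

definition r1_eq :: "nat \<Rightarrow> real \<Rightarrow> real \<Rightarrow> bool" where
  "r1_eq p \<alpha> q \<longleftrightarrow>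
     s_fun \<alpha> q =
       2 + real p powr \<alpha> * (1 - q) * q powr (((real p)\<^sup>2 - 1) / 2) / (2 * (1 - q ^ (p\<^sup>2)))"

definition r1 :: "nat \<Rightarrow> real \<Rightarrow> real" where
  "r1 p \<alpha> = (THE q. q \<in> {0<..<1} \<and> r1_eq p \<alpha> q)"

text \<open>Sequences are indexed by \<open>n \<ge> 1\<close>; the entry at index \<open>0\<close> is unconstrained.\<close>

definition T1 :: "nat \<Rightarrow> real \<Rightarrow> (nat \<Rightarrow> real) set" where
  "T1 p \<alpha> = {q. (\<forall>n\<ge>1. q n \<in> {0<..<1}) \<and> (SUP n\<in>{1..}. q n) < r1 p \<alpha> \<and>
                (\<forall>n\<ge>1. q n = q (p * n))}"

end

(*
  Lambert series.  For c > 0 let F z be the sum of 2 sin (m z) / sinh (m c) over odd m > 0.  Writing F as a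
  Laurent series in exp (i z), products of the coefficients 1 / sinh (m c) are differences of values of
  coth, so the coefficients of F^2 and F^3 telescope; this gives F'' = 2 F^3 - C F on the strip |Im z| < c.
  By uniqueness for this equation, a zero of F' inside the real quarter period, or inside the vertical segment
  from pi/2 to pi/2 + i c, would force a symmetry of F which contradicts its first Fourier coefficient.
  Hence F'^2 = (a^2 - F^2) (b^2 - F^2), F runs monotonically from 0 to a on [0, pi/2] and from a to b on the
  segment, and the two travel times are K (a/b) = b pi/2 and K (sqrt (1 - (a/b)^2)) = b c.  So F / a is the
  elliptic sine of modulus a/b, whose nome is exp (-2 c), and the nome determines the modulus.

  Basis property.  Up to scaling, the n-th eigenfunction has sine coefficient beta_j (q_n) at j n for odd j,
  beta_j (q) = (1 - q) q^((j-1)/2) / (1 - q^j), so the expansion problem is an infinite system which is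
  triangular for divisibility.  Its formal solution is unique; it is square summable because the
  finite sections are uniformly coercive.  The trivial estimate gives coercivity only for s_alpha < 2; the
  ratios 3 and 9 together lose less than that, and the saving covers the extra term of the threshold.
*)
theory Submission
  imports Defs
begin

section \<open>Trigonometric series on a strip\<close>

text \<open>\<open>jacobi_sn\<close> is defined by inverting an integral, which gives no access to
  Fourier coefficients; hence the direction from the series to the function. The obstacle is that
  the series converges only inside the strip, while the second travel time ends on its boundary, at
  pi/2 + i c. There a geometric series with sum 1 / cosh is split off, and the remainder converges
  up to vertical distance 2 c from that point.

  In the second half, s_alpha - 1 bounds the sum of the norms of the off-diagonal dilations, so
  s_alpha < 2 is what a perturbation of the identity would require. Coercivity, unlike a norm bound,
  sees signs: for real a, if a_n a_3n and a_3n a_9n are negative then a_n a_9n is positive. This is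
  why 9 = 3 * 3 is the useful second ratio. The threshold contains the index p^2 instead of 9; below
  the threshold, submultiplicativity of the coefficients in the index bounds that term by the one of
  index 9, uniformly in p.\<close>

text \<open>The strict inequality \<open>r < c\<close> leaves a margin which absorbs polynomial
  factors, so the class is closed under termwise differentiation. At \<open>r = c\<close> the
  coefficients 1 / sinh would already fail.\<close>

definition exp_summable :: "real \<Rightarrow> (nat \<Rightarrow> complex) \<Rightarrow> bool" where
  "exp_summable c b \<longleftrightarrow> (\<forall>r<c. summable (\<lambda>l. norm (b l) * exp (r * real (2 * l + 1))))"

definition sin_series :: "(nat \<Rightarrow> complex) \<Rightarrow> complex \<Rightarrow> complex" where
  "sin_series b z = (\<Sum>l. b l * sin (of_nat (2 * l + 1) * z))"

definition cos_series :: "(nat \<Rightarrow> complex) \<Rightarrow> complex \<Rightarrow> complex" where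
  "cos_series b z = (\<Sum>l. b l * cos (of_nat (2 * l + 1) * z))"

text \<open>Half of the margin c - r pays for the factor: 2 l + 1 is at most exp (e (2 l + 1)) /
  e.\<close>

lemma exp_summable_mult_index:
  assumes "exp_summable c b"
  shows "exp_summable c (\<lambda>l. of_nat (2 * l + 1) * b l)"
  unfolding exp_summable_def
proof (intro allI impI)
  fix r assume "r < c"
  define e where "e = (c - r) / 2"
  have e: "e > 0" "r + e < c" using \<open>r < c\<close> by (auto simp: e_def field_simps)
  have "summable (\<lambda>l. (norm (b l) * exp ((r + e) * real (2 * l + 1))) / e)"
    using assms e by (intro summable_divide) (auto simp: exp_summable_def)
  then show "summable (\<lambda>l. norm (of_nat (2 * l + 1) * b l) * exp (r * real (2 * l + 1)))"
  proof (rule summable_comparison_test'[where N = 0])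
    fix l
    have "real (2 * l + 1) * e \<le> exp (e * real (2 * l + 1))"
      using exp_ge_add_one_self[of "e * real (2 * l + 1)"] mult.commute[of e "real (2 * l + 1)"] by linarith
    then have "real (2 * l + 1) \<le> exp (e * real (2 * l + 1)) / e"
      using e by (simp add: field_simps)
    then have "real (2 * l + 1) * (norm (b l) * exp (r * real (2 * l + 1)))
        \<le> exp (e * real (2 * l + 1)) / e * (norm (b l) * exp (r * real (2 * l + 1)))"
      by (rule mult_right_mono) simp
    moreover have "cmod (of_nat (2 * l + 1)) = real (2 * l + 1)"
      by (metis norm_of_nat)
    ultimately show "norm (norm (of_nat (2 * l + 1) * b l) * exp (r * real (2 * l + 1)))
        \<le> norm (b l) * exp ((r + e) * real (2 * l + 1)) / e"
      by (simp only: norm_mult real_norm_def abs_mult abs_exp_cancel distrib_right exp_add)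
         (simp add: mult_ac)
  qed
qed

lemma norm_sin_mult_le: "norm (sin (of_nat m * z)) \<le> exp (\<bar>Im z\<bar> * real m)"
  and norm_cos_mult_le: "norm (cos (of_nat m * z)) \<le> exp (\<bar>Im z\<bar> * real m)"
  using cmod_sin_le_exp[of 1 "of_nat m * z"] cmod_cos_le_exp[of 1 "of_nat m * z"]
  by (auto simp: abs_mult mult.commute)

lemma exp_summable_imp:
  assumes "exp_summable c b" "\<bar>Im z\<bar> < c"
  shows "summable (\<lambda>l. norm (b l * sin (of_nat (2 * l + 1) * z)))"
    and "summable (\<lambda>l. norm (b l * cos (of_nat (2 * l + 1) * z)))"
proof -
  have S: "summable (\<lambda>l. norm (b l) * exp (\<bar>Im z\<bar> * real (2 * l + 1)))"
    using assms by (auto simp: exp_summable_def)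
  show "summable (\<lambda>l. norm (b l * sin (of_nat (2 * l + 1) * z)))"
    by (rule summable_comparison_test'[OF S, where N = 0])
       (simp only: norm_mult real_norm_def abs_mult abs_norm_cancel mult_left_mono norm_ge_zero norm_sin_mult_le)
  show "summable (\<lambda>l. norm (b l * cos (of_nat (2 * l + 1) * z)))"
    by (rule summable_comparison_test'[OF S, where N = 0])
       (simp only: norm_mult real_norm_def abs_mult abs_norm_cancel mult_left_mono norm_ge_zero norm_cos_mult_le)
qed

lemma strip_convex_open:
  "convex {z. \<bar>Im z\<bar> < r}" "open {z. \<bar>Im z\<bar> < r}"
proof -
  have "{z. \<bar>Im z\<bar> < r} = {z. Im z < r} \<inter> {z. Im z > -r}" by auto
  then show "convex {z. \<bar>Im z\<bar> < r}" "open {z. \<bar>Im z\<bar> < r}"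
    by (auto intro: convex_Int open_Int convex_halfspace_Im_lt convex_halfspace_Im_gt
        open_halfspace_Im_lt open_halfspace_Im_gt)
qed

text \<open>The majorants grow with |Im z|, so uniformity is claimed on narrower strips only; this
  is enough to differentiate termwise at each point.\<close>

lemma uniformly_convergent_strip:
  assumes "exp_summable c b" "r < c" "\<And>l z. norm (h l z) \<le> exp (\<bar>Im z\<bar> * real (2 * l + 1))"
  shows "uniformly_convergent_on {z. \<bar>Im z\<bar> < r} (\<lambda>n z. \<Sum>l<n. b l * h l z)"
proof (rule Weierstrass_m_test')
  show "summable (\<lambda>l. norm (b l) * exp (r * real (2 * l + 1)))"
    using assms by (auto simp: exp_summable_def)
  fix l z assume "z \<in> {z. \<bar>Im z\<bar> < r}"
  then have "exp (\<bar>Im z\<bar> * real (2 * l + 1)) \<le> exp (r * real (2 * l + 1))"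
    by (simp add: mult_right_mono)
  then have "norm (h l z) \<le> exp (r * real (2 * l + 1))" using assms(3)[of l z] by linarith
  then show "norm (b l * h l z) \<le> norm (b l) * exp (r * real (2 * l + 1))"
    by (simp only: norm_mult mult_left_mono norm_ge_zero)
qed

lemma has_derivative_sin_series:
  assumes b: "exp_summable c b" and z: "\<bar>Im z\<bar> < c"
  shows "(sin_series b has_field_derivative cos_series (\<lambda>l. of_nat (2 * l + 1) * b l) z) (at z)"
proof -
  obtain r where r: "\<bar>Im z\<bar> < r" "r < c" using z dense by blast
  define S where "S = {z. \<bar>Im z\<bar> < r}"
  have S: "convex S" "open S" using strip_convex_open by (auto simp: S_def)
  have "((\<lambda>z. \<Sum>l. b l * sin (of_nat (2 * l + 1) * z)) has_field_derivative
        (\<Sum>l. of_nat (2 * l + 1) * b l * cos (of_nat (2 * l + 1) * z))) (at z)"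
  proof (rule has_field_derivative_series'(2)[where x0 = z and S = S])
    show "uniformly_convergent_on S (\<lambda>n x. \<Sum>l<n. of_nat (2 * l + 1) * b l * cos (of_nat (2 * l + 1) * x))"
      unfolding S_def by (rule uniformly_convergent_strip[OF exp_summable_mult_index[OF b] r(2)])
        (rule norm_cos_mult_le)
    show "summable (\<lambda>l. b l * sin (of_nat (2 * l + 1) * z))"
      by (rule summable_norm_cancel[OF exp_summable_imp(1)[OF b z]])
    show "z \<in> interior S" "z \<in> S" using S r by (auto simp: interior_open S_def)
    fix l x
    show "((\<lambda>z. b l * sin (of_nat (2 * l + 1) * z)) has_field_derivative
        of_nat (2 * l + 1) * b l * cos (of_nat (2 * l + 1) * x)) (at x within S)"
      by (auto intro!: derivative_eq_intros simp: mult_ac)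
  qed (use S in auto)
  then show ?thesis unfolding sin_series_def[abs_def] cos_series_def .
qed

lemma has_derivative_cos_series:
  assumes b: "exp_summable c b" and z: "\<bar>Im z\<bar> < c"
  shows "(cos_series b has_field_derivative - sin_series (\<lambda>l. of_nat (2 * l + 1) * b l) z) (at z)"
proof -
  obtain r where r: "\<bar>Im z\<bar> < r" "r < c" using z dense by blast
  define S where "S = {z. \<bar>Im z\<bar> < r}"
  have S: "convex S" "open S" using strip_convex_open by (auto simp: S_def)
  have U: "uniformly_convergent_on S (\<lambda>n x. \<Sum>l<n. of_nat (2 * l + 1) * b l * (- sin (of_nat (2 * l + 1) * x)))"
      unfolding S_def
      by (rule uniformly_convergent_strip[OF exp_summable_mult_index[OF b] r(2)])
        (simp only: norm_minus_cancel norm_sin_mult_le)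
  have "((\<lambda>z. \<Sum>l. b l * cos (of_nat (2 * l + 1) * z)) has_field_derivative
        (\<Sum>l. of_nat (2 * l + 1) * b l * (- sin (of_nat (2 * l + 1) * z)))) (at z)"
  proof (rule has_field_derivative_series'(2)[where x0 = z and S = S])
    show "uniformly_convergent_on S (\<lambda>n x. \<Sum>l<n. of_nat (2 * l + 1) * b l * (- sin (of_nat (2 * l + 1) * x)))"
      by (rule U)
    show "summable (\<lambda>l. b l * cos (of_nat (2 * l + 1) * z))"
      by (rule summable_norm_cancel[OF exp_summable_imp(2)[OF b z]])
    show "z \<in> interior S" "z \<in> S" using S r by (auto simp: interior_open S_def)
    fix l x
    show "((\<lambda>z. b l * cos (of_nat (2 * l + 1) * z)) has_field_derivative
        of_nat (2 * l + 1) * b l * (- sin (of_nat (2 * l + 1) * x))) (at x within S)"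
      by (auto intro!: derivative_eq_intros simp: mult_ac)
  qed (use S in auto)
  moreover have "(\<Sum>l. of_nat (2 * l + 1) * b l * (- sin (of_nat (2 * l + 1) * z))) =
     - sin_series (\<lambda>l. of_nat (2 * l + 1) * b l) z"
    unfolding sin_series_def mult_minus_right
    using exp_summable_imp(1)[OF exp_summable_mult_index[OF b] z, THEN summable_norm_cancel]
    by (rule suminf_minus)
  ultimately show ?thesis unfolding cos_series_def[abs_def] by simp
qed

section \<open>Sums over the integers and their convolution\<close>

text \<open>The negative half is listed as -1 - n because the reflection k to -1 - k changes the
  sign of the frequency 2 k + 1.\<close>

lemma has_sum_int_split:
  fixes g :: "int \<Rightarrow> 'a :: banach"
  assumes "summable (\<lambda>n. norm (g (int n)))" "summable (\<lambda>n. norm (g (- 1 - int n)))"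
  shows "(g has_sum ((\<Sum>n. g (int n)) + (\<Sum>n. g (- 1 - int n)))) UNIV"
proof -
  have U: "UNIV = range int \<union> range (\<lambda>n. - 1 - int n)"
  proof -
    have "k \<in> range int \<union> range (\<lambda>n. - 1 - int n)" for k
    proof (cases "k \<ge> 0")
      case True then have "k = int (nat k)" by simp
      then show ?thesis by blast
    next
      case False then have "k = - 1 - int (nat (- 1 - k))" by simp
      then show ?thesis by blast
    qed
    then show ?thesis by blast
  qed
  have 1: "(g has_sum (\<Sum>n. g (int n))) (range int)"
    using assms(1) by (subst has_sum_reindex)
      (auto simp: o_def inj_on_def intro!: norm_summable_imp_has_sum summable_sums summable_norm_cancel[OF assms(1)])
  have 2: "(g has_sum (\<Sum>n. g (- 1 - int n))) (range (\<lambda>n. - 1 - int n))"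
    using assms(2) by (subst has_sum_reindex)
      (auto simp: o_def inj_on_def intro!: norm_summable_imp_has_sum summable_sums summable_norm_cancel[OF assms(2)])
  show ?thesis
    unfolding U by (rule has_sum_Un_disjoint[OF 1 2]) auto
qed

lemma summable_on_int_split:
  fixes g :: "int \<Rightarrow> 'a :: banach"
  assumes "summable (\<lambda>n. norm (g (int n)))" "summable (\<lambda>n. norm (g (- 1 - int n)))"
  shows "(\<lambda>k. norm (g k)) summable_on UNIV"
  using has_sum_int_split[of "\<lambda>n. norm (g n)"] assms by (auto simp: summable_on_def)

text \<open>Cauchy product of two Laurent series: the products are absolutely summable over pairs,
  and the shear (M, N) to (M - N, N) regroups them by the total index M.\<close>

lemma has_sum_int_convolution:
  fixes f g :: "int \<Rightarrow> complex"
  assumes "(\<lambda>k. norm (f k)) summable_on UNIV" "(\<lambda>k. norm (g k)) summable_on UNIV"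
  shows "((\<lambda>M. \<Sum>\<^sub>\<infinity>N. f (M - N) * g N) has_sum (infsum f UNIV * infsum g UNIV)) UNIV"
    and "(\<lambda>N. f (M - N) * g N) summable_on UNIV"
proof -
  have *: "(\<lambda>p. norm ((\<lambda>(k, N). f k * g N) p)) summable_on UNIV \<times> UNIV"
  proof (rule iffD2[OF Infinite_Sum.abs_summable_on_Sigma_iff], intro conjI ballI)
    show "(\<lambda>N. norm ((\<lambda>(k, N). f k * g N) (k, N))) summable_on UNIV" for k
      using assms(2) by (simp add: norm_mult summable_on_cmult_right)
    have "(\<lambda>k. norm (f k) * infsum (\<lambda>N. norm (g N)) UNIV) summable_on UNIV"
      using assms(1) by (rule summable_on_cmult_left)
    moreover have "norm (infsum (\<lambda>N. norm ((\<lambda>(k, N). f k * g N) (k, N))) UNIV) =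
        norm (f k) * infsum (\<lambda>N. norm (g N)) UNIV" for k
      by (simp add: norm_mult infsum_cmult_right' infsum_nonneg)
    ultimately show "(\<lambda>k. norm (infsum (\<lambda>N. norm ((\<lambda>(k, N). f k * g N) (k, N))) UNIV)) summable_on UNIV"
      by (simp only:)
  qed
  have fg: "f summable_on UNIV" "g summable_on UNIV"
    using assms abs_summable_summable by blast+
  have **: "((\<lambda>(k, N). f k * g N) has_sum (infsum f UNIV * infsum g UNIV)) (UNIV \<times> UNIV)"
  proof (rule has_sum_SigmaI)
    show "((\<lambda>N. case (k, N) of (k, N) \<Rightarrow> f k * g N) has_sum f k * infsum g UNIV) UNIV" for k
      using fg(2) by (simp add: has_sum_cmult_right)
    show "((\<lambda>k. f k * infsum g UNIV) has_sum infsum f UNIV * infsum g UNIV) UNIV"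
      using fg(1) by (simp add: has_sum_cmult_left)
    show "(\<lambda>(k, N). f k * g N) summable_on UNIV \<times> UNIV"
      using * abs_summable_summable by blast
  qed
  have bij: "bij_betw (\<lambda>(M, N). (M - N, N)) (UNIV \<times> UNIV) (UNIV \<times> (UNIV :: int set))"
    by (rule bij_betwI[where g = "\<lambda>(k, N). (k + N, N)"]) auto
  have ***: "((\<lambda>(M, N). f (M - N) * g N) has_sum (infsum f UNIV * infsum g UNIV)) (UNIV \<times> UNIV)"
    using has_sum_reindex_bij_betw[OF bij, of "\<lambda>(k, N). f k * g N"] ** by (simp add: case_prod_unfold)
  show S: "(\<lambda>N. f (M - N) * g N) summable_on UNIV" for M
    using summable_on_SigmaD1[of "\<lambda>M N. f (M - N) * g N" UNIV "\<lambda>_. UNIV" M]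
      has_sum_imp_summable[OF ***] by simp
  show "((\<lambda>M. \<Sum>\<^sub>\<infinity>N. f (M - N) * g N) has_sum (infsum f UNIV * infsum g UNIV)) UNIV"
    by (rule has_sum_SigmaD[OF ***]) (simp only: prod.case has_sum_infsum[OF S])
qed

section \<open>Lambert series convolutions\<close>

lemma int_shift_has_sum:
  fixes f :: "int \<Rightarrow> 'a :: real_normed_vector"
  shows "((\<lambda>k. f (k + N)) has_sum S) UNIV \<longleftrightarrow> (f has_sum S) UNIV"
  by (rule has_sum_reindex_bij_betw) (rule bij_betwI[where g = "\<lambda>k. k - N"]; simp)

lemma has_sum_diff:
  fixes f g :: "'a \<Rightarrow> real"
  assumes "(f has_sum a) A" "(g has_sum b) A"
  shows "((\<lambda>x. f x - g x) has_sum (a - b)) A"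
  using has_sum_add[OF assms(1) has_sum_uminusI[OF assms(2)]] by simp

text \<open>Whenever x + y is fixed, this turns a convolution of values 1 / sinh into a sum of
  differences of coth. All the telescoping below rests on it.\<close>

lemma coth_add:
  fixes x y :: real
  assumes "x \<noteq> 0" "y \<noteq> 0"
  shows "1 / tanh x + 1 / tanh y = sinh (x + y) * ((1 / sinh x) * (1 / sinh y))"
  using assms by (simp add: tanh_def sinh_add field_simps)

lemma summable_exp_odd:
  assumes "r < 0"
  shows "summable (\<lambda>l. exp (r * real (2 * l + 1)))"
proof -
  have "exp (r * real (2 * l + 1)) = exp r * exp (2 * r) ^ l" for l
    by (simp add: exp_of_nat_mult[symmetric] exp_add[symmetric] algebra_simps)
  then show ?thesis using assms by (auto intro!: summable_mult summable_geometric)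
qed

section \<open>The coefficients 1 / sinh ((2 k + 1) c) and telescoping sums of coth\<close>

context
  fixes c :: real
  assumes c_pos: "c > 0"
begin

definition csch_odd :: "int \<Rightarrow> real" where
  "csch_odd k = 1 / sinh (of_int (2 * k + 1) * c)"

definition coth_odd :: "int \<Rightarrow> real" where
  "coth_odd k = 1 / tanh (of_int (2 * k + 1) * c)"

lemma odd_nonzero: "of_int (2 * k + 1) * c \<noteq> 0"
proof -
  have "2 * k + 1 \<noteq> 0" by presburger
  then have "of_int (2 * k + 1) \<noteq> (0 :: real)" by (simp only: of_int_eq_0_iff) simp
  then show ?thesis using c_pos by simp
qed

lemma csch_odd_reflect: "csch_odd (- 1 - k) = - csch_odd k"
proof -
  have "of_int (2 * (- 1 - k) + 1) * c = - (of_int (2 * k + 1) * c)" by (simp add: algebra_simps)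
  then show ?thesis unfolding csch_odd_def by (simp only: sinh_minus divide_minus_right)
qed

lemma coth_odd_reflect: "coth_odd (- 1 - k) = - coth_odd k"
proof -
  have "of_int (2 * (- 1 - k) + 1) * c = - (of_int (2 * k + 1) * c)" by (simp add: algebra_simps)
  then show ?thesis unfolding coth_odd_def by (simp only: tanh_minus divide_minus_right)
qed

text \<open>2 sinh x = exp x (1 - exp (-2 x)), and the second factor is smallest at x = c.\<close>

lemma csch_bound:
  assumes "x \<ge> c"
  shows "1 / sinh x \<le> 2 / (1 - exp (- 2 * c)) * exp (- x)"
proof -
  have e: "exp (- 2 * c) < 1" using c_pos by simp
  have x: "x > 0" using assms c_pos by simp
  have "exp (- 2 * x) \<le> exp (- 2 * c)" using assms by simp
  then have "exp x * (1 - exp (- 2 * c)) \<le> exp x * (1 - exp (- 2 * x))" by simp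
  also have "\<dots> = 2 * sinh x" by (simp add: sinh_field_def right_diff_distrib flip: exp_add)
  finally have *: "exp x * (1 - exp (- 2 * c)) \<le> 2 * sinh x" .
  have "2 / (2 * sinh x) \<le> 2 / (exp x * (1 - exp (- 2 * c)))"
    by (rule divide_left_mono[OF *]) (use e x in auto)
  then show ?thesis by (simp add: exp_minus field_simps)
qed

lemma csch_odd_int: "csch_odd (int l) = 1 / sinh (real (2 * l + 1) * c)"
  by (simp add: csch_odd_def)

lemma csch_odd_nat_bound:
  "\<bar>csch_odd (int l)\<bar> \<le> 2 / (1 - exp (- 2 * c)) * exp (- c * real (2 * l + 1))"
proof -
  have "c \<le> real (2 * l + 1) * c" using c_pos by (simp add: algebra_simps)
  from csch_bound[OF this] show ?thesis
    using c_pos by (simp add: csch_odd_int mult.commute)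
qed

lemma exp_summable_csch: "exp_summable c (\<lambda>l. of_real (csch_odd (int l)))"
  unfolding exp_summable_def
proof (intro allI impI)
  fix r assume "r < c"
  have "summable (\<lambda>l. 2 / (1 - exp (- 2 * c)) * exp ((r - c) * real (2 * l + 1)))"
    using \<open>r < c\<close> by (intro summable_mult summable_exp_odd) simp
  then show "summable (\<lambda>l. norm (of_real (csch_odd (int l)) :: complex) * exp (r * real (2 * l + 1)))"
  proof (rule summable_comparison_test'[where N = 0])
    fix l
    have "\<bar>csch_odd (int l)\<bar> * exp (r * real (2 * l + 1)) \<le>
        2 / (1 - exp (- 2 * c)) * exp (- c * real (2 * l + 1)) * exp (r * real (2 * l + 1))"
      by (rule mult_right_mono[OF csch_odd_nat_bound]) simp
    also have "\<dots> = 2 / (1 - exp (- 2 * c)) * exp ((r - c) * real (2 * l + 1))"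
      by (simp add: mult_exp_exp algebra_simps)
    finally show "norm (norm (of_real (csch_odd (int l)) :: complex) * exp (r * real (2 * l + 1))) \<le>
        2 / (1 - exp (- 2 * c)) * exp ((r - c) * real (2 * l + 1))"
      by simp
  qed
qed

lemma summable_csch_odd: "summable (\<lambda>l. norm (csch_odd (int l)))"
  using exp_summable_csch[unfolded exp_summable_def, rule_format, of 0] c_pos by simp

lemma summable_index_csch_odd: "summable (\<lambda>l. norm (of_nat (2 * l + 1) * csch_odd (int l)))"
proof -
  have "cmod (of_nat (2 * l + 1) * of_real x) = norm (of_nat (2 * l + 1) * x)" for l x
    by (simp only: norm_mult norm_of_nat norm_of_real real_norm_def abs_mult abs_of_nat)
  then show ?thesis
    using exp_summable_mult_index[OF exp_summable_csch, unfolded exp_summable_def, rule_format, of 0] c_pos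
    by (simp only: mult_zero_left exp_zero mult_1_right)
qed

lemma csch_odd_summable_on: "(\<lambda>k. norm (csch_odd k)) summable_on UNIV"
  by (rule summable_on_int_split) (use summable_csch_odd in \<open>auto simp: csch_odd_reflect\<close>)

lemma index_csch_odd_summable_on: "(\<lambda>k. norm (of_int (2 * k + 1) * csch_odd k)) summable_on UNIV"
proof (rule summable_on_int_split)
  show 1: "summable (\<lambda>l. norm (of_int (2 * int l + 1) * csch_odd (int l)))"
    using summable_index_csch_odd by (simp add: add.commute)
  have "of_int (2 * (- 1 - int l) + 1) * csch_odd (- 1 - int l) = of_int (2 * int l + 1) * csch_odd (int l)" for l
    unfolding csch_odd_reflect by (simp add: algebra_simps)
  then show "summable (\<lambda>l. norm (of_int (2 * (- 1 - int l) + 1) * csch_odd (- 1 - int l)))"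
    using 1 by (simp only:)
qed

lemma csch_odd_le: "\<bar>csch_odd k\<bar> \<le> csch_odd 0"
proof -
  have *: "\<bar>csch_odd (int l)\<bar> \<le> csch_odd 0" for l
  proof -
    have "sinh c \<le> sinh (real (2 * l + 1) * c)" using c_pos by (simp add: algebra_simps)
    then have "1 / sinh (real (2 * l + 1) * c) \<le> 1 / sinh c"
      using c_pos by (intro divide_left_mono) auto
    then show ?thesis using c_pos by (simp add: csch_odd_def add.commute)
  qed
  show ?thesis
  proof (cases "k \<ge> 0")
    case True then show ?thesis using *[of "nat k"] by simp
  next
    case False then show ?thesis using *[of "nat (- 1 - k)"] csch_odd_reflect[of k] by simp
  qed
qed

definition coth_step :: "int \<Rightarrow> real" where
  "coth_step n = coth_odd n - coth_odd (n - 1)"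

text \<open>\<open>coth_add\<close> at (2 n + 1) c and - (2 n - 1) c, whose sum is 2 c for every n.
  In this form a step is visibly summable over n.\<close>

lemma coth_step_eq: "coth_step n = - sinh (2 * c) * (csch_odd n * csch_odd (n - 1))"
proof -
  have "coth_step n = coth_odd n + coth_odd (- 1 - (n - 1))"
    unfolding coth_step_def by (subst coth_odd_reflect) simp
  also have "\<dots> = sinh (of_int (2 * n + 1) * c + of_int (2 * (- 1 - (n - 1)) + 1) * c) *
      (csch_odd n * csch_odd (- 1 - (n - 1)))"
    unfolding csch_odd_def coth_odd_def by (rule coth_add[OF odd_nonzero odd_nonzero])
  also have "of_int (2 * n + 1) * c + of_int (2 * (- 1 - (n - 1)) + 1) * c = 2 * c"
    by (simp add: algebra_simps)
  finally show ?thesis by (simp only: csch_odd_reflect mult_minus_left mult_minus_right)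
qed

lemma coth_step_minus: "coth_step (- n) = coth_step n"
proof -
  have *: "- n = - 1 - (n - 1)" "- 1 - (n - 1) - 1 = - 1 - n" by auto
  show ?thesis
    unfolding coth_step_def by (subst (1 2) *(1)) (simp only: *(2) coth_odd_reflect)
qed

lemma coth_step_le: "norm (coth_step n) \<le> sinh (2 * c) * csch_odd 0 * norm (csch_odd n)"
proof -
  have "norm (coth_step n) = sinh (2 * c) * norm (csch_odd n) * norm (csch_odd (n - 1))"
    using c_pos by (simp add: coth_step_eq abs_mult)
  also have "\<dots> \<le> sinh (2 * c) * norm (csch_odd n) * csch_odd 0"
    using csch_odd_le c_pos by (intro mult_left_mono) auto
  finally show ?thesis by (simp add: mult_ac)
qed

lemma coth_odd_tendsto: "(\<lambda>l. coth_odd (int l - 1)) \<longlonglongrightarrow> 1"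
proof -
  have "filterlim (\<lambda>l. real_of_int (2 * (int l - 1) + 1) * c) at_top sequentially"
  proof -
    have "filterlim (\<lambda>l. (2 * c) * real l + (- c)) at_top sequentially"
      using c_pos
      by (subst add.commute, intro filterlim_tendsto_add_at_top tendsto_const
          filterlim_tendsto_pos_mult_at_top[OF tendsto_const] filterlim_real_sequentially) auto
    then show ?thesis by (simp add: algebra_simps)
  qed
  then have "(\<lambda>l. tanh (real_of_int (2 * (int l - 1) + 1) * c)) \<longlonglongrightarrow> 1"
    by (rule filterlim_compose[OF tanh_real_at_top])
  then have "(\<lambda>l. 1 / tanh (real_of_int (2 * (int l - 1) + 1) * c)) \<longlonglongrightarrow> 1 / 1"
    by (intro tendsto_intros) auto
  then show ?thesis by (simp add: coth_odd_def)
qed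

text \<open>The limits of coth at the two ends are 1 and -1. The negative half is obtained from the
  positive one, because the step is even in n.\<close>

lemma coth_step_has_sum: "(coth_step has_sum 2) UNIV"
proof -
  have s: "(\<lambda>n. coth_step (int n)) sums (1 - coth_odd (-1))"
    using telescope_sums[OF coth_odd_tendsto] by (simp add: coth_step_def)
  have s': "(\<lambda>n. coth_step (- 1 - int n)) sums (1 - coth_odd 0)"
  proof -
    have "(\<lambda>n. coth_step (int (Suc n))) sums (1 - coth_odd (-1) - coth_step 0)"
      using s sums_Suc_iff[of "\<lambda>n. coth_step (int n)"] by simp
    moreover have "coth_step (int (Suc n)) = coth_step (- 1 - int n)" for n
      using coth_step_minus[of "int (Suc n)"] by (simp add: algebra_simps)
    ultimately show ?thesis by (simp add: coth_step_def)
  qed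
  have a: "summable (\<lambda>n. norm (coth_step (int n)))" "summable (\<lambda>n. norm (coth_step (- 1 - int n)))"
  proof -
    show "summable (\<lambda>n. norm (coth_step (int n)))"
      by (rule summable_comparison_test'[OF summable_mult[OF summable_csch_odd], where N = 0])
         (use coth_step_le in simp)
    show "summable (\<lambda>n. norm (coth_step (- 1 - int n)))"
      by (rule summable_comparison_test'[OF summable_mult[OF summable_csch_odd], where N = 0])
         (use coth_step_le[of "-1 - int _"] in \<open>simp add: csch_odd_reflect\<close>)
  qed
  have "coth_odd (-1) = - coth_odd 0" using coth_odd_reflect[of 0] by simp
  then show ?thesis
    using has_sum_int_split[OF a] s s' by (simp add: sums_iff)
qed

text \<open>The summand is odd in n, so absolute convergence is all that has to be shown.\<close>

lemma index_coth_step_has_sum: "((\<lambda>n. of_int n * coth_step n) has_sum 0) UNIV"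
proof -
  have "(\<lambda>n. norm (of_int n * coth_step n)) summable_on UNIV"
  proof (rule Infinite_Sum.abs_summable_on_comparison_test')
    show "(\<lambda>n. sinh (2 * c) * csch_odd 0 * norm (of_int (2 * n + 1) * csch_odd n)) summable_on UNIV"
      by (rule summable_on_cmult_right[OF index_csch_odd_summable_on])
    fix n
    have "norm (of_int n * coth_step n) \<le> \<bar>of_int n\<bar> * (sinh (2 * c) * csch_odd 0 * norm (csch_odd n))"
      using coth_step_le[of n] by (simp add: abs_mult mult_left_mono)
    also have "\<dots> \<le> \<bar>of_int (2 * n + 1)\<bar> * (sinh (2 * c) * csch_odd 0 * norm (csch_odd n))"
    proof (rule mult_right_mono)
      have "\<bar>n\<bar> \<le> \<bar>2 * n + 1\<bar>" by presburger
      then show "\<bar>real_of_int n\<bar> \<le> \<bar>real_of_int (2 * n + 1)\<bar>" by linarith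
    qed (use c_pos csch_odd_le[of 0] in auto)
    finally show "norm (of_int n * coth_step n) \<le> sinh (2 * c) * csch_odd 0 * norm (of_int (2 * n + 1) * csch_odd n)"
      by (simp only: norm_mult real_norm_def abs_mult mult_ac)
  qed
  then obtain S where S: "((\<lambda>n. of_int n * coth_step n) has_sum S) UNIV"
    using abs_summable_summable summable_on_def by blast
  have "bij_betw uminus (UNIV :: int set) UNIV" by (rule bij_betwI[where g = uminus]) auto
  from has_sum_reindex_bij_betw[OF this, of "\<lambda>n. of_int n * coth_step n" S] S
  have "((\<lambda>n. - (of_int n * coth_step n)) has_sum S) UNIV" by (simp add: coth_step_minus)
  moreover have "((\<lambda>n. - (of_int n * coth_step n)) has_sum - S) UNIV" using S by (simp add: has_sum_uminus)
  ultimately have "S = - S" by (rule has_sum_unique)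
  then show ?thesis using S by simp
qed

text \<open>A shift by N consists of unit shifts, each of which contributes a translate of
  \<open>coth_step\<close> with sum 2.\<close>

lemma coth_odd_shift_has_sum: "((\<lambda>k. coth_odd k - coth_odd (k - N)) has_sum (2 * real_of_int N)) UNIV"
proof (induction N rule: int_induct[where k = 0])
  case base then show ?case by simp
next
  case (step1 i)
  have "((\<lambda>k. coth_step (k - i)) has_sum 2) UNIV"
    using int_shift_has_sum[of coth_step "-i"] coth_step_has_sum by simp
  from has_sum_add[OF step1(2) this] show ?case
    by (simp add: coth_step_def algebra_simps)
next
  case (step2 i)
  have "((\<lambda>k. - coth_step (k - i + 1)) has_sum - 2) UNIV"
    using int_shift_has_sum[of "\<lambda>k. - coth_step k" "1-i"] coth_step_has_sum has_sum_uminusI[OF coth_step_has_sum]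
    by (simp add: algebra_simps)
  from has_sum_add[OF step2(2) this] show ?case
    by (simp add: coth_step_def algebra_simps)
qed

section \<open>Laurent coefficients of the square and of the cube\<close>

text \<open>The constant term of F^2. It enters only the constant of the differential equation, so
  no closed form is sought.\<close>

definition csch_square_sum :: real where
  "csch_square_sum = (\<Sum>\<^sub>\<infinity>k. csch_odd k ^ 2)"

text \<open>The coefficient of exp (2 i N z) in F^2.\<close>

definition square_coeff :: "int \<Rightarrow> real" where
  "square_coeff N = (if N = 0 then csch_square_sum else - 2 * of_int N / sinh (2 * of_int N * c))"

text \<open>The arguments (2 k + 1) c and (2 (N - 1 - k) + 1) c add up to 2 N c, so for N \<noteq> 0
  each product is a shift difference of coth divided by sinh (2 N c). For N = 0 this divisor
  vanishes, and the reflection gives minus a sum of squares.\<close>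

lemma csch_odd_convolution:
  "((\<lambda>k. csch_odd (N - 1 - k) * csch_odd k) has_sum (- square_coeff N)) UNIV"
proof (cases "N = 0")
  case True
  have "(\<lambda>k. norm (csch_odd k ^ 2)) summable_on UNIV"
  proof (rule Infinite_Sum.abs_summable_on_comparison_test')
    show "(\<lambda>k. csch_odd 0 * norm (csch_odd k)) summable_on UNIV"
      by (rule summable_on_cmult_right[OF csch_odd_summable_on])
    fix k show "norm (csch_odd k ^ 2) \<le> csch_odd 0 * norm (csch_odd k)"
      using mult_right_mono[OF csch_odd_le[of k], of "\<bar>csch_odd k\<bar>"] by (simp add: power2_eq_square)
  qed
  then have "((\<lambda>k. csch_odd k ^ 2) has_sum csch_square_sum) UNIV"
    unfolding csch_square_sum_def by (rule has_sum_infsum[OF abs_summable_summable])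
  then have "((\<lambda>k. - (csch_odd k ^ 2)) has_sum - csch_square_sum) UNIV" by (simp add: has_sum_uminus)
  moreover have "csch_odd (- 1 - k) * csch_odd k = - (csch_odd k ^ 2)" for k
    by (simp add: csch_odd_reflect power2_eq_square)
  ultimately show ?thesis using True by (simp add: square_coeff_def)
next
  case False
  have s: "sinh (2 * of_int N * c) \<noteq> 0" using False c_pos by simp
  have "csch_odd (N - 1 - k) * csch_odd k =
      (coth_odd k - coth_odd (k - N)) * (1 / sinh (2 * of_int N * c))" for k
  proof -
    have "coth_odd k - coth_odd (k - N) = coth_odd k + coth_odd (- 1 - (k - N))"
      using coth_odd_reflect[of "k - N"] by simp
    also have "\<dots> = sinh (of_int (2 * k + 1) * c + of_int (2 * (- 1 - (k - N)) + 1) * c) *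
        (csch_odd k * csch_odd (- 1 - (k - N)))"
      unfolding csch_odd_def coth_odd_def by (rule coth_add[OF odd_nonzero odd_nonzero])
    also have "of_int (2 * k + 1) * c + of_int (2 * (- 1 - (k - N)) + 1) * c = 2 * of_int N * c"
      by (simp add: algebra_simps)
    also have "- 1 - (k - N) = N - 1 - k" by simp
    finally show ?thesis using s by (simp add: field_simps)
  qed
  moreover have "((\<lambda>k. (coth_odd k - coth_odd (k - N)) * (1 / sinh (2 * of_int N * c))) has_sum
      2 * of_int N * (1 / sinh (2 * of_int N * c))) UNIV"
    by (rule has_sum_cmult_left[OF coth_odd_shift_has_sum])
  ultimately show ?thesis using False by (simp add: square_coeff_def)
qed

text \<open>For N \<noteq> 0 the N-th term of the cubic convolution is minus
  \<open>csch_odd M\<close> times this kernel; \<open>- coth_odd (N - M - 1)\<close> is coth at (2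
  (M - N) + 1) c. At N = 0 the prefactor makes the kernel vanish.\<close>

definition cube_kernel :: "int \<Rightarrow> int \<Rightarrow> real" where
  "cube_kernel M N = 2 * of_int N * (1 / tanh (2 * of_int N * c) - coth_odd (N - M - 1))"

text \<open>For M = 0 the two arguments add up to c, and \<open>coth_add\<close> exhibits the
  decaying factor \<open>csch_odd (- N)\<close>. The other factor 2 N / sinh (2 N c) is bounded by 1
  / c since |x| \<le> |sinh x|.\<close>

lemma cube_kernel_0_summable: "cube_kernel 0 summable_on UNIV"
proof -
  have "(\<lambda>N. norm (csch_odd (- N))) summable_on UNIV"
    using summable_on_reindex_bij_betw[OF bij_betwI[where f = uminus and g = uminus and A = UNIV and B = "UNIV :: int set"], of "\<lambda>k. norm (csch_odd k)"] csch_odd_summable_on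
    by simp
  then have S: "(\<lambda>N. sinh c / c * norm (csch_odd (- N))) summable_on UNIV"
    by (rule summable_on_cmult_right)
  have "(\<lambda>N. norm (cube_kernel 0 N)) summable_on UNIV"
  proof (rule Infinite_Sum.abs_summable_on_comparison_test'[OF S])
    fix N
    show "norm (cube_kernel 0 N) \<le> sinh c / c * norm (csch_odd (- N))"
    proof (cases "N = 0")
      case True then show ?thesis using c_pos by (simp add: cube_kernel_def)
    next
      case False
      then have n: "2 * of_int N * c \<noteq> 0" using c_pos by simp
      have "coth_odd (N - 1) = - coth_odd (- N)" using coth_odd_reflect[of "- N"] by simp
      then have "cube_kernel 0 N = 2 * of_int N * (1 / tanh (2 * of_int N * c) + coth_odd (- N))"
        by (simp add: cube_kernel_def)
      also have "1 / tanh (2 * of_int N * c) + coth_odd (- N) =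
          sinh (2 * of_int N * c + of_int (2 * (- N) + 1) * c) * ((1 / sinh (2 * of_int N * c)) * csch_odd (- N))"
        unfolding csch_odd_def coth_odd_def by (rule coth_add[OF n odd_nonzero])
      also have "2 * of_int N * c + of_int (2 * (- N) + 1) * c = c" by (simp add: algebra_simps)
      finally have eq: "cube_kernel 0 N = sinh c * (2 * of_int N / sinh (2 * of_int N * c)) * csch_odd (- N)"
        by simp
      have "\<bar>2 * of_int N * c\<bar> \<le> \<bar>sinh (2 * of_int N * c)\<bar>"
      proof -
        have *: "x \<le> sinh x" if "x \<ge> 0" for x :: real
        proof -
          have "sinh 0 - 0 \<le> sinh x - x"
          proof (rule DERIV_nonneg_imp_nondecreasing[OF that])
            show "\<exists>y'. ((\<lambda>y. sinh y - y) has_real_derivative y') (at y) \<and> y' \<ge> 0" for y :: real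
              by (rule exI[of _ "cosh y - 1"]) (auto intro!: derivative_eq_intros simp: cosh_real_ge_1)
          qed
          then show ?thesis by simp
        qed
        show ?thesis using *[of "\<bar>2 * of_int N * c\<bar>"] by (simp only: sinh_real_abs abs_ge_zero)
      qed
      then have "\<bar>2 * of_int N / sinh (2 * of_int N * c)\<bar> \<le> 1 / c"
        using n c_pos by (simp add: abs_mult field_simps)
      then have "sinh c * \<bar>2 * of_int N / sinh (2 * of_int N * c)\<bar> * \<bar>csch_odd (- N)\<bar> \<le> sinh c * (1 / c) * \<bar>csch_odd (- N)\<bar>"
        using c_pos by (intro mult_right_mono mult_left_mono) auto
      then show ?thesis using c_pos by (simp add: eq abs_mult)
    qed
  qed
  then show ?thesis by (rule abs_summable_summable)
qed

definition cube_const :: real where "cube_const = infsum (cube_kernel 0) UNIV"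

text \<open>Passing from M to M + 1 changes the kernel by 2 N times a step of coth, and the sum of
  these changes is linear in M. The total is therefore quadratic in M; this polynomial in the
  frequency is what becomes F''.\<close>

lemma cube_kernel_has_sum:
  "(cube_kernel M has_sum (cube_const + 2 * of_int M * (of_int M + 1))) UNIV"
proof -
  \<comment> \<open>With n = N - M - 1 the weight 2 N splits into 2 n, which sums to 0 against the
    steps, and the constant 2 (M + 1), which sums to twice itself.\<close>
  have step: "((\<lambda>N. 2 * of_int N * coth_step (N - M - 1)) has_sum (4 * (of_int M + 1))) UNIV" for M
  proof -
    have "((\<lambda>n. 2 * (of_int n * coth_step n) + 2 * (of_int M + 1) * coth_step n) has_sum
        (2 * 0 + 2 * (of_int M + 1) * 2)) UNIV"
      by (intro has_sum_add has_sum_cmult_right index_coth_step_has_sum coth_step_has_sum)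
    then have "((\<lambda>n. 2 * (of_int n + of_int M + 1) * coth_step n) has_sum (4 * (of_int M + 1))) UNIV"
      by (simp add: algebra_simps)
    then show ?thesis
      using int_shift_has_sum[of "\<lambda>n. 2 * (of_int n + of_int M + 1) * coth_step n" "- M - 1"]
      by (simp add: add_diff_eq)
  qed
  have rel: "cube_kernel (M + 1) N = cube_kernel M N + 2 * of_int N * coth_step (N - M - 1)" for M N
    by (simp add: cube_kernel_def coth_step_def algebra_simps)
  show ?thesis
  proof (induction M rule: int_induct[where k = 0])
    case base then show ?case using cube_kernel_0_summable by (simp add: cube_const_def)
  next
    case (step1 i)
    from has_sum_add[OF step1(2) step[of i]] show ?case
      by (simp only: rel[symmetric]) (simp add: algebra_simps)
  next
    case (step2 i)
    from has_sum_add[OF step2(2) has_sum_uminusI[OF step[of "i - 1"]]]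
    have "((\<lambda>N. cube_kernel i N - 2 * of_int N * coth_step (N - (i - 1) - 1)) has_sum
       (cube_const + 2 * of_int i * (of_int i + 1) - 4 * (of_int (i - 1) + 1))) UNIV" by simp
    moreover have "cube_kernel i N - 2 * of_int N * coth_step (N - (i - 1) - 1) = cube_kernel (i - 1) N" for N
      using rel[of "i - 1" N] by simp
    ultimately show ?case by (simp add: algebra_simps)
  qed
qed

text \<open>The arguments now add up to (2 M + 1) c, independently of N, so
  \<open>csch_odd M\<close> factors out. The term N = 0 lies outside the coth identity and
  contributes \<open>csch_square_sum\<close>.\<close>

lemma cube_convolution:
  "((\<lambda>N. csch_odd (M - N) * square_coeff N) has_sum
     csch_odd M * (csch_square_sum - cube_const - 2 * of_int M * (of_int M + 1))) UNIV"
proof -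
  have "csch_odd (M - N) * square_coeff N =
      csch_odd M * ((if N = 0 then csch_square_sum else 0) - cube_kernel M N)" for N
  proof (cases "N = 0")
    case True then show ?thesis by (simp add: square_coeff_def cube_kernel_def)
  next
    case False
    then have n: "2 * of_int N * c \<noteq> 0" using c_pos by simp
    have "N - M - 1 = - 1 - (M - N)" by simp
    then have "coth_odd (N - M - 1) = - coth_odd (M - N)" by (simp only: coth_odd_reflect)
    then have "cube_kernel M N = 2 * of_int N * (1 / tanh (2 * of_int N * c) + coth_odd (M - N))"
      by (simp add: cube_kernel_def)
    also have "1 / tanh (2 * of_int N * c) + coth_odd (M - N) =
        sinh (2 * of_int N * c + of_int (2 * (M - N) + 1) * c) * ((1 / sinh (2 * of_int N * c)) * csch_odd (M - N))"
      unfolding csch_odd_def coth_odd_def by (rule coth_add[OF n odd_nonzero])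
    also have "2 * of_int N * c + of_int (2 * (M - N) + 1) * c = of_int (2 * M + 1) * c" by (simp add: algebra_simps)
    finally have eq: "cube_kernel M N = sinh (of_int (2 * M + 1) * c) * (2 * of_int N / sinh (2 * of_int N * c)) * csch_odd (M - N)"
      by (simp add: mult_ac)
    have "csch_odd M * sinh (of_int (2 * M + 1) * c) = 1"
      using odd_nonzero[of M] by (simp only: csch_odd_def) simp
    then have "csch_odd M * cube_kernel M N = (2 * of_int N / sinh (2 * of_int N * c)) * csch_odd (M - N)"
      unfolding eq by (simp only: mult.assoc[symmetric] mult_1_left)
    then show ?thesis using False by (simp add: square_coeff_def algebra_simps)
  qed
  moreover have "((\<lambda>N. csch_odd M * ((if N = 0 then csch_square_sum else 0) - cube_kernel M N)) has_sum
      csch_odd M * (csch_square_sum - (cube_const + 2 * of_int M * (of_int M + 1)))) UNIV"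
  proof (intro has_sum_cmult_right has_sum_diff cube_kernel_has_sum)
    show "((\<lambda>N::int. if N = 0 then csch_square_sum else 0) has_sum csch_square_sum) UNIV"
      by (rule has_sum_finite_neutralI[where B = "{0}"]) auto
  qed
  ultimately show ?thesis by (simp only: diff_diff_eq)
qed

end

section \<open>The differential equation of the Lambert series\<close>

text \<open>The terms k and -1 - k combine to a sine because \<alpha> is odd under the reflection: 2
  sin t = - i (exp (i t) - exp (- i t)).\<close>

lemma odd_series_has_sum:
  fixes \<alpha> :: "int \<Rightarrow> real"
  assumes odd: "\<And>k. \<alpha> (- 1 - k) = - \<alpha> k"
    and sm: "exp_summable c (\<lambda>l. of_real (\<alpha> (int l)))" and z: "\<bar>Im z\<bar> < c"
  shows "((\<lambda>k. - \<i> * of_real (\<alpha> k) * exp (\<i> * of_int (2 * k + 1) * z)) has_sum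
    sin_series (\<lambda>l. of_real (2 * \<alpha> (int l))) z) UNIV" (is "(?g has_sum _) UNIV")
proof -
  have S: "summable (\<lambda>l. norm (of_real (\<alpha> (int l)) :: complex) * exp (\<bar>Im z\<bar> * real (2 * l + 1)))"
    using sm z unfolding exp_summable_def by blast
  have m: "?g (- 1 - int l) = \<i> * of_real (\<alpha> (int l)) * exp (- (\<i> * (of_nat (2 * l + 1) * z)))" for l
  proof -
    have "\<i> * of_int (2 * (- 1 - int l) + 1) * z = - (\<i> * (of_nat (2 * l + 1) * z))"
      by (simp add: algebra_simps)
    then show ?thesis by (simp only: odd) simp
  qed
  have p: "?g (int l) = - \<i> * of_real (\<alpha> (int l)) * exp (\<i> * (of_nat (2 * l + 1) * z))" for l
    by (simp add: algebra_simps)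
  have n1: "summable (\<lambda>l. norm (?g (int l)))"
  proof (rule summable_comparison_test'[OF S, where N = 0])
    fix l
    have "- (real (2 * l + 1) * Im z) \<le> \<bar>Im z\<bar> * real (2 * l + 1)"
      using abs_ge_minus_self[of "real (2 * l + 1) * Im z"] by (simp add: abs_mult mult.commute)
    then have "exp (Re (\<i> * (of_nat (2 * l + 1) * z))) \<le> exp (\<bar>Im z\<bar> * real (2 * l + 1))"
      by (simp add: algebra_simps)
    then show "norm (norm (?g (int l))) \<le> norm (of_real (\<alpha> (int l)) :: complex) * exp (\<bar>Im z\<bar> * real (2 * l + 1))"
      unfolding p real_norm_def abs_norm_cancel norm_mult norm_exp_eq_Re by (simp add: mult_left_mono)
  qed
  have n2: "summable (\<lambda>l. norm (?g (- 1 - int l)))"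
  proof (rule summable_comparison_test'[OF S, where N = 0])
    fix l
    have "real (2 * l + 1) * Im z \<le> \<bar>Im z\<bar> * real (2 * l + 1)"
      using abs_ge_self[of "real (2 * l + 1) * Im z"] by (simp add: abs_mult mult.commute)
    then have "exp (Re (- (\<i> * (of_nat (2 * l + 1) * z)))) \<le> exp (\<bar>Im z\<bar> * real (2 * l + 1))"
      by (simp add: algebra_simps)
    then show "norm (norm (?g (- 1 - int l))) \<le> norm (of_real (\<alpha> (int l)) :: complex) * exp (\<bar>Im z\<bar> * real (2 * l + 1))"
      unfolding m real_norm_def abs_norm_cancel norm_mult norm_exp_eq_Re by (simp add: mult_left_mono)
  qed
  have "(\<Sum>l. ?g (int l)) + (\<Sum>l. ?g (- 1 - int l)) = (\<Sum>l. ?g (int l) + ?g (- 1 - int l))"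
    by (rule suminf_add[OF summable_norm_cancel[OF n1] summable_norm_cancel[OF n2]])
  also have "(\<lambda>l. ?g (int l) + ?g (- 1 - int l)) = (\<lambda>l. of_real (2 * \<alpha> (int l)) * sin (of_nat (2 * l + 1) * z))"
    unfolding p m sin_exp_eq by (simp add: fun_eq_iff field_simps)
  finally show ?thesis
    using has_sum_int_split[OF n1 n2] by (simp only: sin_series_def)
qed

definition sn_wave :: "real \<Rightarrow> complex \<Rightarrow> complex" where
  "sn_wave c = sin_series (\<lambda>l. of_real (2 * csch_odd c (int l)))"

definition sn_wave' :: "real \<Rightarrow> complex \<Rightarrow> complex" where
  "sn_wave' c = cos_series (\<lambda>l. of_nat (2 * l + 1) * of_real (2 * csch_odd c (int l)))"

text \<open>Twice the constant part of the cubic coefficient; the additional 1 comes from 4 M (M +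
  1) = (2 M + 1)^2 - 1.\<close>

definition wave_const :: "real \<Rightarrow> real" where
  "wave_const c = 2 * csch_square_sum c - 2 * cube_const c + 1"

lemma exp_summable_cmult: "exp_summable c b \<Longrightarrow> exp_summable c (\<lambda>l. k * b l)"
  unfolding exp_summable_def by (simp add: norm_mult mult.assoc summable_mult)

lemma exp_summable_wave:
  "c > 0 \<Longrightarrow> exp_summable c (\<lambda>l. of_real (2 * csch_odd c (int l)))"
  using exp_summable_cmult[OF exp_summable_csch, of c 2] by simp

lemma has_derivative_sn_wave:
  "c > 0 \<Longrightarrow> \<bar>Im z\<bar> < c \<Longrightarrow> (sn_wave c has_field_derivative sn_wave' c z) (at z)"
  unfolding sn_wave_def sn_wave'_def by (rule has_derivative_sin_series[OF exp_summable_wave])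

text \<open>Comparison of Laurent coefficients: \<open>g\<close> and \<open>h\<close> below are the
  terms of F^2 and F^3, and the sine series subtracted on the right is - F''.\<close>

lemma sn_wave_ode_aux:
  assumes c: "c > 0" and z: "\<bar>Im z\<bar> < c"
  shows "2 * sn_wave c z ^ 3 = of_real (wave_const c) * sn_wave c z
    - sin_series (\<lambda>l. of_nat (2 * l + 1) * (of_nat (2 * l + 1) * of_real (2 * csch_odd c (int l)))) z"
proof -
  define a where "a = csch_odd c"
  define e where "e k = exp (\<i> * of_int k * z)" for k :: int
  have e_add: "e j * e k = e (j + k)" for j k
    by (simp add: e_def exp_add[symmetric] algebra_simps)
  define f where "f k = - \<i> * of_real (a k) * e (2 * k + 1)" for k
  define g where "g N = of_real (square_coeff c N) * e (2 * N)" for N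
  have F: "(f has_sum sn_wave c z) UNIV"
    unfolding f_def e_def sn_wave_def a_def
    by (rule odd_series_has_sum[OF csch_odd_reflect[OF c] exp_summable_csch[OF c] z])
  have f: "(\<lambda>k. norm (f k)) summable_on UNIV" "infsum f UNIV = sn_wave c z"
    using F by (auto simp flip: summable_on_iff_abs_summable_on_complex simp: infsumI summable_on_def)
  have ff: "(\<Sum>\<^sub>\<infinity>N. f (M - N) * f N) = g (M + 1)" for M
  proof -
    have "((\<lambda>k. of_real (a (M + 1 - 1 - k) * a k)) has_sum (of_real (- square_coeff c (M + 1)) :: complex)) UNIV"
      unfolding a_def by (rule has_sum_of_real[OF csch_odd_convolution[OF c]])
    from has_sum_cmult_right[OF this, of "- e (2 * (M + 1))"]
    have "((\<lambda>k. - e (2 * (M + 1)) * of_real (a (M - k) * a k)) has_sum g (M + 1)) UNIV"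
      by (simp add: g_def mult.commute)
    moreover have "f (M - k) * f k = - e (2 * (M + 1)) * of_real (a (M - k) * a k)" for k
    proof -
      have "f (M - k) * f k = (\<i> * \<i>) * of_real (a (M - k) * a k) * (e (2 * (M - k) + 1) * e (2 * k + 1))"
        unfolding f_def by (simp only: of_real_mult) (simp add: mult_ac)
      also have "e (2 * (M - k) + 1) * e (2 * k + 1) = e (2 * (M + 1))"
        unfolding e_add by (simp add: algebra_simps)
      finally show ?thesis by simp
    qed
    ultimately show ?thesis by (simp add: infsumI)
  qed
  have "((\<lambda>M. g (M + 1)) has_sum sn_wave c z * sn_wave c z) UNIV"
    using has_sum_int_convolution(1)[OF f(1) f(1)] unfolding ff f(2) .
  then have G: "(g has_sum sn_wave c z ^ 2) UNIV"
    by (simp only: int_shift_has_sum power2_eq_square)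
  have g: "(\<lambda>k. norm (g k)) summable_on UNIV" "infsum g UNIV = sn_wave c z ^ 2"
    using G by (auto simp flip: summable_on_iff_abs_summable_on_complex simp: infsumI summable_on_def)
  define h where "h M = - \<i> * of_real (a M * (csch_square_sum c - cube_const c - 2 * of_int M * (of_int M + 1))) * e (2 * M + 1)" for M
  have fg: "(\<Sum>\<^sub>\<infinity>N. f (M - N) * g N) = h M" for M
  proof -
    have "((\<lambda>N. of_real (a (M - N) * square_coeff c N)) has_sum
       (of_real (a M * (csch_square_sum c - cube_const c - 2 * of_int M * (of_int M + 1))) :: complex)) UNIV"
      unfolding a_def by (rule has_sum_of_real[OF cube_convolution[OF c]])
    from has_sum_cmult_right[OF this, of "- \<i> * e (2 * M + 1)"]
    have "((\<lambda>N. - \<i> * e (2 * M + 1) * of_real (a (M - N) * square_coeff c N)) has_sum h M) UNIV"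
      by (simp only: h_def mult_ac)
    moreover have "f (M - N) * g N = - \<i> * e (2 * M + 1) * of_real (a (M - N) * square_coeff c N)" for N
    proof -
      have "f (M - N) * g N = - \<i> * of_real (a (M - N) * square_coeff c N) * (e (2 * (M - N) + 1) * e (2 * N))"
        unfolding f_def g_def by (simp only: of_real_mult) (simp add: mult_ac)
      also have "e (2 * (M - N) + 1) * e (2 * N) = e (2 * M + 1)"
        unfolding e_add by (simp add: algebra_simps)
      finally show ?thesis by (simp add: mult_ac)
    qed
    ultimately show ?thesis by (simp add: infsumI)
  qed
  have H: "(h has_sum sn_wave c z * sn_wave c z ^ 2) UNIV"
    using has_sum_int_convolution(1)[OF f(1) g(1)] unfolding fg f(2) g(2) .
  define s where "s = sin_series (\<lambda>l. of_nat (2 * l + 1) * (of_nat (2 * l + 1) * of_real (2 * a (int l)))) z"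
  have S: "((\<lambda>k. - \<i> * of_real (of_int (2 * k + 1) ^ 2 * a k) * e (2 * k + 1)) has_sum s) UNIV"
  proof -
    have 1: "of_int (2 * (- 1 - k) + 1) ^ 2 * a (- 1 - k) = - (of_int (2 * k + 1) ^ 2 * a k)" for k
      unfolding a_def csch_odd_reflect[OF c] by (simp add: power2_eq_square algebra_simps)
    have 2: "exp_summable c (\<lambda>l. of_real (of_int (2 * int l + 1) ^ 2 * a (int l)))"
      using exp_summable_mult_index[OF exp_summable_mult_index[OF exp_summable_csch[OF c]]]
      by (simp add: a_def power2_eq_square algebra_simps)
    have 3: "(\<lambda>l. of_real (2 * (of_int (2 * int l + 1) ^ 2 * a (int l)))) =
        (\<lambda>l. of_nat (2 * l + 1) * (of_nat (2 * l + 1) * of_real (2 * a (int l))) :: complex)"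
      by (simp add: fun_eq_iff power2_eq_square algebra_simps)
    from odd_series_has_sum[OF 1 2 z] show ?thesis unfolding s_def e_def 3 .
  qed
  have 1: "((\<lambda>k. of_real (wave_const c) * f k - (- \<i> * of_real (of_int (2 * k + 1) ^ 2 * a k) * e (2 * k + 1)))
      has_sum (of_real (wave_const c) * sn_wave c z - s)) UNIV"
    using has_sum_add[OF has_sum_cmult_right[OF F] has_sum_uminusI[OF S]] by simp
  have 2: "of_real (wave_const c) * f k - (- \<i> * of_real (of_int (2 * k + 1) ^ 2 * a k) * e (2 * k + 1)) = 2 * h k" for k
    unfolding f_def h_def wave_const_def by (simp add: power2_eq_square algebra_simps)
  have 3: "((\<lambda>k. 2 * h k) has_sum (2 * (sn_wave c z * sn_wave c z ^ 2))) UNIV"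
    by (rule has_sum_cmult_right[OF H])
  have "of_real (wave_const c) * sn_wave c z - s = 2 * (sn_wave c z * sn_wave c z ^ 2)"
    by (rule has_sum_unique[OF 1[unfolded 2] 3])
  then show ?thesis by (simp add: s_def a_def power3_eq_cube power2_eq_square)
qed

lemma has_derivative_sn_wave':
  assumes "c > 0" "\<bar>Im z\<bar> < c"
  shows "(sn_wave' c has_field_derivative 2 * sn_wave c z ^ 3 - of_real (wave_const c) * sn_wave c z) (at z)"
  unfolding sn_wave_ode_aux[OF assms] sn_wave'_def
  using has_derivative_cos_series[OF exp_summable_mult_index[OF exp_summable_wave] assms(2)] assms
  by simp

text \<open>The first integral of F'' = 2 F^3 - C F. It is constant on the convex strip, and F 0 = 0
  fixes its value.\<close>

lemma sn_wave_energy: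
  assumes c: "c > 0" and z: "\<bar>Im z\<bar> < c"
  shows "sn_wave' c z ^ 2 = sn_wave c z ^ 4 - of_real (wave_const c) * sn_wave c z ^ 2 + sn_wave' c 0 ^ 2"
proof -
  define S where "S = {z. \<bar>Im z\<bar> < c}"
  define E where "E z = sn_wave' c z ^ 2 - sn_wave c z ^ 4 + of_real (wave_const c) * sn_wave c z ^ 2" for z
  have S: "convex S" "open S" unfolding S_def by (rule strip_convex_open)+
  have "\<exists>k. \<forall>z\<in>S. E z = k"
  proof (rule has_field_derivative_zero_constant[OF S(1)])
    fix z assume "z \<in> S"
    then have "\<bar>Im z\<bar> < c" by (simp add: S_def)
    note d = has_derivative_sn_wave[OF c this] has_derivative_sn_wave'[OF c this]
    have "(E has_field_derivative 0) (at z)"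
      unfolding E_def
      by (auto intro!: derivative_eq_intros d simp: power2_eq_square power3_eq_cube algebra_simps)
    then show "(E has_field_derivative 0) (at z within S)" by (rule has_field_derivative_at_within)
  qed
  then have "E z = E 0" using z c by (auto simp: S_def)
  moreover have "sn_wave c 0 = 0" by (simp add: sn_wave_def sin_series_def)
  ultimately show ?thesis by (simp add: E_def algebra_simps)
qed

section \<open>Sine coefficients\<close>

lemma integrable_on_unit:
  fixes f :: "real \<Rightarrow> complex"
  assumes "continuous_on {0..1} f"
  shows "integrable (lebesgue_on {0<..<1}) f"
    and "(LINT x|lebesgue_on {0<..<1}. f x) = integral {0..1} f"
proof -
  have "f absolutely_integrable_on {0..1}"
    by (rule absolutely_integrable_continuous_real[OF assms])
  then have "f absolutely_integrable_on {0<..<1}"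
    by (rule set_integrable_subset) auto
  then show i: "integrable (lebesgue_on {0<..<1}) f"
    by (simp add: integrable_restrict_space set_integrable_def)
  show "(LINT x|lebesgue_on {0<..<1}. f x) = integral {0..1} f"
    by (subst lebesgue_integral_eq_integral[OF i]) (auto simp: integral_open_interval_real)
qed

lemma integral_sin_mult_sin:
  assumes "m \<ge> 1" "k \<ge> 1"
  shows "integral {0..1} (\<lambda>x. sin (real m * pi * x) * sin (real k * pi * x)) = (if m = k then 1 / 2 else 0)"
proof (cases "m = k")
  case True
  have k: "real k \<noteq> 0" using assms by simp
  have "((\<lambda>x. sin (real m * pi * x) * sin (real k * pi * x)) has_integral
     (1 / 2 - sin (2 * real k * pi * 1) / (4 * real k * pi)) - (0 / 2 - sin (2 * real k * pi * 0) / (4 * real k * pi))) {0..1}"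
  proof (rule fundamental_theorem_of_calculus)
    fix x :: real
    have "((\<lambda>x. x / 2 - sin (2 * real k * pi * x) / (4 * real k * pi)) has_real_derivative
        1 / 2 - cos (2 * real k * pi * x) / 2) (at x within {0..1})"
      by (rule derivative_eq_intros refl | use k in \<open>simp add: field_simps\<close>)+
    moreover have "1 / 2 - cos (2 * real k * pi * x) / 2 = sin (real m * pi * x) * sin (real k * pi * x)"
      using cos_double_sin[of "real k * pi * x"] True by (simp add: power2_eq_square mult.assoc diff_divide_distrib)
    ultimately show "((\<lambda>x. x / 2 - sin (2 * real k * pi * x) / (4 * real k * pi)) has_vector_derivative
        sin (real m * pi * x) * sin (real k * pi * x)) (at x within {0..1})"
      by (simp add: has_real_derivative_iff_has_vector_derivative)
  qed simp
  moreover have "sin (2 * real k * pi) = 0" using sin_npi[of "2 * k"] by simp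
  ultimately show ?thesis using True by (simp add: integral_unique)
next
  case False
  define d where "d = real m - real k"
  define e where "e = real m + real k"
  have de: "d \<noteq> 0" "e \<noteq> 0" using False assms by (auto simp: d_def e_def)
  have "((\<lambda>x. sin (real m * pi * x) * sin (real k * pi * x)) has_integral
     (sin (d * pi * 1) / (2 * d * pi) - sin (e * pi * 1) / (2 * e * pi)) -
     (sin (d * pi * 0) / (2 * d * pi) - sin (e * pi * 0) / (2 * e * pi))) {0..1}"
  proof (rule fundamental_theorem_of_calculus)
    fix x :: real
    have "((\<lambda>x. sin (d * pi * x) / (2 * d * pi) - sin (e * pi * x) / (2 * e * pi)) has_real_derivative
        cos (d * pi * x) / 2 - cos (e * pi * x) / 2) (at x within {0..1})"
      by (rule derivative_eq_intros refl | use de in \<open>simp add: field_simps\<close>)+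
    moreover have "cos (d * pi * x) / 2 - cos (e * pi * x) / 2 = sin (real m * pi * x) * sin (real k * pi * x)"
    proof -
      have "real m * pi * x - real k * pi * x = d * pi * x" "real m * pi * x + real k * pi * x = e * pi * x"
        by (simp_all add: d_def e_def algebra_simps)
      then show ?thesis by (simp only: sin_times_sin diff_divide_distrib)
    qed
    ultimately show "((\<lambda>x. sin (d * pi * x) / (2 * d * pi) - sin (e * pi * x) / (2 * e * pi)) has_vector_derivative
        sin (real m * pi * x) * sin (real k * pi * x)) (at x within {0..1})"
      by (simp add: has_real_derivative_iff_has_vector_derivative)
  qed simp
  moreover have "sin (d * pi) = 0"
    by (simp add: d_def left_diff_distrib sin_diff)
  moreover have "sin (e * pi) = 0"
    using sin_npi[of "m + k"] by (simp add: e_def)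
  ultimately show ?thesis using False by (simp add: integral_unique)
qed

lemma continuous_on_sine_series:
  fixes \<beta> :: "nat \<Rightarrow> complex" and \<nu> :: "nat \<Rightarrow> nat"
  assumes "summable (\<lambda>l. norm (\<beta> l))"
  shows "continuous_on UNIV (\<lambda>x. \<Sum>l. \<beta> l * of_real (sin (real (\<nu> l) * pi * x)))"
proof (rule uniform_limit_theorem)
  show "uniform_limit UNIV (\<lambda>n x. \<Sum>l<n. \<beta> l * of_real (sin (real (\<nu> l) * pi * x)))
      (\<lambda>x. \<Sum>l. \<beta> l * of_real (sin (real (\<nu> l) * pi * x))) sequentially"
    by (rule Weierstrass_m_test[OF _ assms]) (simp add: norm_mult mult_left_le)
  show "\<forall>\<^sub>F n in sequentially. continuous_on UNIV (\<lambda>x. \<Sum>l<n. \<beta> l * of_real (sin (real (\<nu> l) * pi * x)))"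
    by (intro always_eventually allI continuous_intros)
qed simp

text \<open>Domination by the norms of the coefficients lets sum and integral commute; orthogonality
  then leaves the factor sqrt 2 * (1 / 2).\<close>

lemma sine_coeff_sine_series:
  fixes \<beta> :: "nat \<Rightarrow> complex" and \<nu> :: "nat \<Rightarrow> nat"
  assumes s: "summable (\<lambda>l. norm (\<beta> l))" and \<nu>: "\<And>l. \<nu> l \<ge> 1" and k: "k \<ge> 1"
  shows "sine_coeff (\<lambda>x. \<Sum>l. \<beta> l * of_real (sin (real (\<nu> l) * pi * x))) k =
    (\<Sum>l. if \<nu> l = k then \<beta> l / of_real (sqrt 2) else 0)"
proof -
  let ?M = "lebesgue_on {0<..<1::real}"
  define f where "f l x = \<beta> l * of_real (sin (real (\<nu> l) * pi * x) * sin (real k * pi * x))" for l x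
  have sx: "summable (\<lambda>l. \<beta> l * of_real (sin (real (\<nu> l) * pi * x)))" for x
    by (rule summable_norm_cancel, rule summable_comparison_test'[OF s, where N = 0])
       (simp add: norm_mult mult_left_le)
  have i: "integrable ?M (f l)" for l
    unfolding f_def by (intro integrable_on_unit continuous_intros)
  have nf: "norm (f l x) \<le> norm (\<beta> l)" for l x
    by (simp add: f_def norm_mult mult_left_le abs_mult mult_le_one)
  have i1: "integrable ?M (\<lambda>x. norm (\<beta> l))" for l
    by (intro integrable_norm integrable_on_unit) simp
  have "(\<Sum>l. \<beta> l * of_real (sin (real (\<nu> l) * pi * x))) * of_real (sin (real k * pi * x)) = (\<Sum>l. f l x)" for x
    by (subst suminf_mult2[OF sx]) (simp add: f_def mult_ac)
  then have "(LINT x|?M. (\<Sum>l. \<beta> l * of_real (sin (real (\<nu> l) * pi * x))) * of_real (sin (real k * pi * x)))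
     = (LINT x|?M. (\<Sum>l. f l x))" by simp
  also have "\<dots> = (\<Sum>l. LINT x|?M. f l x)"
  proof (rule integral_suminf[OF i])
    show "AE x in ?M. summable (\<lambda>l. norm (f l x))"
      using nf by (intro AE_I2 summable_comparison_test'[OF s, where N = 0]) simp
    show "summable (\<lambda>l. LINT x|?M. norm (f l x))"
    proof (rule summable_comparison_test'[OF s, where N = 0])
      fix l
      have "(LINT x|?M. norm (f l x)) \<le> (LINT x|?M. norm (\<beta> l))"
        using nf by (intro integral_mono integrable_norm i i1)
      also have "\<dots> = norm (\<beta> l)" by (simp add: measure_restrict_space)
      finally show "norm (LINT x|?M. norm (f l x)) \<le> norm (\<beta> l)" by simp
    qed
  qed
  also have "(\<lambda>l. LINT x|?M. f l x) = (\<lambda>l. if \<nu> l = k then \<beta> l / 2 else 0)"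
  proof
    fix l
    have c: "continuous_on {0..1} (\<lambda>x. of_real (sin (real (\<nu> l) * pi * x) * sin (real k * pi * x)) :: complex)"
      by (intro continuous_intros)
    have "(LINT x|?M. f l x) = \<beta> l * (LINT x|?M. of_real (sin (real (\<nu> l) * pi * x) * sin (real k * pi * x)))"
      unfolding f_def by simp
    also have "\<dots> = \<beta> l * of_real (integral {0..1} (\<lambda>x. sin (real (\<nu> l) * pi * x) * sin (real k * pi * x)))"
    proof -
      have "(\<lambda>x. sin (real (\<nu> l) * pi * x) * sin (real k * pi * x)) integrable_on {0..1}"
        by (intro integrable_continuous_real continuous_intros)
      from integral_unique[OF has_integral_of_real[OF integrable_integral[OF this]]]
      show ?thesis unfolding integrable_on_unit(2)[OF c] by (rule arg_cong)
    qed
    also have "\<dots> = (if \<nu> l = k then \<beta> l / 2 else 0)"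
      using integral_sin_mult_sin[OF \<nu> k] by simp
    finally show "(LINT x|?M. f l x) = (if \<nu> l = k then \<beta> l / 2 else 0)" .
  qed
  finally have *: "sine_coeff (\<lambda>x. \<Sum>l. \<beta> l * of_real (sin (real (\<nu> l) * pi * x))) k
    = of_real (sqrt 2) * (\<Sum>l. if \<nu> l = k then \<beta> l / 2 else 0)"
    by (simp add: sine_coeff_def)
  have "summable (\<lambda>l. if \<nu> l = k then \<beta> l / 2 else 0)"
    by (rule summable_norm_cancel, rule summable_comparison_test'[OF s, where N = 0])
       (auto simp: norm_divide)
  from suminf_mult[OF this, of "of_real (sqrt 2)"]
  have "of_real (sqrt 2) * (\<Sum>l. if \<nu> l = k then \<beta> l / 2 else 0) =
     (\<Sum>l. of_real (sqrt 2) * (if \<nu> l = k then \<beta> l / 2 else 0))" by simp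
  moreover have "of_real (sqrt 2) * (if P then b / 2 else 0) = (if P then b / of_real (sqrt 2) else 0)" for P and b :: complex
  proof -
    have "of_real (sqrt 2) * of_real (sqrt 2) = (2 :: complex)"
      by (metis of_real_mult of_real_numeral real_sqrt_mult_self abs_numeral)
    then show ?thesis by (simp add: field_simps)
  qed
  ultimately show ?thesis unfolding * by (simp only:)
qed

text \<open>Source of the contradictions about zeros of F': a symmetry of F makes such a series
  vanish although its first coefficient does not. The half line is enough because the coefficient is
  an integral over (0, 1).\<close>

lemma odd_sine_series_zero:
  fixes \<beta> :: "nat \<Rightarrow> complex"
  assumes s: "summable (\<lambda>l. norm (\<beta> l))"
    and zero: "\<And>x. x \<ge> 0 \<Longrightarrow> (\<Sum>l. \<beta> l * sin (of_nat (2 * l + 1) * of_real x)) = 0"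
  shows "\<beta> 0 = 0"
proof -
  have z: "(\<Sum>l. \<beta> l * of_real (sin (real (2 * l + 1) * pi * x))) = 0" if "x \<ge> 0" for x
  proof -
    have "(\<lambda>l. \<beta> l * of_real (sin (real (2 * l + 1) * pi * x))) =
        (\<lambda>l. \<beta> l * sin (of_nat (2 * l + 1) * of_real (pi * x)))"
      by (simp add: fun_eq_iff mult.assoc flip: sin_of_real)
    then show ?thesis using zero[of "pi * x"] that by (simp only:) simp
  qed
  have "sine_coeff (\<lambda>x. \<Sum>l. \<beta> l * of_real (sin (real (2 * l + 1) * pi * x))) 1 =
      of_real (sqrt 2) * (LINT x|lebesgue_on {0<..<1::real}. 0)"
    unfolding sine_coeff_def
    by (intro arg_cong2[where f = "(*)"] refl Bochner_Integration.integral_cong)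
      (subst z, auto simp: space_restrict_space)
  moreover have "sine_coeff (\<lambda>x. \<Sum>l. \<beta> l * of_real (sin (real (2 * l + 1) * pi * x))) 1 =
      (\<Sum>l. if 2 * l + 1 = 1 then \<beta> l / of_real (sqrt 2) else 0)"
    by (rule sine_coeff_sine_series[OF s]) auto
  moreover have "(\<Sum>l. if 2 * l + 1 = 1 then \<beta> l / of_real (sqrt 2) else 0) = \<beta> 0 / of_real (sqrt 2)"
    by (subst suminf_finite[of "{0}"]) auto
  ultimately show ?thesis by simp
qed

section \<open>Zeros of the derivative\<close>

text \<open>Gronwall's argument: the energy |D|^2 + |D'|^2 grows at most at the rate 1 + |K|, so the
  damped energy \<open>W\<close> cannot rise above its initial value 0.\<close>

lemma second_order_ode_zero:
  fixes D D' DD :: "real \<Rightarrow> complex"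
  assumes d: "\<And>x. x \<ge> 0 \<Longrightarrow> (D has_vector_derivative D' x) (at x)"
    and d': "\<And>x. x \<ge> 0 \<Longrightarrow> (D' has_vector_derivative DD x) (at x)"
    and K: "\<And>x. x \<ge> 0 \<Longrightarrow> norm (DD x) \<le> K * norm (D x)"
    and init: "D 0 = 0" "D' 0 = 0" and x: "x \<ge> 0"
  shows "D x = 0"
proof -
  define E where "E x = D x \<bullet> D x + D' x \<bullet> D' x" for x
  define W where "W x = E x * exp (- (1 + \<bar>K\<bar>) * x)" for x
  have "W 0 \<ge> W x"
  proof (rule DERIV_nonpos_imp_nonincreasing[OF x])
    fix y :: real assume y: "0 \<le> y" "y \<le> x"
    have "(E has_real_derivative 2 * (D y \<bullet> D' y) + 2 * (D' y \<bullet> DD y)) (at y)"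
      unfolding E_def[abs_def] has_real_derivative_iff_has_vector_derivative
      by (rule derivative_eq_intros has_vector_derivative_add
           bounded_bilinear.has_vector_derivative[OF bounded_bilinear_inner] d d' y | simp add: y inner_commute)+
    then have W: "(W has_real_derivative (2 * (D y \<bullet> D' y) + 2 * (D' y \<bullet> DD y)) * exp (- (1 + \<bar>K\<bar>) * y)
        + E y * (exp (- (1 + \<bar>K\<bar>) * y) * (- (1 + \<bar>K\<bar>)))) (at y)"
      unfolding W_def[abs_def] by (auto intro!: derivative_eq_intros)
    have am: "2 * u * v \<le> u ^ 2 + v ^ 2" for u v :: real by (rule sum_squares_bound)
    have "2 * (D y \<bullet> D' y) \<le> 2 * norm (D y) * norm (D' y)"
      using norm_cauchy_schwarz[of "D y" "D' y"] by simp
    also have "\<dots> \<le> E y" using am[of "norm (D y)" "norm (D' y)"] by (simp add: E_def power2_norm_eq_inner)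
    finally have 1: "2 * (D y \<bullet> D' y) \<le> E y" .
    have "2 * (D' y \<bullet> DD y) \<le> 2 * (norm (D' y) * norm (DD y))"
      using norm_cauchy_schwarz[of "D' y" "DD y"] by simp
    also have "\<dots> \<le> 2 * (norm (D' y) * (\<bar>K\<bar> * norm (D y)))"
    proof -
      have "K * norm (D y) \<le> \<bar>K\<bar> * norm (D y)" by (simp add: mult_right_mono)
      then show ?thesis using K[of y] y by (intro mult_left_mono) auto
    qed
    also have "\<dots> = \<bar>K\<bar> * (2 * norm (D y) * norm (D' y))" by simp
    also have "\<dots> \<le> \<bar>K\<bar> * E y"
      using am[of "norm (D y)" "norm (D' y)"] by (intro mult_left_mono) (auto simp: E_def power2_norm_eq_inner)
    finally have 2: "2 * (D' y \<bullet> DD y) \<le> \<bar>K\<bar> * E y" .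
    have "(2 * (D y \<bullet> D' y) + 2 * (D' y \<bullet> DD y)) * exp (- (1 + \<bar>K\<bar>) * y) \<le> ((1 + \<bar>K\<bar>) * E y) * exp (- (1 + \<bar>K\<bar>) * y)"
      using 1 2 by (intro mult_right_mono) (auto simp: algebra_simps)
    then show "\<exists>w. (W has_real_derivative w) (at y) \<and> w \<le> 0"
      using W by (intro exI conjI) (auto simp: algebra_simps)
  qed
  moreover have "W 0 = 0" by (simp add: W_def E_def init)
  ultimately have "E x \<le> 0" by (simp add: W_def mult_le_0_iff)
  then have "D x \<bullet> D x \<le> 0" using inner_ge_zero[of "D' x"] unfolding E_def by linarith
  then show ?thesis by (metis inner_ge_zero inner_eq_zero_iff order_antisym)
qed

lemma norm_sin_series_le:
  assumes "exp_summable c b" "r < c"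
  obtains B where "B \<ge> 0" "\<And>z. \<bar>Im z\<bar> \<le> r \<Longrightarrow> norm (sin_series b z) \<le> B"
proof
  define B where "B = (\<Sum>l. norm (b l) * exp (r * real (2 * l + 1)))"
  have S: "summable (\<lambda>l. norm (b l) * exp (r * real (2 * l + 1)))"
    using assms by (auto simp: exp_summable_def)
  show "B \<ge> 0" unfolding B_def by (rule suminf_nonneg[OF S]) simp
  fix z assume z: "\<bar>Im z\<bar> \<le> r"
  show "norm (sin_series b z) \<le> B"
    unfolding sin_series_def B_def
  proof (rule norm_suminf_le[OF _ S])
    fix l
    have "exp (\<bar>Im z\<bar> * real (2 * l + 1)) \<le> exp (r * real (2 * l + 1))"
      using z by (simp add: mult_right_mono)
    then have "norm (sin (of_nat (2 * l + 1) * z)) \<le> exp (r * real (2 * l + 1))"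
      using norm_sin_mult_le[of "2 * l + 1" z] by linarith
    then show "norm (b l * sin (of_nat (2 * l + 1) * z)) \<le> norm (b l) * exp (r * real (2 * l + 1))"
      by (simp only: norm_mult mult_left_mono norm_ge_zero)
  qed
qed

lemma complex_line_derivative:
  assumes "(f has_field_derivative f') (at (z + of_real x * d))"
  shows "((\<lambda>x. f (z + of_real x * d)) has_vector_derivative f' * d) (at x)"
proof -
  have "((\<lambda>x. z + of_real x * d) has_vector_derivative d) (at x)"
    by (auto intro!: derivative_eq_intros)
  from field_vector_diff_chain_at[OF this assms] show ?thesis by (simp add: o_def mult.commute)
qed

section \<open>Symmetries of F\<close>

lemma odd_pi_half:
  "cos (of_nat (2 * l + 1) * of_real (pi / 2)) = (0 :: complex)"
  "sin (of_nat (2 * l + 1) * of_real pi) = (0 :: complex)"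
  "cos (of_nat (2 * l + 1) * of_real pi) = (- 1 :: complex)"
proof -
  have e: "of_nat (2 * l + 1) * of_real x = (of_real (real (2 * l + 1) * x) :: complex)" for x by simp
  have "cos (real (2 * l + 1) * (pi / 2)) = 0"
    by (simp add: distrib_right cos_add add_divide_distrib)
  then show "cos (of_nat (2 * l + 1) * of_real (pi / 2)) = (0 :: complex)"
    unfolding e cos_of_real by simp
  show "sin (of_nat (2 * l + 1) * of_real pi) = (0 :: complex)"
    unfolding e sin_of_real using sin_npi[of "2 * l + 1"] by simp
  show "cos (of_nat (2 * l + 1) * of_real pi) = (- 1 :: complex)"
    unfolding e cos_of_real using cos_npi[of "2 * l + 1"] by simp
qed

lemma sn_wave_reflect: "sn_wave c (of_real pi - z) = sn_wave c z"
  unfolding sn_wave_def sin_series_def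
  by (simp only: right_diff_distrib sin_diff odd_pi_half) simp

lemma sn_wave_sums:
  assumes "c > 0" "\<bar>Im z\<bar> < c"
  shows "(\<lambda>l. of_real (2 * csch_odd c (int l)) * sin (of_nat (2 * l + 1) * z)) sums sn_wave c z"
  unfolding sn_wave_def sin_series_def
  by (rule summable_sums[OF summable_norm_cancel[OF exp_summable_imp(1)[OF exp_summable_wave[OF assms(1)] assms(2)]]])

lemma sn_wave'_sums:
  assumes "c > 0" "\<bar>Im z\<bar> < c"
  shows "(\<lambda>l. of_nat (2 * l + 1) * of_real (2 * csch_odd c (int l)) * cos (of_nat (2 * l + 1) * z)) sums sn_wave' c z"
  unfolding sn_wave'_def cos_series_def
  by (rule summable_sums[OF summable_norm_cancel[OF exp_summable_imp(2)[OF exp_summable_mult_index[OF exp_summable_wave[OF assms(1)]] assms(2)]]])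

lemma sn_wave'_reflect:
  assumes "c > 0" "\<bar>Im z\<bar> < c"
  shows "sn_wave' c (of_real pi - z) = - sn_wave' c z"
proof -
  have "cos (of_nat (2 * l + 1) * (of_real pi - z)) = - cos (of_nat (2 * l + 1) * z)" for l
    by (simp only: right_diff_distrib cos_diff odd_pi_half) simp
  then have "(\<lambda>l. of_nat (2 * l + 1) * of_real (2 * csch_odd c (int l)) * cos (of_nat (2 * l + 1) * (of_real pi - z))) sums - sn_wave' c z"
    using sums_minus[OF sn_wave'_sums[OF assms]] by (simp only: mult_minus_right)
  moreover have "\<bar>Im (of_real pi - z)\<bar> < c" using assms by simp
  ultimately show ?thesis using sn_wave'_sums[of c "of_real pi - z"] assms sums_unique2 by blast
qed

lemma sn_wave_minus:
  assumes "c > 0" "\<bar>Im z\<bar> < c"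
  shows "sn_wave c (- z) = - sn_wave c z"
proof -
  have "(\<lambda>l. of_real (2 * csch_odd c (int l)) * sin (of_nat (2 * l + 1) * (- z))) sums - sn_wave c z"
    using sums_minus[OF sn_wave_sums[OF assms]] by (simp only: mult_minus_right sin_minus)
  moreover have "\<bar>Im (- z)\<bar> < c" using assms by simp
  ultimately show ?thesis using sn_wave_sums[of c "- z"] assms sums_unique2 by blast
qed

lemma sn_wave_cnj:
  assumes "c > 0" "\<bar>Im z\<bar> < c"
  shows "sn_wave c (cnj z) = cnj (sn_wave c z)"
proof -
  have "cnj (sin w) = sin (cnj w)" for w by (simp add: cnj_sin)
  then have "(\<lambda>l. of_real (2 * csch_odd c (int l)) * sin (of_nat (2 * l + 1) * cnj z)) sums cnj (sn_wave c z)"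
    using sn_wave_sums[OF assms, THEN sums_cnj[THEN iffD2]] by simp
  moreover have "\<bar>Im (cnj z)\<bar> < c" using assms by simp
  ultimately show ?thesis using sn_wave_sums[of c "cnj z"] assms sums_unique2 by blast
qed

lemma sn_wave'_cnj:
  assumes "c > 0" "\<bar>Im z\<bar> < c"
  shows "sn_wave' c (cnj z) = cnj (sn_wave' c z)"
proof -
  have "cnj (cos w) = cos (cnj w)" for w by (simp add: cnj_cos)
  then have "(\<lambda>l. of_nat (2 * l + 1) * of_real (2 * csch_odd c (int l)) * cos (of_nat (2 * l + 1) * cnj z)) sums cnj (sn_wave' c z)"
    using sn_wave'_sums[OF assms, THEN sums_cnj[THEN iffD2]] by simp
  moreover have "\<bar>Im (cnj z)\<bar> < c" using assms by simp
  ultimately show ?thesis using sn_wave'_sums[of c "cnj z"] assms sums_unique2 by blast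
qed

text \<open>Both sides solve p'' = 2 p^3 - C p in x, as d^2 = 1. Horizontal lines stay in the strip
  and F is bounded on each of them, so the cubic right-hand side has one Lipschitz constant for all
  x. With d = -1 a critical point becomes a centre of reflection; with d = 1 equal data at two
  points become equality along two parallel lines.\<close>

lemma sn_wave_lines_eq:
  assumes c: "c > 0" and d: "d = 1 \<or> d = -1"
    and u: "\<bar>Im u\<bar> < c" and v: "\<bar>Im v\<bar> < c"
    and init: "sn_wave c u = sn_wave c v" "sn_wave' c u = d * sn_wave' c v" and x: "x \<ge> 0"
  shows "sn_wave c (u + of_real x) = sn_wave c (v + of_real x * of_real d)"
proof -
  let ?F = "sn_wave c" and ?G = "sn_wave' c"
  define C where "C = (of_real (wave_const c) :: complex)"
  define p where "p x = ?F (u + of_real x * 1)" for x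
  define q where "q x = ?F (v + of_real x * of_real d)" for x
  have im: "\<bar>Im (u + of_real x * 1)\<bar> < c" "\<bar>Im (v + of_real x * of_real d)\<bar> < c" for x
    using u v by auto
  obtain B1 where B1: "\<And>z. \<bar>Im z\<bar> \<le> \<bar>Im u\<bar> \<Longrightarrow> norm (?F z) \<le> B1"
    unfolding sn_wave_def using norm_sin_series_le[OF exp_summable_wave[OF c] u] by blast
  obtain B2 where B2: "\<And>z. \<bar>Im z\<bar> \<le> \<bar>Im v\<bar> \<Longrightarrow> norm (?F z) \<le> B2"
    unfolding sn_wave_def using norm_sin_series_le[OF exp_summable_wave[OF c] v] by blast
  define B where "B = max B1 B2"
  have pq: "norm (p x) \<le> B" "norm (q x) \<le> B" for x
  proof -
    have "norm (p x) \<le> B1" unfolding p_def by (rule B1) simp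
    moreover have "norm (q x) \<le> B2" unfolding q_def by (rule B2) simp
    ultimately show "norm (p x) \<le> B" "norm (q x) \<le> B" by (auto simp: B_def)
  qed
  have B0: "B \<ge> 0" using pq(1)[of 0] norm_ge_zero[of "p 0"] by linarith
  have dd: "of_real d * of_real d = (1 :: complex)" using d by auto
  have "p x - q x = 0"
  proof (rule second_order_ode_zero[where K = "2 * (B ^ 2 + B * B + B ^ 2) + norm C"
        and D' = "\<lambda>x. ?G (u + of_real x * 1) * 1 - ?G (v + of_real x * of_real d) * of_real d"
        and DD = "\<lambda>x. (2 * p x ^ 3 - C * p x) - (2 * q x ^ 3 - C * q x)"])
    show "((\<lambda>x. p x - q x) has_vector_derivative
       ?G (u + of_real x * 1) * 1 - ?G (v + of_real x * of_real d) * of_real d) (at x)" for x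
      unfolding p_def q_def
      by (intro has_vector_derivative_diff complex_line_derivative has_derivative_sn_wave c im)
    show "((\<lambda>x. ?G (u + of_real x * 1) * 1 - ?G (v + of_real x * of_real d) * of_real d) has_vector_derivative
       (2 * p x ^ 3 - C * p x) - (2 * q x ^ 3 - C * q x)) (at x)" for x
    proof -
      have "((\<lambda>x. ?G (u + of_real x * 1) * 1) has_vector_derivative (2 * p x ^ 3 - C * p x) * 1 * 1) (at x)"
        unfolding p_def C_def
        by (intro has_vector_derivative_mult_left complex_line_derivative has_derivative_sn_wave' c im)
      moreover have "((\<lambda>x. ?G (v + of_real x * of_real d) * of_real d) has_vector_derivative (2 * q x ^ 3 - C * q x) * of_real d * of_real d) (at x)"
        unfolding q_def C_def
        by (intro has_vector_derivative_mult_left complex_line_derivative has_derivative_sn_wave' c im)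
      ultimately show ?thesis
        using has_vector_derivative_diff by (simp only: mult.assoc dd mult_1_right) blast
    qed
    show "norm ((2 * p x ^ 3 - C * p x) - (2 * q x ^ 3 - C * q x)) \<le> (2 * (B ^ 2 + B * B + B ^ 2) + norm C) * norm (p x - q x)" for x
    proof -
      have "(2 * p x ^ 3 - C * p x) - (2 * q x ^ 3 - C * q x) = (2 * (p x ^ 2 + p x * q x + q x ^ 2) - C) * (p x - q x)"
        by (simp add: power2_eq_square power3_eq_cube algebra_simps)
      moreover have "norm (2 * (p x ^ 2 + p x * q x + q x ^ 2) - C) \<le> 2 * (B ^ 2 + B * B + B ^ 2) + norm C"
      proof -
        have "norm (p x ^ 2) \<le> B ^ 2" "norm (p x * q x) \<le> B * B" "norm (q x ^ 2) \<le> B ^ 2"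
          using pq B0 by (auto simp: norm_power norm_mult intro!: power_mono mult_mono)
        then have "norm (p x ^ 2 + p x * q x + q x ^ 2) \<le> B ^ 2 + B * B + B ^ 2"
          by (meson add_mono norm_triangle_le)
        then have "norm (2 * (p x ^ 2 + p x * q x + q x ^ 2)) \<le> 2 * (B ^ 2 + B * B + B ^ 2)"
          by (simp only: norm_mult norm_numeral mult_left_mono)
        then show ?thesis using norm_triangle_ineq4[of "2 * (p x ^ 2 + p x * q x + q x ^ 2)" C] by linarith
      qed
      ultimately show ?thesis by (simp only: norm_mult mult_right_mono norm_ge_zero)
    qed
    show "p 0 - q 0 = 0" using init by (simp add: p_def q_def)
    show "?G (u + of_real 0 * 1) * 1 - ?G (v + of_real 0 * of_real d) * of_real d = 0"
      using init(2) by (simp add: mult.commute)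
  qed (rule x)
  then show ?thesis by (simp add: p_def q_def)
qed

lemma summable_wave_mult:
  assumes "c > 0" "\<And>l. norm (h l) \<le> B * exp (r * real (2 * l + 1))" "r < c"
  shows "summable (\<lambda>l. norm (of_real (2 * csch_odd c (int l)) * h l :: complex))"
proof (rule summable_comparison_test'[where N = 0])
  show "summable (\<lambda>l. B * (norm (of_real (2 * csch_odd c (int l)) :: complex) * exp (r * real (2 * l + 1))))"
    using exp_summable_wave[OF assms(1)] assms(3) unfolding exp_summable_def by (intro summable_mult) blast
  fix l
  have "norm (of_real (2 * csch_odd c (int l)) :: complex) * norm (h l)
      \<le> norm (of_real (2 * csch_odd c (int l)) :: complex) * (B * exp (r * real (2 * l + 1)))"
    by (rule mult_left_mono[OF assms(2)]) simp
  then show "norm (norm (of_real (2 * csch_odd c (int l)) * h l :: complex)) \<le>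
      B * (norm (of_real (2 * csch_odd c (int l)) :: complex) * exp (r * real (2 * l + 1)))"
    by (simp only: norm_mult real_norm_def abs_mult abs_norm_cancel mult_ac)
qed

lemma csch_odd_0_pos: "c > 0 \<Longrightarrow> csch_odd c 0 > 0"
  by (simp add: csch_odd_def)

section \<open>No critical points on the real quarter period and on the vertical segment\<close>

text \<open>If F' vanished at x0, then F would be even about x0 and, being odd, satisfy F (s + x) =
  - F x with s = 2 x0. For the first harmonic this means cos s = -1, impossible for 0 < s <
  pi.\<close>

lemma sn_wave'_nonzero_real:
  assumes c: "c > 0" and x0: "0 < x0" "x0 < pi / 2"
  shows "sn_wave' c (of_real x0) \<noteq> 0"
proof
  assume z: "sn_wave' c (of_real x0) = 0"
  let ?F = "sn_wave c"
  have refl: "?F (of_real x0 + of_real x) = ?F (of_real x0 - of_real x)" for x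
  proof -
    have *: "?F (of_real x0 + of_real x) = ?F (of_real x0 - of_real x)" if "x \<ge> 0" for x
      using sn_wave_lines_eq[OF c, of "-1" "of_real x0" "of_real x0" x] z c that by simp
    show ?thesis using *[of x] *[of "- x"] by (cases "x \<ge> 0") auto
  qed
  define s where "s = 2 * x0"
  have sh: "?F (of_real s + of_real x) = ?F (- of_real x)" for x
    using refl[of "x0 + x"] by (simp add: s_def algebra_simps)
  define b where "b l = (of_real (2 * csch_odd c (int l)) :: complex)" for l
  \<comment> \<open>F (s + x) - F (s - x) + 2 F x vanishes, and this combination is odd in x, hence
    a pure sine series with the coefficients shown.\<close>
  have "b 0 * (2 * cos (of_nat (2 * 0 + 1) * of_real s) + 2) = 0"
  proof (rule odd_sine_series_zero)
    show "summable (\<lambda>l. norm (b l * (2 * cos (of_nat (2 * l + 1) * of_real s) + 2)))"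
      unfolding b_def
    proof (rule summable_wave_mult[OF c _ c])
      fix l
      have "norm (cos (of_nat (2 * l + 1) * of_real s :: complex)) \<le> 1"
        using norm_cos_mult_le[of "2 * l + 1" "of_real s"] by simp
      then have "norm (2 * cos (of_nat (2 * l + 1) * of_real s :: complex)) \<le> 2" by (simp only: norm_mult) simp
      then show "norm (2 * cos (of_nat (2 * l + 1) * of_real s) + 2 :: complex) \<le> 4 * exp (0 * real (2 * l + 1))"
        by (intro order_trans[OF norm_triangle_ineq]) simp
    qed
    fix x :: real
    have "(\<lambda>l. b l * sin (of_nat (2 * l + 1) * (of_real s + of_real x)) - b l * sin (of_nat (2 * l + 1) * (of_real s - of_real x))
        + 2 * (b l * sin (of_nat (2 * l + 1) * of_real x))) sums
        (?F (of_real s + of_real x) - ?F (of_real s - of_real x) + 2 * ?F (of_real x))"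
      unfolding b_def by (intro sums_add sums_diff sums_mult sn_wave_sums c) (use c in auto)
    moreover have "?F (of_real s + of_real x) - ?F (of_real s - of_real x) + 2 * ?F (of_real x) = 0"
      using sh[of x] sh[of "- x"] sn_wave_minus[OF c, of "of_real x"] c by simp
    moreover have "b l * sin (of_nat (2 * l + 1) * (of_real s + of_real x)) - b l * sin (of_nat (2 * l + 1) * (of_real s - of_real x))
        + 2 * (b l * sin (of_nat (2 * l + 1) * of_real x)) =
        b l * (2 * cos (of_nat (2 * l + 1) * of_real s) + 2) * sin (of_nat (2 * l + 1) * of_real x)" for l
      unfolding distrib_left right_diff_distrib sin_add sin_diff by (simp add: algebra_simps)
    ultimately have "(\<lambda>l. b l * (2 * cos (of_nat (2 * l + 1) * of_real s) + 2) * sin (of_nat (2 * l + 1) * of_real x)) sums 0"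
      by simp
    then show "(\<Sum>l. b l * (2 * cos (of_nat (2 * l + 1) * of_real s) + 2) * sin (of_nat (2 * l + 1) * of_real x)) = 0"
      by (simp only: sums_iff)
  qed
  moreover have "b 0 \<noteq> 0" using csch_odd_0_pos[OF c] by (simp add: b_def)
  ultimately have "of_real (2 * cos s + 2) = (0 :: complex)" by (simp add: cos_of_real)
  then have "2 * cos s + 2 = 0" by (simp only: of_real_eq_0_iff)
  then have "cos s = -1" by simp
  moreover have "cos pi < cos s" using x0 by (intro cos_monotone_0_pi) (auto simp: s_def)
  ultimately show False by simp
qed

text \<open>The mirror image pi/2 - i y0 of the point under z to pi - z would carry the same values
  of F and F', so F would agree on the two horizontal lines through them. The difference is a sine
  series whose first coefficient is a nonzero multiple of sin (i y0).\<close>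

lemma sn_wave'_nonzero_vertical:
  assumes c: "c > 0" and y0: "0 < y0" "y0 < c"
  shows "sn_wave' c (of_real (pi / 2) + \<i> * of_real y0) \<noteq> 0"
proof
  assume z: "sn_wave' c (of_real (pi / 2) + \<i> * of_real y0) = 0"
  let ?F = "sn_wave c"
  define h where "h = (of_real (pi / 2) :: complex)"
  define w where "w = \<i> * of_real y0"
  have im: "\<bar>Im (h + w)\<bar> < c" "\<bar>Im (h - w)\<bar> < c" using y0 by (auto simp: h_def w_def)
  have hw: "of_real pi - (h + w) = h - w" by (simp add: h_def algebra_simps)
  have "?F (h - w) = ?F (h + w)" "sn_wave' c (h - w) = 0"
    using sn_wave_reflect[of c "h + w"] sn_wave'_reflect[OF c im(1)] z unfolding hw h_def w_def by auto
  then have eq: "?F (h + w + of_real x) = ?F (h - w + of_real x)" if "x \<ge> 0" for x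
    using sn_wave_lines_eq[OF c _ im, of 1 x] that z unfolding h_def w_def by simp
  define b where "b l = (of_real (2 * csch_odd c (int l)) :: complex)" for l
  define k where "k l = 2 * sin (of_nat (2 * l + 1) * h) * sin (of_nat (2 * l + 1) * w)" for l
  have "b 0 * k 0 = 0"
  proof (rule odd_sine_series_zero)
    \<comment> \<open>Relative to \<open>b l\<close> the coefficients grow like exp (y0 (2 l + 1));
      the series still converges because y0 < c.\<close>
    show "summable (\<lambda>l. norm (b l * k l))"
      unfolding b_def
    proof (rule summable_wave_mult[OF c _ y0(2)])
      fix l
      have "norm (sin (of_nat (2 * l + 1) * h)) \<le> 1"
        using norm_sin_mult_le[of "2 * l + 1" h] by (simp add: h_def)
      moreover have "norm (sin (of_nat (2 * l + 1) * w)) \<le> exp (y0 * real (2 * l + 1))"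
        using norm_sin_mult_le[of "2 * l + 1" w] y0 by (simp add: w_def)
      ultimately have "norm (sin (of_nat (2 * l + 1) * h)) * norm (sin (of_nat (2 * l + 1) * w)) \<le> 1 * exp (y0 * real (2 * l + 1))"
        by (intro mult_mono) auto
      then show "norm (k l) \<le> 2 * exp (y0 * real (2 * l + 1))"
        unfolding k_def norm_mult by simp
    qed
    fix x :: real assume "x \<ge> 0"
    have "(\<lambda>l. b l * sin (of_nat (2 * l + 1) * (h - w + of_real x)) - b l * sin (of_nat (2 * l + 1) * (h + w + of_real x))) sums
        (?F (h - w + of_real x) - ?F (h + w + of_real x))"
      unfolding b_def by (intro sums_diff sn_wave_sums c) (use im in auto)
    moreover have "b l * sin (of_nat (2 * l + 1) * (h - w + of_real x)) - b l * sin (of_nat (2 * l + 1) * (h + w + of_real x)) =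
        b l * k l * sin (of_nat (2 * l + 1) * of_real x)" for l
    proof -
      have "cos (of_nat (2 * l + 1) * h) = 0" unfolding h_def by (rule odd_pi_half)
      then show ?thesis
        unfolding k_def distrib_left right_diff_distrib sin_add sin_diff cos_add cos_diff by (simp add: algebra_simps)
    qed
    ultimately show "(\<Sum>l. b l * k l * sin (of_nat (2 * l + 1) * of_real x)) = 0"
      using eq[OF \<open>x \<ge> 0\<close>] by (simp only: sums_iff) simp
  qed
  moreover have "b 0 \<noteq> 0" using csch_odd_0_pos[OF c] by (simp add: b_def)
  moreover have "sin h = 1" unfolding h_def by (subst sin_of_real) simp
  ultimately have "sin (\<i> * of_real y0) = 0" by (simp add: k_def w_def)
  then have "exp (\<i> * (\<i> * of_real y0)) = exp (- (\<i> * (\<i> * of_real y0)))" by (simp add: sin_exp_eq)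
  then have "exp (- of_real y0) = (exp (of_real y0) :: complex)" by (simp flip: mult.assoc)
  then have "exp (- y0) = exp y0" by (metis exp_of_real of_real_eq_iff of_real_minus)
  then show False using y0 by simp
qed

section \<open>The elliptic integral and the nome\<close>

definition sn_integrand :: "real \<Rightarrow> real \<Rightarrow> real" where
  "sn_integrand \<mu> t = (1 - t\<^sup>2) powr (-1/2) * (1 - \<mu>\<^sup>2 * t\<^sup>2) powr (-1/2)"

lemma powr_minus_half: "x \<ge> 0 \<Longrightarrow> x powr - (1 / 2) = inverse (sqrt x)"
  using powr_minus[of x "1/2"] by (simp add: powr_half_sqrt)

lemma power2_mult_less_1:
  fixes \<mu> t :: real
  assumes "0 \<le> \<mu>" "\<mu> < 1" "0 \<le> t" "t \<le> 1"
  shows "\<mu>\<^sup>2 * t\<^sup>2 < 1"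
proof -
  have "\<mu> * t \<le> \<mu> * 1" using assms by (intro mult_left_mono) auto
  then have "\<mu> * t < 1" using assms by linarith
  then have "(\<mu> * t)\<^sup>2 < 1" using assms by (simp add: power_less_one_iff abs_square_less_1)
  then show ?thesis by (simp add: power_mult_distrib)
qed

lemma sn_integrand_eq:
  assumes "0 \<le> \<mu>" "\<mu> < 1" "0 \<le> t" "t < 1"
  shows "sn_integrand \<mu> t = 1 / sqrt ((1 - t\<^sup>2) * (1 - \<mu>\<^sup>2 * t\<^sup>2))"
proof -
  have "\<mu>\<^sup>2 * t\<^sup>2 < 1" "t\<^sup>2 < 1" using power2_mult_less_1[of \<mu> t] assms by (auto simp: abs_square_less_1)
  then show ?thesis by (simp add: sn_integrand_def powr_minus_half real_sqrt_mult inverse_eq_divide)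
qed

lemma sn_integrand_nonneg: "sn_integrand \<mu> t \<ge> 0"
  by (simp add: sn_integrand_def)

lemma sn_integrand_ge_1:
  assumes "0 \<le> \<mu>" "\<mu> < 1" "0 \<le> t" "t < 1"
  shows "sn_integrand \<mu> t \<ge> 1"
proof -
  have *: "\<mu>\<^sup>2 * t\<^sup>2 < 1" "t\<^sup>2 < 1" using power2_mult_less_1[of \<mu> t] assms by (auto simp: abs_square_less_1)
  then have "(1 - t\<^sup>2) * (1 - \<mu>\<^sup>2 * t\<^sup>2) \<le> 1" by (intro mult_le_one) auto
  then have "sqrt ((1 - t\<^sup>2) * (1 - \<mu>\<^sup>2 * t\<^sup>2)) \<le> 1" by simp
  moreover have "(1 - t\<^sup>2) * (1 - \<mu>\<^sup>2 * t\<^sup>2) > 0" using * by (intro mult_pos_pos) auto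
  ultimately show ?thesis unfolding sn_integrand_eq[OF assms] by simp
qed

lemma sn_integrand_continuous:
  assumes "0 \<le> \<mu>" "\<mu> < 1" "w < 1"
  shows "continuous_on {0..w} (sn_integrand \<mu>)"
proof -
  have "1 - t\<^sup>2 \<noteq> 0" "1 - \<mu>\<^sup>2 * t\<^sup>2 \<noteq> 0" if "t \<in> {0..w}" for t
    using power2_mult_less_1[of \<mu> t] assms that abs_square_less_1[of t] by auto
  then show ?thesis unfolding sn_integrand_def by (intro continuous_intros) auto
qed

text \<open>The first factor is the derivative of arcsin, and the second is bounded by its value at
  t = 1 because \<mu> < 1.\<close>

lemma sn_integrand_integrable:
  assumes "0 \<le> \<mu>" "\<mu> < 1"
  shows "sn_integrand \<mu> integrable_on {0..1}"
proof -
  have "((\<lambda>t. (1 - t\<^sup>2) powr (-1/2)) has_integral (arcsin 1 - arcsin 0)) {0..1}"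
  proof (rule fundamental_theorem_of_calculus_interior)
    show "continuous_on {0..1} arcsin" by (rule continuous_on_subset[OF continuous_on_arcsin']) auto
    fix x :: real assume x: "x \<in> {0<..<1}"
    then have "1 - x\<^sup>2 \<ge> 0" by (simp add: abs_square_le_1)
    then show "(arcsin has_vector_derivative (1 - x\<^sup>2) powr (-1/2)) (at x)"
      using DERIV_arcsin[of x] x by (simp add: powr_minus_half has_real_derivative_iff_has_vector_derivative)
  qed simp
  then have i: "(\<lambda>t. (1 - t\<^sup>2) powr (-1/2) * (1 - \<mu>\<^sup>2) powr (-1/2)) integrable_on {0..1}"
    by (intro integrable_on_mult_left) (auto simp: integrable_on_def)
  show ?thesis
  proof (rule measurable_bounded_by_integrable_imp_integrable[OF _ i])
    have "(\<lambda>t. (1 - t\<^sup>2) powr (-1/2) * (1 - \<mu>\<^sup>2 * t\<^sup>2) powr (-1/2)) \<in> borel_measurable borel"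
      by measurable
    then have "sn_integrand \<mu> \<in> borel_measurable lborel" unfolding sn_integrand_def[abs_def] by simp
    then show "sn_integrand \<mu> \<in> borel_measurable (lebesgue_on {0..1})"
      by (intro measurable_restrict_space1 measurable_completion)
    fix t :: real assume t: "t \<in> {0..1}"
    have "\<mu>\<^sup>2 * t\<^sup>2 \<le> \<mu>\<^sup>2" using t by (simp add: mult_left_le abs_square_le_1)
    moreover have "\<mu>\<^sup>2 < 1" using assms by (simp add: abs_square_less_1)
    ultimately have "(1 - \<mu>\<^sup>2 * t\<^sup>2) powr (-1/2) \<le> (1 - \<mu>\<^sup>2) powr (-1/2)"
      by (intro powr_mono2') auto
    then show "norm (sn_integrand \<mu> t) \<le> (1 - t\<^sup>2) powr (-1/2) * (1 - \<mu>\<^sup>2) powr (-1/2)"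
      by (simp add: sn_integrand_def mult_left_mono)
  qed simp
qed

lemma arcsn_eq: "arcsn \<mu> z = integral {0..z} (sn_integrand \<mu>)"
  by (simp add: arcsn_def sn_integrand_def[abs_def])

lemma arcsn_0: "arcsn \<mu> 0 = 0"
  by (simp add: arcsn_eq)

lemma arcsn_continuous:
  assumes "0 \<le> \<mu>" "\<mu> < 1"
  shows "continuous_on {0..1} (arcsn \<mu>)"
  using indefinite_integral_continuous_1[OF sn_integrand_integrable[OF assms]]
  by (simp add: arcsn_eq[abs_def])

lemma arcsn_derivative:
  assumes "0 \<le> \<mu>" "\<mu> < 1" "0 < z" "z < 1"
  shows "(arcsn \<mu> has_real_derivative 1 / sqrt ((1 - z\<^sup>2) * (1 - \<mu>\<^sup>2 * z\<^sup>2))) (at z)"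
proof -
  obtain w where w: "z < w" "w < 1" using assms dense by blast
  have "(arcsn \<mu> has_real_derivative sn_integrand \<mu> z) (at z within {0..w})"
    unfolding arcsn_eq[abs_def]
    by (rule integral_has_real_derivative) (use sn_integrand_continuous assms w in auto)
  moreover have "at z within {0..w} = at z"
    by (rule at_within_Icc_at) (use assms w in auto)
  ultimately show ?thesis using assms by (simp add: sn_integrand_eq)
qed

text \<open>T solves the separable equation of the elliptic sine with speed b, so elapsed time is
  the elliptic integral. The equation is required on the open interval only, since the integrand
  blows up at 1; the end points follow by continuity. Used for F on the real axis and, after a
  substitution, on the vertical segment.\<close>

lemma arcsn_time_map:
  assumes \<mu>: "0 \<le> \<mu>" "\<mu> < 1"
    and cont: "continuous_on {0..L} T" and T0: "T 0 = 0"
    and T01: "\<And>s. 0 < s \<Longrightarrow> s < L \<Longrightarrow> 0 < T s \<and> T s < 1" and TL: "0 \<le> T L" "T L \<le> 1"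
    and deriv: "\<And>s. 0 < s \<Longrightarrow> s < L \<Longrightarrow>
      (T has_real_derivative b * sqrt ((1 - (T s)\<^sup>2) * (1 - \<mu>\<^sup>2 * (T s)\<^sup>2))) (at s)"
    and s: "0 \<le> s" "s \<le> L"
  shows "arcsn \<mu> (T s) = b * s"
proof (cases "s = 0")
  case True then show ?thesis by (simp add: T0 arcsn_0)
next
  case False
  then have s0: "0 < s" using s by simp
  define G where "G s = arcsn \<mu> (T s) - b * s" for s
  have "G s = G 0"
  proof (rule DERIV_isconst_end[OF s0])
    have T: "T x \<in> {0..1}" if x: "x \<in> {0..L}" for x
    proof -
      consider "x = 0" | "x = L" | "0 < x" "x < L" using x by (auto simp: le_less)
      then show ?thesis using T0 T01[of x] TL by cases auto
    qed
    have "continuous_on {0..L} G"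
      unfolding G_def
      by (intro continuous_intros continuous_on_compose2[OF arcsn_continuous[OF \<mu>] cont]) (use T in auto)
    then show "continuous_on {0..s} G" by (rule continuous_on_subset) (use s in auto)
    fix x assume x: "0 < x" "x < s"
    then have Tx: "0 < T x" "T x < 1" using T01[of x] s by auto
    have "\<mu>\<^sup>2 * (T x)\<^sup>2 < 1" using power2_mult_less_1[of \<mu> "T x"] \<mu> Tx by simp
    moreover have "(T x)\<^sup>2 < 1" using Tx by (simp add: abs_square_less_1)
    ultimately have nz: "sqrt ((1 - (T x)\<^sup>2) * (1 - \<mu>\<^sup>2 * (T x)\<^sup>2)) \<noteq> 0" by simp
    have "x < L" using x s by simp
    from DERIV_chain2[OF arcsn_derivative[OF \<mu> Tx] deriv[OF x(1) this]]
    have "((\<lambda>x. arcsn \<mu> (T x)) has_real_derivative b) (at x)" using nz by simp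
    then show "(G has_real_derivative 0) (at x)"
      unfolding G_def by (auto intro!: derivative_eq_intros)
  qed
  then show ?thesis by (simp add: G_def T0 arcsn_0)
qed

lemma ellK_pos:
  assumes "0 \<le> \<mu>" "\<mu> < 1"
  shows "ellK \<mu> > 0"
proof -
  have "integral {0..1/2} (\<lambda>t::real. 1 :: real) \<le> integral {0..1/2} (sn_integrand \<mu>)"
    by (rule integral_le)
       (use assms sn_integrand_ge_1 integrable_on_subinterval[OF sn_integrand_integrable[OF assms]] in auto)
  also have "\<dots> \<le> integral {0..1} (sn_integrand \<mu>)"
    by (rule integral_subset_le)
       (use assms sn_integrand_nonneg integrable_on_subinterval[OF sn_integrand_integrable[OF assms]]
          sn_integrand_integrable[OF assms] in auto)
  finally show ?thesis by (simp add: ellK_def arcsn_eq)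
qed

section \<open>Dependence of the period and of the nome on the modulus\<close>

text \<open>The integrands are ordered on [0, 1], and they differ at 1/2. Strictness is drawn from
  [0, 1/2], where both are continuous.\<close>

lemma ellK_strict_mono:
  assumes "0 \<le> \<mu>" "\<mu> < \<nu>" "\<nu> < 1"
  shows "ellK \<mu> < ellK \<nu>"
proof -
  define \<psi> where "\<psi> t = sn_integrand \<nu> t - sn_integrand \<mu> t" for t
  have \<mu>: "0 \<le> \<mu>" "\<mu> < 1" and \<nu>: "0 \<le> \<nu>" "\<nu> < 1" using assms by auto
  note iu = sn_integrand_integrable[OF \<mu>] and iv = sn_integrand_integrable[OF \<nu>]
  have i: "\<psi> integrable_on {0..1}" unfolding \<psi>_def by (rule integrable_diff[OF iv iu])
  have sq: "\<mu>\<^sup>2 < \<nu>\<^sup>2" using assms by (intro power_strict_mono) auto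
  have pos: "\<psi> t \<ge> 0" if "t \<in> {0..1}" for t
  proof -
    have "\<mu>\<^sup>2 * t\<^sup>2 \<le> \<nu>\<^sup>2 * t\<^sup>2" using sq by (intro mult_right_mono) auto
    then have "(1 - \<mu>\<^sup>2 * t\<^sup>2) powr (-1/2) \<le> (1 - \<nu>\<^sup>2 * t\<^sup>2) powr (-1/2)"
      using power2_mult_less_1[OF \<nu>, of t] that by (intro powr_mono2') auto
    then show ?thesis by (simp add: \<psi>_def sn_integrand_def mult_left_mono)
  qed
  have pos': "\<psi> (1/2) \<noteq> 0"
  proof
    assume "\<psi> (1/2) = 0"
    then have "sqrt ((1 - (1/2)\<^sup>2) * (1 - \<nu>\<^sup>2 * (1/2)\<^sup>2)) = sqrt ((1 - (1/2)\<^sup>2) * (1 - \<mu>\<^sup>2 * (1/2)\<^sup>2))"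
      unfolding \<psi>_def using sn_integrand_eq[OF \<mu>, of "1/2"] sn_integrand_eq[OF \<nu>, of "1/2"] by simp
    then show False using sq by (simp add: power2_eq_square)
  qed
  have c: "continuous_on {0..1/2} \<psi>"
    unfolding \<psi>_def by (intro continuous_intros sn_integrand_continuous) (use assms in auto)
  have "integral {0..1/2} \<psi> \<noteq> 0"
    using integral_eq_0_iff[OF c, of ] pos pos' by (auto simp: Ball_def)
  moreover have "integral {0..1/2} \<psi> \<ge> 0"
    by (rule integral_nonneg[OF integrable_continuous_real[OF c]]) (use pos in auto)
  moreover have "integral {0..1/2} \<psi> \<le> integral {0..1} \<psi>"
    by (rule integral_subset_le[OF _ integrable_continuous_real[OF c] i]) (use pos in auto)
  moreover have "integral {0..1} \<psi> = ellK \<nu> - ellK \<mu>"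
    unfolding \<psi>_def ellK_def arcsn_eq by (rule integral_diff[OF iv iu])
  ultimately show ?thesis by linarith
qed

text \<open>K increases with the modulus, while K of the complementary modulus decreases.\<close>

lemma nome_strict_mono:
  assumes "0 < \<mu>" "\<mu> < \<nu>" "\<nu> < 1"
  shows "nome \<mu> < nome \<nu>"
proof -
  have sq: "\<mu>\<^sup>2 < \<nu>\<^sup>2" using assms by (intro power_strict_mono) auto
  have n1: "\<nu>\<^sup>2 < 1" "0 < \<mu>\<^sup>2" using assms by (auto simp: abs_square_less_1)
  have K: "ellK \<mu> < ellK \<nu>" using ellK_strict_mono assms by simp
  have K': "ellK (sqrt (1 - \<nu>\<^sup>2)) < ellK (sqrt (1 - \<mu>\<^sup>2))"
    by (rule ellK_strict_mono) (use sq n1 in auto)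
  have p: "ellK \<mu> > 0" "ellK (sqrt (1 - \<nu>\<^sup>2)) > 0"
    using ellK_pos[of \<mu>] ellK_pos[of "sqrt (1 - \<nu>\<^sup>2)"] assms n1 sq by auto
  have "ellK (sqrt (1 - \<nu>\<^sup>2)) / ellK \<nu> < ellK (sqrt (1 - \<mu>\<^sup>2)) / ellK \<mu>"
    by (rule frac_less) (use K K' p in auto)
  then have "pi * (ellK (sqrt (1 - \<nu>\<^sup>2)) / ellK \<nu>) < pi * (ellK (sqrt (1 - \<mu>\<^sup>2)) / ellK \<mu>)"
    by (rule mult_strict_left_mono) simp
  then show ?thesis by (simp add: nome_def)
qed

lemma nome_inj:
  assumes "0 < \<mu>" "\<mu> < 1" "0 < \<nu>" "\<nu> < 1" "nome \<mu> = nome \<nu>"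
  shows "\<mu> = \<nu>"
  using nome_strict_mono[of \<mu> \<nu>] nome_strict_mono[of \<nu> \<mu>] assms by (cases \<mu> \<nu> rule: linorder_cases) auto

section \<open>Real and vertical lines\<close>

definition sn_real :: "real \<Rightarrow> real \<Rightarrow> real" where
  "sn_real c x = Re (sn_wave c (of_real x))"

definition sn_real' :: "real \<Rightarrow> real \<Rightarrow> real" where
  "sn_real' c x = Re (sn_wave' c (of_real x))"

definition sn_vert :: "real \<Rightarrow> real \<Rightarrow> real" where
  "sn_vert c y = Re (sn_wave c (of_real (pi / 2) + of_real y * \<i>))"

text \<open>The factor i is the direction of the line, so this is the derivative with respect to
  y.\<close>

definition sn_vert' :: "real \<Rightarrow> real \<Rightarrow> real" where
  "sn_vert' c y = Re (sn_wave' c (of_real (pi / 2) + of_real y * \<i>) * \<i>)"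

context
  fixes c :: real
  assumes c: "c > 0"
begin

lemma of_real_sn_real:
  "of_real (sn_real c x) = sn_wave c (of_real x)" "of_real (sn_real' c x) = sn_wave' c (of_real x)"
  using sn_wave_cnj[OF c, of "of_real x"] sn_wave'_cnj[OF c, of "of_real x"] c
  by (auto simp: sn_real_def sn_real'_def complex_eq_iff)

text \<open>On Re z = pi/2 conjugation coincides with the reflection z to pi - z, under which F is
  even and F' is odd. Hence F is real there and F' imaginary.\<close>

lemma of_real_sn_vert:
  assumes "\<bar>y\<bar> < c"
  shows "of_real (sn_vert c y) = sn_wave c (of_real (pi / 2) + of_real y * \<i>)"
    "of_real (sn_vert' c y) = sn_wave' c (of_real (pi / 2) + of_real y * \<i>) * \<i>"
proof -
  define z where "z = of_real (pi / 2) + of_real y * \<i>"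
  have z: "\<bar>Im z\<bar> < c" using assms by (simp add: z_def)
  have e: "cnj z = of_real pi - z" by (simp add: z_def complex_eq_iff)
  have "cnj (sn_wave c z) = sn_wave c z" using sn_wave_cnj[OF c z] sn_wave_reflect[of c z] by (simp add: e)
  moreover have "cnj (sn_wave' c z) = - sn_wave' c z"
    using sn_wave'_cnj[OF c z] sn_wave'_reflect[OF c z] by (simp add: e)
  ultimately show "of_real (sn_vert c y) = sn_wave c (of_real (pi / 2) + of_real y * \<i>)"
    "of_real (sn_vert' c y) = sn_wave' c (of_real (pi / 2) + of_real y * \<i>) * \<i>"
    unfolding sn_vert_def sn_vert'_def z_def by (auto simp: complex_eq_iff)
qed

lemma sn_real_derivative: "(sn_real c has_real_derivative sn_real' c x) (at x)"
proof -
  have "(sn_wave c has_field_derivative sn_wave' c (0 + of_real x * 1)) (at (0 + of_real x * 1))"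
    by (rule has_derivative_sn_wave[OF c]) (use c in simp)
  from bounded_linear.has_vector_derivative[OF bounded_linear_Re complex_line_derivative[OF this]]
  show ?thesis by (simp add: sn_real_def[abs_def] sn_real'_def has_real_derivative_iff_has_vector_derivative)
qed

lemma sn_real'_derivative:
  "(sn_real' c has_real_derivative 2 * sn_real c x ^ 3 - wave_const c * sn_real c x) (at x)"
proof -
  have "(sn_wave' c has_field_derivative 2 * sn_wave c (0 + of_real x * 1) ^ 3 - of_real (wave_const c) * sn_wave c (0 + of_real x * 1)) (at (0 + of_real x * 1))"
    by (rule has_derivative_sn_wave'[OF c]) (use c in simp)
  from bounded_linear.has_vector_derivative[OF bounded_linear_Re complex_line_derivative[OF this]]
  have "((\<lambda>x. Re (sn_wave' c (of_real x))) has_real_derivative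
      Re (2 * sn_wave c (of_real x) ^ 3 - of_real (wave_const c) * sn_wave c (of_real x))) (at x)"
    by (simp add: has_real_derivative_iff_has_vector_derivative)
  moreover have "2 * sn_wave c (of_real x) ^ 3 - of_real (wave_const c) * sn_wave c (of_real x) =
      of_real (2 * sn_real c x ^ 3 - wave_const c * sn_real c x)"
    by (simp add: of_real_sn_real)
  ultimately show ?thesis by (simp only: sn_real'_def[abs_def] Re_complex_of_real)
qed

lemma sn_real_energy:
  "sn_real' c x ^ 2 = sn_real c x ^ 4 - wave_const c * sn_real c x ^ 2 + sn_real' c 0 ^ 2"
proof -
  have "sn_wave' c (of_real 0) = of_real (sn_real' c 0)" by (simp only: of_real_sn_real)
  then have "of_real (sn_real' c x ^ 2) = (of_real (sn_real c x ^ 4 - wave_const c * sn_real c x ^ 2 + sn_real' c 0 ^ 2) :: complex)"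
    using sn_wave_energy[OF c, of "of_real x"] c by (simp flip: of_real_sn_real)
  then show ?thesis by (simp only: of_real_eq_iff)
qed

lemma sn_real_minus: "sn_real c (- x) = - sn_real c x"
  using sn_wave_minus[OF c, of "of_real x"] c by (simp add: sn_real_def)

lemma sn_real_0: "sn_real c 0 = 0"
  using sn_real_minus[of 0] by simp

lemma sn_real_reflect: "sn_real c (pi - x) = sn_real c x"
  using sn_wave_reflect[of c "of_real x"] by (simp add: sn_real_def)

lemma sn_real'_pi_half: "sn_real' c (pi / 2) = 0"
  using sn_wave'_reflect[OF c, of "of_real (pi / 2)"] c by (simp add: sn_real'_def)

lemma sn_real_periodic: "sn_real c (x + 2 * pi) = sn_real c x"
proof -
  have "sn_real c (x + 2 * pi) = sn_real c (pi - (x + 2 * pi))" by (rule sn_real_reflect[symmetric])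
  also have "\<dots> = - sn_real c (pi - (- x))" by (simp add: sn_real_minus[symmetric] algebra_simps)
  also have "\<dots> = sn_real c x" by (simp only: sn_real_reflect sn_real_minus)
  finally show ?thesis .
qed

lemma sn_real_periodic_int: "sn_real c (x + 2 * pi * of_int n) = sn_real c x"
proof (induction n rule: int_induct[where k = 0])
  case base then show ?case by simp
next
  case (step1 i)
  then show ?case using sn_real_periodic[of "x + 2 * pi * of_int i"] by (simp add: algebra_simps)
next
  case (step2 i)
  then show ?case using sn_real_periodic[of "x + 2 * pi * of_int (i - 1)"] by (simp add: algebra_simps)
qed

lemma sn_real_sums: "(\<lambda>l. 2 * csch_odd c (int l) * sin (real (2 * l + 1) * x)) sums sn_real c x"
proof -
  have "of_nat (2 * l + 1) * of_real x = (of_real (real (2 * l + 1) * x) :: complex)" for l by simp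
  then have "of_real (2 * csch_odd c (int l)) * sin (of_nat (2 * l + 1) * of_real x) =
     (of_real (2 * csch_odd c (int l) * sin (real (2 * l + 1) * x)) :: complex)" for l
    by (simp only: sin_of_real of_real_mult[of _ "sin _"])
  then have "(\<lambda>l. of_real (2 * csch_odd c (int l) * sin (real (2 * l + 1) * x)) :: complex) sums of_real (sn_real c x)"
    using sn_wave_sums[OF c, of "of_real x"] c by (simp only: of_real_sn_real) simp
  then show ?thesis by (simp only: sums_of_real_iff)
qed

lemma sn_real'_0_pos: "sn_real' c 0 > 0"
proof -
  have "(\<lambda>l. of_real (real (2 * l + 1) * (2 * csch_odd c (int l))) :: complex) sums of_real (sn_real' c 0)"
    using sn_wave'_sums[OF c, of 0] c by (simp add: of_real_sn_real)
  then have "(\<lambda>l. real (2 * l + 1) * (2 * csch_odd c (int l))) sums sn_real' c 0"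
    by (simp only: sums_of_real_iff)
  then show ?thesis
    using suminf_pos[of "\<lambda>l. real (2 * l + 1) * (2 * csch_odd c (int l))"] c
    by (simp add: sums_iff csch_odd_def)
qed

lemma continuous_sn_real': "continuous_on S (sn_real' c)" and continuous_sn_real: "continuous_on S (sn_real c)"
  by (rule DERIV_continuous_on[OF has_field_derivative_at_within], rule sn_real'_derivative sn_real_derivative)+

text \<open>F' is positive at 0 and has no zero before pi/2.\<close>

lemma sn_real'_pos:
  assumes "0 \<le> x" "x < pi / 2"
  shows "sn_real' c x > 0"
proof (rule ccontr)
  assume "\<not> sn_real' c x > 0"
  then have "sn_real' c x \<le> 0" by simp
  with IVT2'[of "sn_real' c" x 0 0] obtain y where y: "0 \<le> y" "y \<le> x" "sn_real' c y = 0"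
    using sn_real'_0_pos continuous_sn_real' assms by auto
  then have "y \<noteq> 0" using sn_real'_0_pos by auto
  then have "sn_wave' c (of_real y) \<noteq> 0" using sn_wave'_nonzero_real[OF c, of y] y assms by auto
  then show False using y(3) of_real_sn_real(2)[of y] by simp
qed

definition sn_amp :: real where "sn_amp = sn_real c (pi / 2)"

lemma sn_real_between:
  assumes "0 < x" "x < pi / 2"
  shows "0 < sn_real c x" "sn_real c x < sn_amp"
proof -
  have d: "\<exists>d. (sn_real c has_real_derivative d) (at t) \<and> d > 0" if "0 < t" "t < pi / 2" for t
    using sn_real_derivative[of t] sn_real'_pos[of t] that by auto
  have "sn_real c 0 < sn_real c x"
    by (rule DERIV_pos_imp_increasing_open[OF assms(1) d continuous_sn_real]) (use assms in auto)
  then show "0 < sn_real c x" by (simp add: sn_real_0)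
  show "sn_real c x < sn_amp" unfolding sn_amp_def
    by (rule DERIV_pos_imp_increasing_open[OF assms(2) d continuous_sn_real]) (use assms in auto)
qed

lemma sn_amp_pos: "sn_amp > 0"
  using sn_real_between[of "pi / 4"] by simp

text \<open>The second positive root of the quartic f^4 - C f^2 + F'(0)^2. \<open>sn_amp\<close> is
  a root because F' vanishes at pi/2, and the squares of the two roots have the product
  F'(0)^2.\<close>

definition sn_scale :: real where "sn_scale = sn_real' c 0 / sn_amp"

lemma sn_scale_pos: "sn_scale > 0"
  using sn_amp_pos sn_real'_0_pos by (simp add: sn_scale_def)

lemma wave_const_eq: "wave_const c = sn_amp\<^sup>2 + sn_scale\<^sup>2"
proof -
  have "0 = sn_amp ^ 4 - wave_const c * sn_amp ^ 2 + sn_real' c 0 ^ 2"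
    using sn_real_energy[of "pi / 2"] by (simp add: sn_real'_pi_half sn_amp_def)
  moreover have "sn_real' c 0 = sn_scale * sn_amp" using sn_amp_pos by (simp add: sn_scale_def)
  ultimately have "sn_amp ^ 2 * (sn_amp ^ 2 + sn_scale ^ 2) = sn_amp ^ 2 * wave_const c"
    by (simp add: power2_eq_square power4_eq_xxxx algebra_simps)
  then show ?thesis using sn_amp_pos by simp
qed

lemma quartic_factor:
  "f ^ 4 - wave_const c * f ^ 2 + sn_real' c 0 ^ 2 = (sn_amp\<^sup>2 - f\<^sup>2) * (sn_scale\<^sup>2 - f\<^sup>2)"
proof -
  have "sn_real' c 0 = sn_scale * sn_amp" using sn_amp_pos by (simp add: sn_scale_def)
  then show ?thesis by (simp add: wave_const_eq power2_eq_square power4_eq_xxxx algebra_simps)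
qed

lemma sn_vert_derivative:
  assumes "\<bar>y\<bar> < c"
  shows "(sn_vert c has_real_derivative sn_vert' c y) (at y)"
proof -
  have "(sn_wave c has_field_derivative sn_wave' c (of_real (pi / 2) + of_real y * \<i>)) (at (of_real (pi / 2) + of_real y * \<i>))"
    by (rule has_derivative_sn_wave[OF c]) (use assms in simp)
  from bounded_linear.has_vector_derivative[OF bounded_linear_Re complex_line_derivative[OF this]]
  show ?thesis by (simp only: sn_vert_def[abs_def] sn_vert'_def has_real_derivative_iff_has_vector_derivative)
qed

text \<open>F' is imaginary on this line, so its square is minus that of \<open>sn_vert'\<close>,
  and one factor of the quartic changes sign.\<close>

lemma sn_vert_energy:
  assumes "\<bar>y\<bar> < c"
  shows "sn_vert' c y ^ 2 = ((sn_vert c y)\<^sup>2 - sn_amp\<^sup>2) * (sn_scale\<^sup>2 - (sn_vert c y)\<^sup>2)"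
proof -
  define z where "z = of_real (pi / 2) + of_real y * \<i>"
  have z: "\<bar>Im z\<bar> < c" using assms by (simp add: z_def)
  have "sn_wave' c 0 = of_real (sn_real' c 0)" using of_real_sn_real(2)[of 0] by simp
  moreover have "sn_wave' c z ^ 2 = - (of_real (sn_vert' c y) ^ 2)"
    unfolding of_real_sn_vert[OF assms] z_def by (simp add: power_mult_distrib)
  moreover have "sn_wave c z = of_real (sn_vert c y)" unfolding of_real_sn_vert[OF assms] z_def ..
  ultimately have "of_real (- (sn_vert' c y ^ 2)) = (of_real (sn_vert c y ^ 4 - wave_const c * sn_vert c y ^ 2 + sn_real' c 0 ^ 2) :: complex)"
    using sn_wave_energy[OF c z] by simp
  then have "- (sn_vert' c y ^ 2) = sn_vert c y ^ 4 - wave_const c * sn_vert c y ^ 2 + sn_real' c 0 ^ 2"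
    by (simp only: of_real_eq_iff)
  then show ?thesis unfolding quartic_factor by (simp add: algebra_simps)
qed

lemma sn_vert'_nonzero: "0 < y \<Longrightarrow> y < c \<Longrightarrow> sn_vert' c y \<noteq> 0"
  using sn_wave'_nonzero_vertical[OF c, of y] of_real_sn_vert(2)[of y] by (auto simp: mult.commute)

lemma sn_vert_0: "sn_vert c 0 = sn_amp"
  by (simp add: sn_vert_def sn_amp_def sn_real_def)

text \<open>If \<open>sn_scale\<close> were smaller, F would attain it before pi/2, and the energy
  would force F' = 0 there. If the two were equal, the square of \<open>sn_vert'\<close> would be
  minus a square, although \<open>sn_vert'\<close> has no zero inside the segment.\<close>

lemma sn_amp_less_scale: "sn_amp < sn_scale"
proof (rule ccontr)
  assume "\<not> sn_amp < sn_scale"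
  then consider "sn_scale < sn_amp" | "sn_scale = sn_amp" by linarith
  then show False
  proof cases
    case 1
    with IVT'[of "sn_real c" 0 sn_scale "pi / 2"] obtain x where x: "0 \<le> x" "x \<le> pi / 2" "sn_real c x = sn_scale"
      using continuous_sn_real sn_scale_pos by (auto simp: sn_real_0 sn_amp_def)
    then have "x \<noteq> pi / 2" using 1 unfolding sn_amp_def by (metis less_irrefl)
    then have "sn_real' c x > 0" using x by (intro sn_real'_pos) auto
    moreover have "sn_real' c x ^ 2 = 0" unfolding sn_real_energy[of x] quartic_factor x(3) by simp
    ultimately show False by simp
  next
    case 2
    have "sn_vert' c (c / 2) ^ 2 = - (((sn_vert c (c / 2))\<^sup>2 - sn_amp\<^sup>2) ^ 2)"
      using sn_vert_energy[of "c / 2"] c 2 by (simp add: power2_eq_square algebra_simps)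
    then have "sn_vert' c (c / 2) ^ 2 \<le> 0" by simp
    then show False using sn_vert'_nonzero[of "c / 2"] c by simp
  qed
qed

section \<open>Continuation across the boundary of the strip\<close>

text \<open>With m = 2 l + 1 and u = y - c one has cosh (m y) / sinh (m c) = exp (m u) + exp (- m c)
  cosh (m u) / sinh (m c). The first summand is geometric and carries the loss of convergence at u =
  0; the second has gained a factor exp (- m c), and these are its coefficients.\<close>

definition edge_coeff :: "nat \<Rightarrow> complex" where
  "edge_coeff l = of_real ((-1) ^ l * exp (- (real (2 * l + 1) * c)) * (2 * csch_odd c (int l)))"

lemma exp_summable_edge: "exp_summable (2 * c) edge_coeff"
  unfolding exp_summable_def
proof (intro allI impI)
  fix r assume "r < 2 * c"
  then have "summable (\<lambda>l. norm (of_real (2 * csch_odd c (int l)) :: complex) * exp ((r - c) * real (2 * l + 1)))"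
    using exp_summable_wave[OF c] unfolding exp_summable_def by simp
  moreover have "norm (edge_coeff l) * exp (r * real (2 * l + 1)) =
     norm (of_real (2 * csch_odd c (int l)) :: complex) * exp ((r - c) * real (2 * l + 1))" for l
  proof -
    have "exp (- (real (2 * l + 1) * c)) * exp (r * real (2 * l + 1)) = exp ((r - c) * real (2 * l + 1))"
      by (simp add: mult_exp_exp algebra_simps)
    then show ?thesis
      unfolding edge_coeff_def norm_of_real abs_mult power_abs by (simp add: mult_ac)
  qed
  ultimately show "summable (\<lambda>l. norm (edge_coeff l) * exp (r * real (2 * l + 1)))" by (simp only:)
qed

text \<open>The continuation of \<open>sn_vert c\<close> across the boundary of the strip, in the coordinate \<open>u = y - c\<close>.\<close>

definition edge :: "real \<Rightarrow> real" where
  "edge u = 1 / cosh u + Re (cos_series edge_coeff (0 + of_real u * \<i>))"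

definition edge' :: "real \<Rightarrow> real" where
  "edge' u = - sinh u / cosh u ^ 2 + Re (- sin_series (\<lambda>l. of_nat (2 * l + 1) * edge_coeff l) (0 + of_real u * \<i>) * \<i>)"

lemma edge_derivative:
  assumes "\<bar>u\<bar> < 2 * c"
  shows "(edge has_real_derivative edge' u) (at u)"
proof -
  have "(cos_series edge_coeff has_field_derivative - sin_series (\<lambda>l. of_nat (2 * l + 1) * edge_coeff l) (0 + of_real u * \<i>)) (at (0 + of_real u * \<i>))"
    by (rule has_derivative_cos_series[OF exp_summable_edge]) (use assms in simp)
  from bounded_linear.has_vector_derivative[OF bounded_linear_Re complex_line_derivative[OF this]]
  have "((\<lambda>u. Re (cos_series edge_coeff (0 + of_real u * \<i>))) has_real_derivative
      Re (- sin_series (\<lambda>l. of_nat (2 * l + 1) * edge_coeff l) (0 + of_real u * \<i>) * \<i>)) (at u)"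
    by (simp only: has_real_derivative_iff_has_vector_derivative)
  moreover have "((\<lambda>u. 1 / cosh u) has_real_derivative - sinh u / cosh u ^ 2) (at u)"
    by (auto intro!: derivative_eq_intros simp: power2_eq_square)
  ultimately show ?thesis
    unfolding edge_def[abs_def] edge'_def by (intro DERIV_add)
qed

lemma continuous_edge': "continuous_on {-c..0} edge'"
proof -
  have "continuous_on {-c..0} (\<lambda>u. sin_series (\<lambda>l. of_nat (2 * l + 1) * edge_coeff l) (0 + of_real u * \<i>))"
  proof (rule continuous_on_compose2[where t = "{z. \<bar>Im z\<bar> < 2 * c}"
        and g = "sin_series (\<lambda>l. of_nat (2 * l + 1) * edge_coeff l)" and f = "\<lambda>u. 0 + of_real u * \<i>"])
    show "continuous_on {z. \<bar>Im z\<bar> < 2 * c} (sin_series (\<lambda>l. of_nat (2 * l + 1) * edge_coeff l))"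
      by (rule DERIV_continuous_on[OF has_field_derivative_at_within[OF has_derivative_sin_series[OF exp_summable_mult_index[OF exp_summable_edge]]]]) simp
  qed (use c in \<open>auto intro!: continuous_intros\<close>)
  then show ?thesis unfolding edge'_def[abs_def]
    by (intro continuous_intros) auto
qed

lemma sn_vert_eq_edge:
  assumes y: "\<bar>y\<bar> < c"
  shows "sn_vert c y = edge (y - c)"
proof -
  define s where "s = c - y"
  have s: "s > 0" "s < 2 * c" using y by (auto simp: s_def)
  have m: "of_nat (2 * l + 1) * (of_real (pi / 2) + of_real y * \<i>) =
      of_nat (2 * l + 1) * of_real (pi / 2) + \<i> * of_real (real (2 * l + 1) * y)" for l
    by (simp add: algebra_simps)
  have sn: "sin (of_nat (2 * l + 1) * of_real (pi / 2)) = ((-1) ^ l :: complex)" for l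
  proof -
    have "of_nat (2 * l + 1) * of_real (pi / 2) = (of_real (real l * pi + pi / 2) :: complex)" by (simp add: algebra_simps)
    moreover have "sin (real l * pi + pi / 2) = (-1) ^ l" by (simp add: sin_add)
    ultimately show ?thesis by (simp only: sin_of_real) simp
  qed
  have cs: "cos (\<i> * of_real x) = (of_real (cosh x) :: complex)" for x
    using exp_of_real[of "- x", where 'a = complex] by (simp add: cosh_conv_cos[symmetric] cosh_field_def exp_of_real)
  have "(\<lambda>l. of_real (2 * csch_odd c (int l)) * sin (of_nat (2 * l + 1) * (of_real (pi / 2) + of_real y * \<i>))) sums
      (of_real (sn_vert c y) :: complex)"
    unfolding of_real_sn_vert[OF y] by (rule sn_wave_sums[OF c]) (use y in simp)
  then have "(\<lambda>l. of_real ((-1) ^ l * (2 * csch_odd c (int l)) * cosh (real (2 * l + 1) * y))) sums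
      (of_real (sn_vert c y) :: complex)"
    unfolding m sin_add odd_pi_half sn cs by (simp add: mult_ac)
  then have 1: "(\<lambda>l. (-1) ^ l * (2 * csch_odd c (int l)) * cosh (real (2 * l + 1) * y)) sums sn_vert c y"
    by (simp only: sums_of_real_iff)
  have "(\<lambda>l. edge_coeff l * cos (of_nat (2 * l + 1) * (0 + of_real (y - c) * \<i>))) sums
      cos_series edge_coeff (0 + of_real (y - c) * \<i>)"
    unfolding cos_series_def
    by (rule summable_sums[OF summable_norm_cancel[OF exp_summable_imp(2)[OF exp_summable_edge]]]) (use s in \<open>simp add: s_def\<close>)
  moreover have "of_nat (2 * l + 1) * (0 + of_real (y - c) * \<i>) = \<i> * of_real (real (2 * l + 1) * (y - c))" for l
    by (simp add: algebra_simps)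
  ultimately have "(\<lambda>l. edge_coeff l * of_real (cosh (real (2 * l + 1) * (y - c)))) sums
      cos_series edge_coeff (0 + of_real (y - c) * \<i>)" by (simp only: cs)
  from sums_Re[OF this]
  have 2: "(\<lambda>l. (-1) ^ l * exp (- (real (2 * l + 1) * c)) * (2 * csch_odd c (int l)) * cosh (real (2 * l + 1) * (y - c))) sums
      Re (cos_series edge_coeff (0 + of_real (y - c) * \<i>))"
    unfolding edge_coeff_def by (simp only: of_real_mult[symmetric] Re_complex_of_real)
  \<comment> \<open>The geometric part, with s = - u: its value 1 / cosh is regular at u = 0, where
    the series itself diverges.\<close>
  have 3: "(\<lambda>l. 2 * exp (- s) * (- exp (- 2 * s)) ^ l) sums (1 / cosh (y - c))"
  proof -
    have "(\<lambda>l. 2 * exp (- s) * (- exp (- 2 * s)) ^ l) sums (2 * exp (- s) * (1 / (1 - (- exp (- 2 * s)))))"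
      using s by (intro sums_mult geometric_sums) simp
    moreover have "2 * exp (- s) * (1 / (1 - (- exp (- 2 * s)))) = 1 / cosh s"
    proof -
      have "1 + exp (- 2 * s) = 2 * exp (- s) * cosh s"
        by (simp add: cosh_field_def distrib_left mult_exp_exp mult.assoc)
      then show ?thesis by simp
    qed
    moreover have "cosh s = cosh (y - c)" using cosh_minus[of s] by (simp add: s_def)
    ultimately show ?thesis by simp
  qed
  have t: "2 * exp (- s) * (- exp (- 2 * s)) ^ l +
     (-1) ^ l * exp (- (real (2 * l + 1) * c)) * (2 * csch_odd c (int l)) * cosh (real (2 * l + 1) * (y - c)) =
     (-1) ^ l * (2 * csch_odd c (int l)) * cosh (real (2 * l + 1) * y)" for l
  proof -
    define m where "m = real (2 * l + 1)"
    have mp: "m * c > 0" using c by (simp add: m_def)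
    then have sh: "sinh (m * c) \<noteq> 0" by (simp only: sinh_real_zero_iff)
    have k: "csch_odd c (int l) = 1 / sinh (m * c)" by (simp add: csch_odd_def[OF c] m_def)
    have e: "exp (- s) * (- exp (- 2 * s)) ^ l = (-1) ^ l * exp (- (m * s))"
    proof -
      have "exp (- (m * s)) = exp (- s) * exp (- 2 * s) ^ l"
        by (simp add: m_def exp_of_nat_mult[symmetric] mult_exp_exp algebra_simps)
      then show ?thesis by (subst power_minus) (simp only: mult_ac)
    qed
    have "exp (- (m * s)) * sinh (m * c) + exp (- (m * c)) * cosh (m * (y - c)) = cosh (m * y)"
    proof -
      have "exp (- (m * s)) * sinh (m * c) = (exp (m * y) - exp (m * y - 2 * (m * c))) / 2"
        by (simp add: sinh_field_def s_def right_diff_distrib mult_exp_exp algebra_simps)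
      moreover have "exp (- (m * c)) * cosh (m * (y - c)) = (exp (m * y - 2 * (m * c)) + exp (- (m * y))) / 2"
        by (simp add: cosh_field_def distrib_left mult_exp_exp algebra_simps)
      ultimately show ?thesis by (simp add: cosh_field_def field_simps)
    qed
    then have "exp (- (m * s)) + exp (- (m * c)) * (1 / sinh (m * c)) * cosh (m * (y - c)) = 1 / sinh (m * c) * cosh (m * y)"
      using sh by (simp add: field_simps)
    then have "2 * (-1) ^ l * (exp (- (m * s)) + exp (- (m * c)) * (1 / sinh (m * c)) * cosh (m * (y - c))) =
        2 * (-1) ^ l * (1 / sinh (m * c) * cosh (m * y))" by simp
    then show ?thesis unfolding k m_def[symmetric] mult.assoc e by (simp add: algebra_simps)
  qed
  from sums_add[OF 3 2] have "(\<lambda>l. (-1) ^ l * (2 * csch_odd c (int l)) * cosh (real (2 * l + 1) * y)) sums edge (y - c)"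
    unfolding t edge_def .
  with 1 show ?thesis by (rule sums_unique2)
qed

end

section \<open>The Jacobi elliptic sine as a Lambert series\<close>

lemma arcsn_inj:
  assumes "0 \<le> \<mu>" "\<mu> < 1"
  shows "inj_on (arcsn \<mu>) {0..1}"
proof -
  have *: "arcsn \<mu> x < arcsn \<mu> y" if "0 \<le> x" "x < y" "y \<le> 1" for x y
  proof (rule DERIV_pos_imp_increasing_open[OF that(2)])
    show "continuous_on {x..y} (arcsn \<mu>)"
      by (rule continuous_on_subset[OF arcsn_continuous[OF assms]]) (use that in auto)
    fix t assume t: "x < t" "t < y"
    have "\<mu>\<^sup>2 * t\<^sup>2 < 1" using power2_mult_less_1[of \<mu> t] assms t that by simp
    moreover have "t\<^sup>2 < 1" using t that by (simp add: abs_square_less_1)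
    ultimately show "\<exists>d. (arcsn \<mu> has_real_derivative d) (at t) \<and> d > 0"
      using arcsn_derivative[OF assms, of t] t that by (intro exI conjI) auto
  qed
  show ?thesis
  proof (rule inj_onI)
    fix x y assume "x \<in> {0..1}" "y \<in> {0..1}" "arcsn \<mu> x = arcsn \<mu> y"
    then show "x = y" using *[of x y] *[of y x] by (cases x y rule: linorder_cases) auto
  qed
qed

context
  fixes c :: real
  assumes c: "c > 0"
begin

definition sn_mod :: real where "sn_mod = sn_amp c / sn_scale c"

lemma sn_mod_bounds: "0 < sn_mod" "sn_mod < 1"
  using sn_amp_pos[OF c] sn_scale_pos[OF c] sn_amp_less_scale[OF c] by (auto simp: sn_mod_def)

text \<open>Division of F by its amplitude normalises the quartic to the one under the root of the
  elliptic integral, with speed \<open>sn_scale c\<close>.\<close>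

lemma arcsn_sn_real:
  assumes "0 \<le> s" "s \<le> pi / 2"
  shows "arcsn sn_mod (sn_real c s / sn_amp c) = sn_scale c * s"
proof (rule arcsn_time_map[where L = "pi / 2"])
  show "0 \<le> sn_mod" "sn_mod < 1" using sn_mod_bounds by auto
  show "continuous_on {0..pi / 2} (\<lambda>s. sn_real c s / sn_amp c)"
    by (intro continuous_intros continuous_sn_real[OF c]) (use sn_amp_pos[OF c] in auto)
  show "sn_real c 0 / sn_amp c = 0" by (simp add: sn_real_0[OF c])
  show "0 < sn_real c s / sn_amp c \<and> sn_real c s / sn_amp c < 1" if "0 < s" "s < pi / 2" for s
    using sn_real_between[OF c that] sn_amp_pos[OF c] by simp
  show "0 \<le> sn_real c (pi / 2) / sn_amp c" "sn_real c (pi / 2) / sn_amp c \<le> 1"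
    using sn_amp_pos[OF c] by (auto simp: sn_amp_def[OF c])
  fix s assume s: "0 < s" "s < pi / 2"
  define a b f where "a = sn_amp c" and "b = sn_scale c" and "f = sn_real c s"
  have ab: "0 < a" "0 < b" using sn_amp_pos[OF c] sn_scale_pos[OF c] by (auto simp: a_def b_def)
  have "sn_real' c s > 0" using s by (intro sn_real'_pos[OF c]) auto
  then have "sn_real' c s = sqrt (sn_real' c s ^ 2)" by simp
  also have "sn_real' c s ^ 2 = (a\<^sup>2 - f\<^sup>2) * (b\<^sup>2 - f\<^sup>2)"
    unfolding sn_real_energy[OF c, of s] quartic_factor[OF c] a_def b_def f_def ..
  also have "\<dots> = (a * b)\<^sup>2 * ((1 - (f / a)\<^sup>2) * (1 - sn_mod\<^sup>2 * (f / a)\<^sup>2))"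
    using ab by (simp add: sn_mod_def a_def[symmetric] b_def[symmetric] power_divide power_mult_distrib field_simps)
  also have "sqrt \<dots> = a * b * sqrt ((1 - (f / a)\<^sup>2) * (1 - sn_mod\<^sup>2 * (f / a)\<^sup>2))"
    using ab by (simp add: real_sqrt_mult)
  finally have e: "sn_real' c s / a = b * sqrt ((1 - (f / a)\<^sup>2) * (1 - sn_mod\<^sup>2 * (f / a)\<^sup>2))"
    using ab by (simp add: field_simps)
  have "((\<lambda>s. sn_real c s / a) has_real_derivative sn_real' c s / a) (at s)"
    by (rule DERIV_cdivide[OF sn_real_derivative[OF c]])
  then show "((\<lambda>s. sn_real c s / sn_amp c) has_real_derivative
     sn_scale c * sqrt ((1 - (sn_real c s / sn_amp c)\<^sup>2) * (1 - sn_mod\<^sup>2 * (sn_real c s / sn_amp c)\<^sup>2))) (at s)"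
    using e by (simp only: a_def b_def f_def)
qed (use assms in auto)

lemma ellK_sn_mod: "ellK sn_mod = sn_scale c * (pi / 2)"
  using arcsn_sn_real[of "pi / 2"] sn_amp_pos[OF c] by (simp add: ellK_def sn_amp_def[OF c])

text \<open>Since K is \<open>sn_scale c\<close> times pi/2, the reduction modulo 4 K and the
  reflection about K in the definition become reduction modulo 2 pi and reflection about pi/2, which
  are symmetries of F.\<close>

lemma jacobi_sn_eq: "jacobi_sn (sn_scale c * x) sn_mod = sn_real c x / sn_amp c"
proof -
  define n where "n = \<lfloor>(x + pi) / (2 * pi)\<rfloor>"
  define w where "w = x - 2 * pi * of_int n"
  have b: "sn_scale c > 0" by (rule sn_scale_pos[OF c])
  have "of_int n \<le> (x + pi) / (2 * pi)" "(x + pi) / (2 * pi) < of_int n + 1" by (auto simp: n_def)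
  then have w: "- pi \<le> w" "w < pi" by (auto simp: w_def field_simps)
  have K: "(sn_scale c * x + 2 * ellK sn_mod) / (4 * ellK sn_mod) = (x + pi) / (2 * pi)"
  proof -
    have "sn_scale c * x + 2 * ellK sn_mod = sn_scale c * (x + pi)" "4 * ellK sn_mod = sn_scale c * (2 * pi)"
      by (simp_all add: ellK_sn_mod algebra_simps)
    then show ?thesis using b by (simp only:) simp
  qed
  have y: "sn_scale c * x - 4 * ellK sn_mod * of_int n = sn_scale c * w"
    by (simp add: ellK_sn_mod w_def algebra_simps)
  have mn: "min \<bar>sn_scale c * w\<bar> (2 * ellK sn_mod - \<bar>sn_scale c * w\<bar>) = sn_scale c * min \<bar>w\<bar> (pi - \<bar>w\<bar>)"
    using b by (auto simp: ellK_sn_mod abs_mult min_def algebra_simps)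
  have sg: "sgn (sn_scale c * w) = sgn w" using b by (simp add: sgn_mult)
  define v where "v = min \<bar>w\<bar> (pi - \<bar>w\<bar>)"
  have v: "0 \<le> v" "v \<le> pi / 2" using w by (auto simp: v_def min_def)
  have "the_inv_into {0..1} (arcsn sn_mod) (sn_scale c * v) = sn_real c v / sn_amp c"
  proof (rule the_inv_into_f_eq)
    show "inj_on (arcsn sn_mod) {0..1}" using sn_mod_bounds by (intro arcsn_inj) auto
    show "arcsn sn_mod (sn_real c v / sn_amp c) = sn_scale c * v" by (rule arcsn_sn_real[OF v])
    consider "v = 0" | "v = pi / 2" | "0 < v" "v < pi / 2" using v by linarith
    then show "sn_real c v / sn_amp c \<in> {0..1}"
    proof cases
      case 2
      have "sn_real c v = sn_amp c" unfolding 2 sn_amp_def[OF c] ..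
      then show ?thesis using sn_amp_pos[OF c] by simp
    qed (use sn_real_between[OF c, of v] sn_amp_pos[OF c] in \<open>auto simp: sn_real_0[OF c]\<close>)
  qed
  moreover have "sgn w * sn_real c v = sn_real c w"
  proof -
    have "sn_real c v = sn_real c \<bar>w\<bar>" unfolding v_def min_def using sn_real_reflect[OF c, of "\<bar>w\<bar>"] by simp
    then show ?thesis using sn_real_minus[OF c, of w] sn_real_0[OF c] by (cases w "0::real" rule: linorder_cases) auto
  qed
  moreover have "sn_real c w = sn_real c x"
    using sn_real_periodic_int[OF c, of w n] by (simp add: w_def)
  ultimately show ?thesis
    unfolding jacobi_sn_def Let_def K n_def[symmetric] y mn sg v_def[symmetric] by simp
qed

text \<open>What is known on the open segment, extended to its end point y = c by continuity.
  \<open>edge\<close> is even in u, so its derivative vanishes there; this is what fixes the end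
  value of F.\<close>

lemma edge_facts:
  fixes h h' :: "real \<Rightarrow> real"
  assumes h_def: "h = (\<lambda>y. edge c (y - c))" and h'_def: "h' = (\<lambda>y. edge' c (y - c))"
  shows "\<And>y. 0 \<le> y \<Longrightarrow> y \<le> c \<Longrightarrow> (h has_real_derivative h' y) (at y)"
    and "\<And>y. 0 \<le> y \<Longrightarrow> y \<le> c \<Longrightarrow> h' y ^ 2 = ((h y)\<^sup>2 - (sn_amp c)\<^sup>2) * ((sn_scale c)\<^sup>2 - (h y)\<^sup>2)"
    and "\<And>y. 0 < y \<Longrightarrow> y < c \<Longrightarrow> h' y \<noteq> 0" and "h 0 = sn_amp c" and "h' c = 0"
    and "continuous_on {0..c} h'"
proof -
  show d: "(h has_real_derivative h' y) (at y)" if "0 \<le> y" "y \<le> c" for y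
  proof -
    have "(edge c has_real_derivative edge' c (y - c)) (at (y + (- c)))"
      using edge_derivative[OF c, of "y - c"] that c by simp
    then show ?thesis unfolding h_def h'_def using DERIV_shift[of "edge c" _ y "- c"] by simp
  qed
  have hv: "h y = sn_vert c y" if "\<bar>y\<bar> < c" for y using sn_vert_eq_edge[OF c that] by (simp add: h_def)
  have hv': "h' y = sn_vert' c y" if y0: "0 \<le> y" and y: "\<bar>y\<bar> < c" for y
  proof (rule DERIV_unique[OF d])
    have "open {-c<..<c}" "y \<in> {-c<..<c}" using y by auto
    then show "(h has_real_derivative sn_vert' c y) (at y)"
      by (rule has_field_derivative_transform_within_open[OF sn_vert_derivative[OF c y]]) (auto simp: hv)
  qed (use y y0 in auto)
  show "h 0 = sn_amp c" using hv[of 0] c by (simp add: sn_vert_0[OF c])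
  show "h' y \<noteq> 0" if "0 < y" "y < c" for y using hv'[of y] sn_vert'_nonzero[OF c that] that by simp
  show "h' c = 0" by (simp add: h'_def edge'_def[OF c] sin_series_def)
  show ch': "continuous_on {0..c} h'"
    unfolding h'_def by (rule continuous_on_compose2[OF continuous_edge'[OF c]]) (auto intro!: continuous_intros)
  have ch: "continuous_on {0..c} h"
    by (rule DERIV_continuous_on[OF has_field_derivative_at_within[OF d]]) auto
  show "h' y ^ 2 = ((h y)\<^sup>2 - (sn_amp c)\<^sup>2) * ((sn_scale c)\<^sup>2 - (h y)\<^sup>2)" if "0 \<le> y" "y \<le> c" for y
  proof -
    define G where "G y = h' y ^ 2 - ((h y)\<^sup>2 - (sn_amp c)\<^sup>2) * ((sn_scale c)\<^sup>2 - (h y)\<^sup>2)" for y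
    have cl: "closure {0..<c} = {0..c}" using c by simp
    have "G y = 0"
    proof (rule continuous_constant_on_closure[where S = "{0..<c}" and f = G and a = 0])
      show "continuous_on (closure {0..<c}) G" unfolding cl G_def by (intro continuous_intros ch ch')
      show "y \<in> closure {0..<c}" unfolding cl using that by simp
      show "G x = 0" if "x \<in> {0..<c}" for x
        using sn_vert_energy[OF c, of x] hv[of x] hv'[of x] that by (simp add: G_def)
    qed
    then show ?thesis by (simp add: G_def)
  qed
qed

text \<open>On the segment F rises from a to b. With the complementary modulus k, the function sqrt
  (1 - (F / b)^2) / k, read backwards from the end point, rises from 0 to 1 and solves the equation
  of the elliptic sine of modulus k with speed b.\<close>

lemma ellK_complementary: "ellK (sqrt (1 - sn_mod\<^sup>2)) = sn_scale c * c"
proof -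
  define h h' where "h = (\<lambda>y. edge c (y - c))" and "h' = (\<lambda>y. edge' c (y - c))"
  define a b where "a = sn_amp c" and "b = sn_scale c"
  note F = edge_facts[OF h_def h'_def, folded a_def b_def]
  have ab: "0 < a" "a < b" using sn_amp_pos[OF c] sn_amp_less_scale[OF c] by (auto simp: a_def b_def)
  have ch: "continuous_on S h" if "S \<subseteq> {0..c}" for S
    by (rule DERIV_continuous_on[OF has_field_derivative_at_within[OF F(1)]]) (use that in auto)
  have sq: "a\<^sup>2 < (h y)\<^sup>2 \<and> (h y)\<^sup>2 < b\<^sup>2" if y: "0 < y" "y < c" for y
  proof -
    have "h' y ^ 2 > 0" using F(3)[OF y] by simp
    then have "((h y)\<^sup>2 - a\<^sup>2) * (b\<^sup>2 - (h y)\<^sup>2) > 0" using F(2)[of y] y by simp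
    moreover have "a\<^sup>2 < b\<^sup>2" using ab by (intro power_strict_mono) auto
    ultimately show ?thesis by (auto simp: zero_less_mult_iff)
  qed
  \<comment> \<open>h starts at a > 0 and its square stays above a^2, so h cannot cross 0.\<close>
  have hpos: "h y > 0" if y: "0 < y" "y < c" for y
  proof (rule ccontr)
    assume "\<not> h y > 0"
    with IVT2'[of h y 0 0] obtain x where x: "0 \<le> x" "x \<le> y" "h x = 0"
      using F(4) ab ch[of "{0..y}"] y by auto
    then have "x \<noteq> 0" using F(4) ab by auto
    then show False using sq[of x] x y ab by simp
  qed
  have hab: "a < h y" "h y < b" if "0 < y" "y < c" for y
    using sq[OF that] hpos[OF that] ab by (auto simp: power2_less_imp_less intro: power2_less_imp_less)
  \<comment> \<open>h' has no zero inside, and the mean value theorem supplies a point where it is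
    positive.\<close>
  have h'pos: "h' y > 0" if y: "0 < y" "y < c" for y
  proof (rule ccontr)
    assume "\<not> h' y > 0"
    then have n: "h' y \<le> 0" by simp
    obtain z where z: "0 < z" "z < y" "h y - h 0 = (y - 0) * h' z"
      using MVT2[of 0 y h h'] F(1) y by auto
    then have "h' z > 0" using hab(1)[OF y] F(4) y by (metis diff_gt_0_iff_gt diff_zero zero_less_mult_pos)
    with IVT2'[of h' y 0 z] obtain x where x: "z \<le> x" "x \<le> y" "h' x = 0"
      using n z continuous_on_subset[OF F(6), of "{z..y}"] y by auto
    then show False using F(3)[of x] z y by simp
  qed
  \<comment> \<open>At the end point h' = 0, so the energy leaves only the values a^2 and b^2 for
    the square of h, and h has already exceeded a.\<close>
  have hc: "h c = b"
  proof -
    have "h (c / 2) < h c"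
    proof (rule DERIV_pos_imp_increasing_open[of "c / 2" c h])
      show "\<exists>d. (h has_real_derivative d) (at x) \<and> d > 0" if "c / 2 < x" "x < c" for x
        using F(1)[of x] h'pos[of x] that c by auto
    qed (use c ch[of "{c / 2..c}"] in auto)
    then have "a < h c" using hab[of "c / 2"] c by simp
    then have "a\<^sup>2 < (h c)\<^sup>2" using ab by (intro power_strict_mono) auto
    then have "(h c)\<^sup>2 = b\<^sup>2" using F(2)[of c] F(5) c by simp
    then show ?thesis using \<open>a < h c\<close> ab by (simp add: power2_eq_iff)
  qed
  define k where "k = sqrt (1 - sn_mod\<^sup>2)"
  have k2: "k\<^sup>2 = 1 - (a / b)\<^sup>2" "0 < k" "k < 1"
  proof -
    have "0 < sn_mod\<^sup>2" "sn_mod\<^sup>2 < 1" using sn_mod_bounds by (auto simp: abs_square_less_1)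
    then show "k\<^sup>2 = 1 - (a / b)\<^sup>2" "0 < k" "k < 1" by (auto simp: k_def sn_mod_def a_def b_def)
  qed
  define T where "T s = sqrt (1 - (h (c - s) / b)\<^sup>2) / k" for s
  have "arcsn k (T c) = b * c"
  proof (rule arcsn_time_map[where L = c])
    show "0 \<le> k" "k < 1" using k2 by auto
    have "continuous_on {0..c} (\<lambda>s. h (c - s))"
      by (rule continuous_on_compose2[OF ch[OF order_refl]]) (auto intro!: continuous_intros)
    then show "continuous_on {0..c} T"
      unfolding T_def by (intro continuous_intros) (use k2 ab in auto)
    show "T 0 = 0" using hc ab by (simp add: T_def)
    have "T c = 1" using F(4) k2 by (simp add: T_def flip: k2(1))
    then show "0 \<le> T c" "T c \<le> 1" by auto
    fix s assume s: "0 < s" "s < c"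
    define y where "y = c - s"
    have y: "0 < y" "y < c" using s by (auto simp: y_def)
    have hy: "a < h y" "h y < b" "0 < h y" using hab[OF y] hpos[OF y] by auto
    define W where "W = 1 - (h y / b)\<^sup>2"
    have W: "0 < W" "W < k\<^sup>2"
    proof -
      have "(a / b)\<^sup>2 < (h y / b)\<^sup>2" "(h y / b)\<^sup>2 < 1"
        using hy ab by (auto intro!: power_strict_mono divide_strict_right_mono simp: abs_square_less_1)
      then show "0 < W" "W < k\<^sup>2" by (auto simp: W_def k2)
    qed
    have Ts: "T s = sqrt W / k" by (simp add: T_def W_def y_def)
    have Ts2: "(T s)\<^sup>2 = W / k\<^sup>2" using W by (simp add: Ts power_divide)
    have "sqrt W < k" using W k2 by (metis real_sqrt_less_iff real_sqrt_abs abs_of_pos)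
    then show "0 < T s \<and> T s < 1" using W k2 by (simp add: Ts)
    have "h' y = sqrt (h' y ^ 2)" using h'pos[OF y] by simp
    also have "h' y ^ 2 = ((h y)\<^sup>2 - a\<^sup>2) * (b\<^sup>2 * W)"
    proof -
      have "b\<^sup>2 * W = b\<^sup>2 - (h y)\<^sup>2" using ab by (simp add: W_def power_divide right_diff_distrib)
      then show ?thesis using F(2)[of y] y by simp
    qed
    also have "sqrt \<dots> = sqrt ((h y)\<^sup>2 - a\<^sup>2) * (b * sqrt W)" using ab by (simp add: real_sqrt_mult)
    finally have h'y: "h' y = sqrt ((h y)\<^sup>2 - a\<^sup>2) * (b * sqrt W)" .
    have "((\<lambda>s. h (c - s)) has_real_derivative h' y * (- 1)) (at s)"
    proof (rule DERIV_chain2[where f = h and g = "\<lambda>s. c - s"])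
      show "(h has_real_derivative h' y) (at (c - s))" using F(1)[of y] y by (simp add: y_def)
    qed (auto intro!: derivative_eq_intros)
    then have "((\<lambda>s. 1 - (h (c - s) / b)\<^sup>2) has_real_derivative 2 * h y * h' y / b\<^sup>2) (at s)"
      using ab by (auto intro!: derivative_eq_intros simp: y_def power2_eq_square field_simps)
    moreover have "(sqrt has_real_derivative inverse (sqrt W) / 2) (at (1 - (h (c - s) / b)\<^sup>2))"
      using DERIV_real_sqrt[OF W(1)] by (simp add: W_def y_def)
    ultimately have "(T has_real_derivative inverse (sqrt W) / 2 * (2 * h y * h' y / b\<^sup>2) / k) (at s)"
      unfolding T_def by (intro DERIV_cdivide DERIV_chain2[where f = sqrt])
    moreover have "inverse (sqrt W) / 2 * (2 * h y * h' y / b\<^sup>2) / k = h y * sqrt ((h y)\<^sup>2 - a\<^sup>2) / (b * k)"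
      unfolding h'y using W ab k2 by (simp add: field_simps power2_eq_square)
    moreover have "b * sqrt ((1 - (T s)\<^sup>2) * (1 - k\<^sup>2 * (T s)\<^sup>2)) = h y * sqrt ((h y)\<^sup>2 - a\<^sup>2) / (b * k)"
    proof -
      have "(1 - (T s)\<^sup>2) * (1 - k\<^sup>2 * (T s)\<^sup>2) = ((h y)\<^sup>2 - a\<^sup>2) * (h y / (b\<^sup>2 * k))\<^sup>2"
      proof -
        have "1 - k\<^sup>2 * (T s)\<^sup>2 = (h y / b)\<^sup>2" using k2(2) by (simp add: Ts2 W_def)
        moreover have "1 - (T s)\<^sup>2 = ((h y)\<^sup>2 - a\<^sup>2) / (b * k)\<^sup>2"
        proof -
          have "1 - (T s)\<^sup>2 = (k\<^sup>2 - W) / k\<^sup>2" using k2(2) by (simp add: Ts2 field_simps)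
          also have "k\<^sup>2 - W = ((h y)\<^sup>2 - a\<^sup>2) / b\<^sup>2" by (simp add: k2 W_def power_divide diff_divide_distrib)
          finally show ?thesis by (simp add: power_mult_distrib)
        qed
        ultimately show ?thesis by (simp add: power_divide power_mult_distrib power2_eq_square)
      qed
      then have "sqrt ((1 - (T s)\<^sup>2) * (1 - k\<^sup>2 * (T s)\<^sup>2)) = sqrt ((h y)\<^sup>2 - a\<^sup>2) * (h y / (b\<^sup>2 * k))"
        using hy ab k2(2) by (simp add: real_sqrt_mult)
      then show ?thesis using ab by (simp add: power2_eq_square)
    qed
    ultimately show "(T has_real_derivative b * sqrt ((1 - (T s)\<^sup>2) * (1 - k\<^sup>2 * (T s)\<^sup>2))) (at s)" by simp
  qed (use c in auto)
  moreover have "T c = 1" using F(4) k2 by (simp add: T_def flip: k2(1))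
  ultimately show ?thesis by (simp add: ellK_def k_def b_def)
qed

lemma nome_sn_mod: "nome sn_mod = exp (- 2 * c)"
  using sn_scale_pos[OF c] by (simp add: nome_def ellK_complementary ellK_sn_mod)

end

section \<open>Coefficients of the eigenfunctions\<close>

text \<open>For \<open>q = exp (- 2 c)\<close> this is \<open>sinh c / sinh (j c)\<close>. Even \<open>j\<close> are needed for the right-hand
  side of the equation which defines \<open>r1\<close>.\<close>

definition lambert :: "nat \<Rightarrow> real \<Rightarrow> real" where
  "lambert j q = (1 - q) * q powr ((real j - 1) / 2) / (1 - q ^ j)"

definition geom :: "nat \<Rightarrow> real \<Rightarrow> real" where
  "geom j q = (\<Sum>i<j. q ^ i)"

text \<open>\<open>geom j q\<close> times 2 q times the logarithmic derivative of
  \<open>lambert j\<close>.\<close>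

definition geom_moment :: "nat \<Rightarrow> real \<Rightarrow> real" where
  "geom_moment j q = (\<Sum>i<j. (real j - 1 - 2 * real i) * q ^ i)"

lemma geom_pos: "j \<ge> 1 \<Longrightarrow> q > 0 \<Longrightarrow> geom j q > 0"
  unfolding geom_def by (rule sum_pos) (auto simp: lessThan_empty_iff)

lemma lambert_geom: "q \<noteq> 1 \<Longrightarrow> lambert j q = q powr ((real j - 1) / 2) / geom j q"
  by (simp add: lambert_def geom_def one_diff_power_eq)

lemma lambert_odd: "q > 0 \<Longrightarrow> lambert (2 * l + 1) q = (1 - q) * q ^ l / (1 - q ^ (2 * l + 1))"
  by (simp add: lambert_def powr_realpow)

lemma lambert_1: "0 < q \<Longrightarrow> q < 1 \<Longrightarrow> lambert 1 q = 1"
  by (simp add: lambert_def)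

lemma lambert_pos: "0 < q \<Longrightarrow> q < 1 \<Longrightarrow> j \<ge> 1 \<Longrightarrow> lambert j q > 0"
  by (simp add: lambert_def power_less_one_iff)

lemma lambert_Suc_le:
  assumes q: "0 < q" "q < 1" and "j \<ge> 1"
  shows "lambert (Suc j) q \<le> lambert j q"
proof -
  have "q powr ((real (Suc j) - 1) / 2) \<le> q powr ((real j - 1) / 2)"
    using q by (intro powr_mono') auto
  moreover have "geom j q \<le> geom (Suc j) q" using q by (simp add: geom_def)
  moreover have "geom j q > 0" using geom_pos assms by simp
  ultimately show ?thesis using q unfolding lambert_geom[OF less_imp_neq[OF q(2)]]
    by (intro frac_le) auto
qed

lemma lambert_antimono:
  assumes "0 < q" "q < 1" "1 \<le> i" "i \<le> j"
  shows "lambert j q \<le> lambert i q"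
  using assms(4)
proof (induction rule: dec_induct)
  case (step n)
  then show ?case using lambert_Suc_le[OF assms(1,2), of n] assms(3) by simp
qed simp

lemma index_sum: "(1 - q) * (\<Sum>k<j. (real k + 1) * q ^ k) = geom j q - real j * q ^ j"
proof (induction j)
  case (Suc j)
  have "(1 - q) * (\<Sum>k<Suc j. (real k + 1) * q ^ k) =
      (geom j q - real j * q ^ j) + (1 - q) * ((real j + 1) * q ^ j)"
    unfolding Suc[symmetric] by (simp only: sum.lessThan_Suc distrib_left)
  also have "\<dots> = geom (Suc j) q - real (Suc j) * q ^ Suc j"
    by (simp add: geom_def algebra_simps)
  finally show ?case .
qed (simp add: geom_def)

text \<open>Summation by parts: the weights j - 1 - 2 i change sign, but their partial sums (k + 1)
  (j - 1 - k) do not.\<close>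

lemma geom_moment_eq:
  "geom_moment j q = (1 - q) * (\<Sum>k<j. (real k + 1) * (real j - 1 - real k) * q ^ k)"
proof (induction j)
  case 0 then show ?case by (simp add: geom_moment_def)
next
  case (Suc j)
  have "geom_moment (Suc j) q = (\<Sum>i<j. (real j - 1 - 2 * real i) * q ^ i + q ^ i) - real j * q ^ j"
    by (simp add: geom_moment_def algebra_simps)
  also have "\<dots> = geom_moment j q + (geom j q - real j * q ^ j)"
    by (simp add: sum.distrib geom_moment_def geom_def)
  also have "\<dots> = (1 - q) * (\<Sum>k<j. (real k + 1) * (real j - 1 - real k) * q ^ k + (real k + 1) * q ^ k)"
    unfolding index_sum[symmetric] Suc sum.distrib distrib_left ..
  also have "(\<Sum>k<j. (real k + 1) * (real j - 1 - real k) * q ^ k + (real k + 1) * q ^ k) =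
      (\<Sum>k<Suc j. (real k + 1) * (real (Suc j) - 1 - real k) * q ^ k)"
    by (simp add: algebra_simps)
  finally show ?case .
qed

lemma geom_moment_nonneg:
  assumes "0 < q" "q < 1"
  shows "geom_moment j q \<ge> 0"
  unfolding geom_moment_eq by (intro mult_nonneg_nonneg sum_nonneg) (use assms in auto)

lemma geom_moment_pos:
  assumes "0 < q" "q < 1" "j \<ge> 2"
  shows "geom_moment j q > 0"
proof -
  have "(\<Sum>k<j. (real k + 1) * (real j - 1 - real k) * q ^ k) > 0"
    by (rule sum_pos2[where i = 0]) (use assms in auto)
  then show ?thesis unfolding geom_moment_eq using assms by simp
qed

text \<open>After division by 1 - q the claim is that the sum of (k + 1) (j - 2 - k) q^k is
  nonnegative. Only the weight at k = j - 1 is negative, so replacing every q^k by q^(j - 1) can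
  only lower the sum. What remains has the factor j (j + 1) (j - 4) / 6, whence the condition j
  \<ge> 4.\<close>

lemma geom_moment_Suc_le:
  assumes q: "0 < q" "q < 1" and j: "j \<ge> 4"
  shows "geom_moment (Suc j) q \<le> 2 * geom_moment j q"
proof -
  define S where "S = (\<Sum>k<j. (real k + 1) * (real j - 1 - real k) * q ^ k)"
  have cnt: "(\<Sum>k<n. (real k + 1) * (x - real k)) = real n * (real n + 1) * (3 * x + 2 - 2 * real n) / 6" for n x
    by (induction n) (auto simp: field_simps)
  have "0 \<le> real j * (real j + 1) * (real j - 4) / 6" using j by simp
  also have "\<dots> = (\<Sum>k<j. (real k + 1) * (real j - 2 - real k))" unfolding cnt by (simp add: field_simps)
  finally have "0 \<le> (\<Sum>k<j. (real k + 1) * (real j - 2 - real k)) * q ^ (j - 1)" using q by simp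
  also have "\<dots> = (\<Sum>k<j. (real k + 1) * (real j - 2 - real k) * q ^ (j - 1))" by (simp add: sum_distrib_right)
  also have "\<dots> \<le> (\<Sum>k<j. (real k + 1) * (real j - 2 - real k) * q ^ k)"
  proof (rule sum_mono)
    fix k assume k: "k \<in> {..<j}"
    show "(real k + 1) * (real j - 2 - real k) * q ^ (j - 1) \<le> (real k + 1) * (real j - 2 - real k) * q ^ k"
    proof (cases "k = j - 1")
      case False
      then have "k + 2 \<le> j" using k by auto
      then have "real k + 2 \<le> real j" by (metis of_nat_add of_nat_le_iff of_nat_numeral)
      then show ?thesis using q k by (intro mult_left_mono power_decreasing) auto
    qed simp
  qed
  also have "\<dots> = S - (\<Sum>k<j. (real k + 1) * q ^ k)"
    unfolding S_def sum_subtractf[symmetric] by (intro sum.cong) (auto simp: algebra_simps)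
  finally have *: "(\<Sum>k<j. (real k + 1) * q ^ k) \<le> S" by simp
  have "(\<Sum>k<Suc j. (real k + 1) * (real (Suc j) - 1 - real k) * q ^ k) = S + (\<Sum>k<j. (real k + 1) * q ^ k)"
    unfolding S_def by (simp add: sum.distrib[symmetric] algebra_simps)
  then have "geom_moment (Suc j) q = (1 - q) * (S + (\<Sum>k<j. (real k + 1) * q ^ k))" by (simp only: geom_moment_eq)
  also have "\<dots> \<le> (1 - q) * (S + S)" using * q by (intro mult_left_mono) auto
  also have "\<dots> = 2 * geom_moment j q" by (simp add: geom_moment_eq S_def)
  finally show ?thesis .
qed

section \<open>Monotonicity in the nome and submultiplicativity in the index\<close>

lemma lambert_derivative:
  assumes q: "0 < q" "q < 1" and j: "j \<ge> 1"
  shows "(lambert j has_real_derivative lambert j q * (geom_moment j q / geom j q) / (2 * q)) (at q)"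
proof -
  define e where "e = (real j - 1) / 2"
  define Z' where "Z' = (\<Sum>i<j. real i * q ^ (i - 1))"
  have Z: "geom j q > 0" using geom_pos j q by simp
  have "((\<lambda>q. q powr e / geom j q) has_real_derivative
      (e * q powr (e - 1) * geom j q - q powr e * Z') / (geom j q * geom j q)) (at q)"
  proof (rule DERIV_divide)
    show "((\<lambda>q. q powr e) has_real_derivative e * q powr (e - 1)) (at q)"
      by (rule has_real_derivative_powr) (rule q)
    show "(geom j has_real_derivative Z') (at q)"
      unfolding geom_def[abs_def] Z'_def by (auto intro!: derivative_eq_intros sum.cong)
  qed (use Z in simp)
  moreover have "(e * q powr (e - 1) * geom j q - q powr e * Z') / (geom j q * geom j q) =
      lambert j q * (geom_moment j q / geom j q) / (2 * q)"
  proof -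
    have pw: "q powr (e - 1) = q powr e / q" using q by (simp add: powr_diff)
    have qZ: "q * Z' = (\<Sum>i<j. real i * q ^ i)"
      unfolding Z'_def sum_distrib_left
    proof (rule sum.cong)
      fix i show "q * (real i * q ^ (i - 1)) = real i * q ^ i" by (cases i) auto
    qed simp
    define X where "X = e * geom j q - q * Z'"
    have gm: "geom_moment j q = 2 * X"
      unfolding X_def qZ geom_moment_def geom_def e_def
      by (simp add: sum_distrib_left sum_subtractf sum.distrib algebra_simps)
    have "lambert j q * (geom_moment j q / geom j q) / (2 * q) = (q powr e / geom j q) * (X / geom j q) / q"
      unfolding gm lambert_geom[OF less_imp_neq[OF q(2)]] e_def[symmetric] by simp
    also have "\<dots> = (e * (q powr e / q) * geom j q - q powr e * Z') / (geom j q * geom j q)"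
      using q Z by (simp add: X_def field_simps)
    finally show ?thesis by (simp add: pw)
  qed
  ultimately have "((\<lambda>q. q powr e / geom j q) has_real_derivative
      lambert j q * (geom_moment j q / geom j q) / (2 * q)) (at q)" by simp
  then show ?thesis
    by (rule has_field_derivative_transform_within_open[where S = "{0<..<1}"])
       (use q in \<open>auto simp: lambert_geom e_def\<close>)
qed

lemma lambert_mono:
  assumes "0 < q" "q \<le> r" "r < 1" "j \<ge> 1"
  shows "lambert j q \<le> lambert j r"
proof (rule DERIV_nonneg_imp_nondecreasing[OF assms(2)])
  fix x assume x: "q \<le> x" "x \<le> r"
  then have "lambert j x * (geom_moment j x / geom j x) / (2 * x) \<ge> 0"
    using assms lambert_pos[of x j] geom_moment_nonneg[of x j] geom_pos[of j x]
    by (intro divide_nonneg_nonneg mult_nonneg_nonneg) auto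
  then show "\<exists>d. (lambert j has_real_derivative d) (at x) \<and> 0 \<le> d"
    using lambert_derivative[of x j] x assms by auto
qed

lemma lambert_strict_mono:
  assumes "0 < q" "q < r" "r < 1" "j \<ge> 2"
  shows "lambert j q < lambert j r"
proof (rule DERIV_pos_imp_increasing[OF assms(2)])
  fix x assume x: "q \<le> x" "x \<le> r"
  then have "lambert j x * (geom_moment j x / geom j x) / (2 * x) > 0"
    using assms lambert_pos[of x j] geom_moment_pos[of x j] geom_pos[of j x]
    by (intro divide_pos_pos mult_pos_pos) auto
  then show "\<exists>d. (lambert j has_real_derivative d) (at x) \<and> 0 < d"
    using lambert_derivative[of x j] x assms by auto
qed

text \<open>For even p the index p^2 is not among the odd indices of \<open>s_fun\<close>. With Suc
  j = p^2, this lets the term of index j outgrow half of the one of index p^2.\<close>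

lemma lambert_difference_mono:
  assumes "0 < q" "q \<le> r" "r < 1" "j \<ge> 4"
  shows "2 * lambert j q - lambert (Suc j) q \<le> 2 * lambert j r - lambert (Suc j) r"
proof (rule DERIV_nonneg_imp_nondecreasing[OF assms(2)])
  fix x assume x: "q \<le> x" "x \<le> r"
  then have x01: "0 < x" "x < 1" using assms by auto
  have j: "j \<ge> 1" "Suc j \<ge> 1" using assms by auto
  define u where "u j = lambert j x * (geom_moment j x / geom j x) / (2 * x)" for j
  have "geom_moment (Suc j) x / geom (Suc j) x \<le> 2 * geom_moment j x / geom j x"
    using geom_moment_Suc_le[OF x01 assms(4)] geom_moment_nonneg[OF x01, of "Suc j"] geom_moment_nonneg[OF x01, of j] geom_pos[OF j(1) x01(1)] x01
    by (intro frac_le) (auto simp: geom_def)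
  then have "lambert (Suc j) x * (geom_moment (Suc j) x / geom (Suc j) x) \<le> lambert j x * (2 * geom_moment j x / geom j x)"
    using lambert_Suc_le[OF x01 j(1)] lambert_pos[OF x01 j(1)] geom_moment_nonneg[OF x01, of "Suc j"] geom_pos[OF j(2) x01(1)]
    by (intro mult_mono) auto
  then have "u (Suc j) \<le> lambert j x * (2 * geom_moment j x / geom j x) / (2 * x)"
    unfolding u_def by (rule divide_right_mono) (use x01 in simp)
  also have "\<dots> = 2 * u j" by (simp add: u_def)
  finally have "u (Suc j) \<le> 2 * u j" .
  moreover have "((\<lambda>q. 2 * lambert j q - lambert (Suc j) q) has_real_derivative 2 * u j - u (Suc j)) (at x)"
    unfolding u_def by (intro DERIV_diff DERIV_cmult lambert_derivative x01 j)
  ultimately show "\<exists>d. ((\<lambda>q. 2 * lambert j q - lambert (Suc j) q) has_real_derivative d) (at x) \<and> 0 \<le> d"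
    by (intro exI conjI) auto
qed

text \<open>The coefficient of index j k is exactly \<open>lambert j q\<close> times
  \<open>lambert k\<close> at q^j, and q^j \<le> q.\<close>

lemma lambert_mult_le:
  assumes q: "0 < q" "q < 1" and j: "j \<ge> 1" and k: "k \<ge> 1"
  shows "lambert (j * k) q \<le> lambert j q * lambert k q"
proof -
  have qj: "0 < q ^ j" "q ^ j < 1" "q ^ j \<le> q"
    using q j power_decreasing[of 1 j q] by (auto simp: power_less_one_iff)
  have "q powr ((real (j * k) - 1) / 2) = q powr ((real j - 1) / 2) * (q ^ j) powr ((real k - 1) / 2)"
    using q by (simp add: powr_powr powr_add[symmetric] algebra_simps add_divide_distrib diff_divide_distrib flip: powr_realpow)
  then have "lambert (j * k) q = lambert j q * lambert k (q ^ j)"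
    using q qj by (simp add: lambert_def power_mult)
  also have "\<dots> \<le> lambert j q * lambert k q"
    using lambert_mono[OF qj(1,3) q(2) k] lambert_pos[OF q j] by simp
  finally show ?thesis .
qed

lemma lambert_le_power:
  assumes "0 < q" "q < 1"
  shows "lambert (2 * l + 1) q \<le> q ^ l"
proof -
  have "q ^ (2 * l + 1) \<le> q ^ 1" using assms by (intro power_decreasing) auto
  then have "(1 - q) * q ^ l \<le> q ^ l * (1 - q ^ (2 * l + 1))" using assms by (simp add: mult.commute)
  moreover have "1 - q ^ (2 * l + 1) > 0" using assms by (simp add: power_less_one_iff del: power_Suc)
  ultimately show ?thesis using assms unfolding lambert_odd[OF assms(1)] by (simp add: divide_le_eq)
qed

lemma lambert_ge:
  assumes "0 < q" "q < 1"
  shows "lambert (2 * l + 1) q \<ge> q ^ l / real (2 * l + 1)"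
proof -
  have "geom (2 * l + 1) q \<le> (\<Sum>i<2 * l + 1. 1)"
    unfolding geom_def by (rule sum_mono) (use assms in \<open>auto intro: power_le_one\<close>)
  moreover have "geom (2 * l + 1) q > 0" using geom_pos[of "2 * l + 1" q] assms by simp
  moreover have "q powr ((real (2 * l + 1) - 1) / 2) = q ^ l" using assms by (simp add: powr_realpow)
  ultimately show ?thesis using assms by (subst lambert_geom) (auto intro!: divide_left_mono)
qed

section \<open>The threshold\<close>

text \<open>From ln (e y) \<le> e y - 1; the choice e = d / (4 a) makes the power of y cost half of
  the geometric decay rate d.\<close>

lemma summable_powr_geometric:
  fixes \<alpha> r :: real
  assumes "0 < r" "r < 1"
  shows "summable (\<lambda>l. real (2 * l + 1) powr \<alpha> * r ^ l)"
proof -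
  define a where "a = \<bar>\<alpha>\<bar> + 1"
  define d where "d = - ln r"
  define e where "e = d / (4 * a)"
  have ad: "a > 0" "d > 0" using assms by (auto simp: a_def d_def)
  then have pos: "a > 0" "d > 0" "e > 0" by (auto simp: e_def)
  define C where "C = exp (a * (e - 1 - ln e))"
  have "summable (\<lambda>l. C * exp (- d / 2) ^ l)"
    using pos by (intro summable_mult summable_geometric) simp
  then show ?thesis
  proof (rule summable_comparison_test'[where N = 0])
    fix l :: nat
    define y where "y = real (2 * l + 1)"
    have y: "y \<ge> 1" by (simp add: y_def)
    have "ln (e * y) \<le> e * y - 1" using y pos by (intro ln_le_minus_one) auto
    then have "ln y \<le> e * y - 1 - ln e" using y pos by (simp add: ln_mult)
    then have "a * ln y \<le> a * (e * y - 1 - ln e)" using pos by (intro mult_left_mono) auto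
    also have "\<dots> = a * (e - 1 - ln e) + d / 2 * real l"
      using pos by (simp add: y_def e_def field_simps)
    finally have 1: "a * ln y \<le> a * (e - 1 - ln e) + d / 2 * real l" .
    have "\<alpha> * ln y \<le> a * ln y" using y by (intro mult_right_mono) (auto simp: a_def)
    then have "y powr \<alpha> \<le> exp (a * (e - 1 - ln e) + d / 2 * real l)" using 1 y by (simp add: powr_def)
    moreover have "r ^ l = exp (- d * real l)"
      using assms exp_of_nat_mult[of l "ln r"] by (simp add: d_def mult.commute)
    ultimately have "y powr \<alpha> * r ^ l \<le> exp (a * (e - 1 - ln e) + d / 2 * real l) * exp (- d * real l)"
      by (simp add: mult_right_mono)
    also have "\<dots> = C * exp (- d / 2) ^ l"
      by (simp add: C_def exp_of_nat_mult[symmetric] mult_exp_exp field_simps)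
    finally show "norm (real (2 * l + 1) powr \<alpha> * r ^ l) \<le> C * exp (- d / 2) ^ l"
      using assms by (simp add: y_def)
  qed
qed

definition s_term :: "real \<Rightarrow> nat \<Rightarrow> real \<Rightarrow> real" where
  "s_term \<alpha> l q = real (2 * l + 1) powr \<alpha> * lambert (2 * l + 1) q"

lemma s_term_nonneg: "0 < q \<Longrightarrow> q < 1 \<Longrightarrow> s_term \<alpha> l q \<ge> 0"
  using lambert_pos[of q "2 * l + 1"] by (simp add: s_term_def)

lemma s_term_mono: "0 < q \<Longrightarrow> q \<le> r \<Longrightarrow> r < 1 \<Longrightarrow> s_term \<alpha> l q \<le> s_term \<alpha> l r"
  unfolding s_term_def by (intro mult_left_mono lambert_mono) auto

lemma s_term_0: "0 < q \<Longrightarrow> q < 1 \<Longrightarrow> s_term \<alpha> 0 q = 1"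
  using lambert_1 by (simp add: s_term_def)

lemma summable_s_term:
  assumes "0 < q" "q < 1"
  shows "summable (\<lambda>l. s_term \<alpha> l q)"
  by (rule summable_comparison_test'[OF summable_powr_geometric[OF assms, of \<alpha>], where N = 0])
     (use assms s_term_nonneg lambert_le_power in \<open>auto simp: s_term_def intro!: mult_left_mono\<close>)

lemma s_fun_eq: "0 < q \<Longrightarrow> s_fun \<alpha> q = (\<Sum>l. s_term \<alpha> l q)"
  unfolding s_fun_def s_term_def lambert_odd ..

lemma sum_le_s_fun:
  assumes "0 < q" "q < 1" "finite A"
  shows "(\<Sum>l\<in>A. s_term \<alpha> l q) \<le> s_fun \<alpha> q"
  unfolding s_fun_eq[OF assms(1)]
  by (rule sum_le_suminf[OF summable_s_term]) (use assms s_term_nonneg in auto)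

text \<open>The interval contains 0, the left end point of the intermediate value argument for the
  threshold.\<close>

lemma s_fun_continuous:
  assumes "0 < r" "r < 1"
  shows "continuous_on {0..r} (s_fun \<alpha>)"
proof -
  define g where "g l q = real (2 * l + 1) powr \<alpha> * ((1 - q) * q ^ l / (1 - q ^ (2 * l + 1)))" for l and q :: real
  have nz: "1 - q ^ (2 * l + 1) > 0" if "q \<in> {0..r}" for q l
    using that assms by (simp add: power_less_one_iff del: power_Suc)
  have "uniform_limit {0..r} (\<lambda>n q. \<Sum>l<n. g l q) (\<lambda>q. \<Sum>l. g l q) sequentially"
  proof (rule Weierstrass_m_test[OF _ summable_powr_geometric[OF assms, of \<alpha>]])
    fix l q assume q: "q \<in> {0..r}"
    have "q ^ (2 * l + 1) \<le> q ^ 1" using q assms by (intro power_decreasing) auto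
    then have "(1 - q) * q ^ l \<le> (1 - q ^ (2 * l + 1)) * q ^ l" using q by (intro mult_right_mono) auto
    then have "(1 - q) * q ^ l / (1 - q ^ (2 * l + 1)) \<le> q ^ l"
      using nz[OF q, of l] by (simp add: divide_le_eq mult.commute)
    also have "q ^ l \<le> r ^ l" using q by (intro power_mono) auto
    finally have "(1 - q) * q ^ l / (1 - q ^ (2 * l + 1)) \<le> r ^ l" .
    moreover have nn: "0 \<le> (1 - q) * q ^ l / (1 - q ^ (2 * l + 1))"
      using nz[OF q, of l] q assms by (intro divide_nonneg_nonneg mult_nonneg_nonneg) auto
    ultimately show "norm (g l q) \<le> real (2 * l + 1) powr \<alpha> * r ^ l"
      unfolding g_def real_norm_def abs_mult[of "_ powr _"] abs_of_nonneg[OF nn] abs_of_nonneg[OF powr_ge_zero]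
      by (intro mult_left_mono) auto
  qed
  then have "continuous_on {0..r} (\<lambda>q. \<Sum>l. g l q)"
  proof (rule uniform_limit_theorem[rotated])
    show "\<forall>\<^sub>F n in sequentially. continuous_on {0..r} (\<lambda>q. \<Sum>l<n. g l q)"
      unfolding g_def using nz by (intro always_eventually allI continuous_intros) (auto simp: less_le)
  qed simp
  then show ?thesis by (simp add: g_def s_fun_def[abs_def])
qed

lemma s_fun_0: "s_fun \<alpha> 0 = 1"
proof -
  have "s_fun \<alpha> 0 = (\<Sum>l\<in>{0::nat}. real (2 * l + 1) powr \<alpha> * ((1 - 0) * 0 ^ l / (1 - 0 ^ (2 * l + 1))))"
    unfolding s_fun_def by (rule suminf_finite) auto
  then show ?thesis by simp
qed

text \<open>The terms dominate q^l / (2 l + 1); as q tends to 1, finite sums of these approach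
  partial sums of a divergent series.\<close>

lemma s_fun_unbounded:
  assumes "\<alpha> \<ge> 0"
  shows "\<exists>q. 0 < q \<and> q < 1 \<and> s_fun \<alpha> q > B"
proof -
  have "\<exists>L. (\<Sum>l<L. 1 / real (2 * l + 1)) > B"
  proof (rule ccontr)
    assume "\<not> ?thesis"
    then have "(\<Sum>l<L. 1 / real (2 * l + 1)) \<le> B" for L by (meson not_less)
    then have "summable (\<lambda>l. 1 / real (2 * l + 1))"
      by (intro bounded_imp_summable[of _ B]) (simp_all only: lessThan_Suc_atMost[symmetric], simp)
    then have "summable (\<lambda>l. 2 * (1 / real (2 * l + 1)))" by (rule summable_mult)
    then have "summable (\<lambda>l. inverse (real (Suc l)))"
      by (rule summable_comparison_test'[where N = 0]) (auto simp: field_simps)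
    then show False using not_summable_harmonic[where 'a = real] summable_Suc_iff[of "\<lambda>l. inverse (real l)"] by simp
  qed
  then obtain L where L: "(\<Sum>l<L. 1 / real (2 * l + 1)) > B" by blast
  define P where "P q = (\<Sum>l<L. q ^ l / real (2 * l + 1))" for q :: real
  have "(P \<longlongrightarrow> P 1) (at_left 1)"
    unfolding P_def by (intro tendsto_intros) auto
  moreover have "P 1 > B" using L by (simp add: P_def)
  ultimately have "\<forall>\<^sub>F q in at_left 1. P q > B" by (rule order_tendstoD)
  moreover have "\<forall>\<^sub>F q in at_left (1::real). q \<in> {0<..<1}" by (rule eventually_at_leftI[of 0]) auto
  ultimately have "\<forall>\<^sub>F q in at_left (1::real). q \<in> {0<..<1} \<and> P q > B" by eventually_elim auto
  then obtain q where q: "0 < q" "q < 1" "P q > B"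
    using eventually_happens[of _ "at_left (1::real)"] by auto
  have "P q \<le> (\<Sum>l<L. s_term \<alpha> l q)"
    unfolding P_def
  proof (rule sum_mono)
    fix l
    have "1 * (q ^ l / real (2 * l + 1)) \<le> real (2 * l + 1) powr \<alpha> * lambert (2 * l + 1) q"
      using lambert_ge[OF q(1,2), of l] assms q by (intro mult_mono ge_one_powr_ge_zero) auto
    then show "q ^ l / real (2 * l + 1) \<le> s_term \<alpha> l q" by (simp add: s_term_def)
  qed
  also have "\<dots> \<le> s_fun \<alpha> q" by (rule sum_le_s_fun) (use q in auto)
  finally show ?thesis using q by force
qed

section \<open>Monotonicity of the threshold equation and bounds below the threshold\<close>

context
  fixes p :: nat and \<alpha> :: real
  assumes p: "p \<ge> 3" and \<alpha>: "\<alpha> \<ge> 0"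
begin

text \<open>Twice the summand by which the right-hand side of \<open>r1_eq\<close> exceeds
  2.\<close>

definition gain :: "real \<Rightarrow> real" where
  "gain q = real p powr \<alpha> * lambert (p\<^sup>2) q"

lemma r1_eq_iff: "r1_eq p \<alpha> q \<longleftrightarrow> s_fun \<alpha> q = 2 + gain q / 2"
  by (simp add: r1_eq_def gain_def lambert_def mult_ac)

text \<open>One term of \<open>s_fun\<close> beats the extra term of the threshold in size and beats
  half of it in growth: the term of index p^2 for odd p, of index p^2 - 1 for even p. The bound
  \<open>l \<ge> 4\<close> keeps it apart from the terms of index 1 and 3.\<close>

lemma gain_dominated:
  obtains l where "l \<ge> 4" and "\<And>q r. 0 < q \<Longrightarrow> q \<le> r \<Longrightarrow> r < 1 \<Longrightarrow>
      s_term \<alpha> l q - gain q / 2 \<le> s_term \<alpha> l r - gain r / 2"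
    and "\<And>q. 0 < q \<Longrightarrow> q < 1 \<Longrightarrow> gain q \<le> s_term \<alpha> l q"
proof (cases "odd p")
  case True
  then have "odd (p\<^sup>2)" by simp
  then obtain l where l: "p\<^sup>2 = 2 * l + 1" using oddE by blast
  have "3 * 3 \<le> p * p" using p by (intro mult_mono) auto
  then have l4: "l \<ge> 4" using l by (simp add: power2_eq_square)
  have "p \<le> 2 * l + 1" unfolding l[symmetric] by (simp add: power2_eq_square)
  then have P: "real p powr \<alpha> \<le> real (2 * l + 1) powr \<alpha>" using \<alpha> by (intro powr_mono2) auto
  show ?thesis
  proof (rule that[OF l4])
    fix q r :: real assume qr: "0 < q" "q \<le> r" "r < 1"
    have "(real (2 * l + 1) powr \<alpha> - real p powr \<alpha> / 2) * lambert (2 * l + 1) q \<le>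
        (real (2 * l + 1) powr \<alpha> - real p powr \<alpha> / 2) * lambert (2 * l + 1) r"
      by (rule mult_left_mono[OF lambert_mono[OF qr]])
         (use P powr_ge_zero[of "real p" \<alpha>] in \<open>simp, linarith\<close>)
    then show "s_term \<alpha> l q - gain q / 2 \<le> s_term \<alpha> l r - gain r / 2"
      unfolding s_term_def gain_def l by (simp add: algebra_simps)
  next
    fix q :: real assume q: "0 < q" "q < 1"
    show "gain q \<le> s_term \<alpha> l q"
      unfolding s_term_def gain_def l using P lambert_pos[OF q, of "2 * l + 1"] by (intro mult_right_mono) auto
  qed
next
  case False
  then have p4: "p \<ge> 4" using p by (cases "p = 3") auto
  obtain k where k: "p\<^sup>2 = 2 * k" using False by (auto elim!: evenE simp: power2_eq_square)
  have "4 * p \<le> p * p" using p4 by (intro mult_mono) auto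
  moreover have "p * p = 2 * k" using k by (simp add: power2_eq_square)
  ultimately have k8: "2 * k \<ge> 4 * p" by linarith
  define l where "l = k - 1"
  have l: "p\<^sup>2 = Suc (2 * l + 1)" using k k8 p4 by (simp add: l_def)
  have l4: "l \<ge> 4" using k8 p4 by (simp add: l_def)
  have "p \<le> 2 * l + 1" using l k k8 p4 by simp
  then have P: "real p powr \<alpha> \<le> real (2 * l + 1) powr \<alpha>" using \<alpha> by (intro powr_mono2) auto
  show ?thesis
  proof (rule that[OF l4])
    fix q r :: real assume qr: "0 < q" "q \<le> r" "r < 1"
    \<comment> \<open>Of the weight (2 l + 1) powr \<alpha>, the part p powr \<alpha> is paired with
      the extra term through \<open>lambert_difference_mono\<close>; the rest is
      nonnegative.\<close>
    have "(real (2 * l + 1) powr \<alpha> - real p powr \<alpha>) * lambert (2 * l + 1) q \<le>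
        (real (2 * l + 1) powr \<alpha> - real p powr \<alpha>) * lambert (2 * l + 1) r"
      by (rule mult_left_mono[OF lambert_mono[OF qr]]) (use P in auto)
    moreover have "real p powr \<alpha> * (2 * lambert (2 * l + 1) q - lambert (p\<^sup>2) q) \<le>
       real p powr \<alpha> * (2 * lambert (2 * l + 1) r - lambert (p\<^sup>2) r)"
      unfolding l by (rule mult_left_mono[OF lambert_difference_mono[OF qr]]) (use l4 in auto)
    ultimately show "s_term \<alpha> l q - gain q / 2 \<le> s_term \<alpha> l r - gain r / 2"
      unfolding s_term_def gain_def by (simp add: algebra_simps)
  next
    fix q :: real assume q: "0 < q" "q < 1"
    have "lambert (p\<^sup>2) q \<le> lambert (2 * l + 1) q" unfolding l by (rule lambert_Suc_le[OF q]) simp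
    then show "gain q \<le> s_term \<alpha> l q"
      unfolding s_term_def gain_def using P lambert_pos[OF q, of "p\<^sup>2"] p by (intro mult_mono) auto
  qed
qed

definition r1_defect :: "real \<Rightarrow> real" where
  "r1_defect q = s_fun \<alpha> q - 2 - gain q / 2"

text \<open>The term of \<open>gain_dominated\<close> compensates the subtracted
  \<open>gain\<close>, and the term of index 3 provides strictness.\<close>

lemma r1_defect_strict_mono:
  assumes qr: "0 < q" "q < r" "r < 1"
  shows "r1_defect q < r1_defect r"
proof -
  obtain l where l: "l \<ge> 4" "s_term \<alpha> l q - gain q / 2 \<le> s_term \<alpha> l r - gain r / 2"
    using gain_dominated qr by (metis less_imp_le)
  define d where "d i = s_term \<alpha> i r - s_term \<alpha> i q" for i
  have r: "0 < r" "q < 1" using qr by auto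
  have sd: "summable d" unfolding d_def by (intro summable_diff summable_s_term) (use qr in auto)
  have "(\<Sum>i\<in>{1, l}. d i) \<le> suminf d"
    by (rule sum_le_suminf[OF sd]) (use s_term_mono qr in \<open>auto simp: d_def\<close>)
  also have "suminf d = s_fun \<alpha> r - s_fun \<alpha> q"
    unfolding d_def s_fun_eq[OF qr(1)] s_fun_eq[OF r(1)]
    by (rule suminf_diff[symmetric]) (auto intro!: summable_s_term simp: qr r)
  finally have "d 1 + d l \<le> s_fun \<alpha> r - s_fun \<alpha> q" using l by simp
  moreover have "d 1 > 0" unfolding d_def s_term_def using lambert_strict_mono[OF qr, of 3] by simp
  ultimately show ?thesis using l(2) by (simp add: r1_defect_def d_def)
qed

lemma r1_defect_continuous:
  assumes "0 < r" "r < 1"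
  shows "continuous_on {0..r} r1_defect"
proof -
  define e where "e = (real (p\<^sup>2) - 1) / 2"
  have "3 * 3 \<le> p * p" using p by (intro mult_mono) auto
  then have "e > 0" by (simp add: e_def power2_eq_square flip: of_nat_mult)
  then have e: "continuous_on {0..r} (\<lambda>q. q powr e)"
    by (intro continuous_on_powr' continuous_on_id continuous_on_const) auto
  have nz: "1 - q ^ (p\<^sup>2) \<noteq> 0" if "q \<in> {0..r}" for q
  proof -
    have "q ^ (p\<^sup>2) < 1" using that assms p by (simp add: power_less_one_iff)
    then show ?thesis by simp
  qed
  have "continuous_on {0..r} (\<lambda>q. real p powr \<alpha> * ((1 - q) * q powr e / (1 - q ^ (p\<^sup>2))))"
    using nz by (intro continuous_on_mult continuous_on_divide continuous_on_diff continuous_on_power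
        continuous_on_const continuous_on_id e) auto
  then show ?thesis
    unfolding r1_defect_def[abs_def] gain_def lambert_def e_def
    by (intro continuous_on_diff continuous_on_divide s_fun_continuous[OF assms] continuous_on_const) auto
qed

lemma r1_unique: "\<exists>!q. q \<in> {0<..<1} \<and> r1_eq p \<alpha> q"
proof -
  \<comment> \<open>The level 4 suffices: \<open>gain\<close> is at most \<open>s_fun\<close>, so
    the defect is at least s_fun / 2 - 2.\<close>
  obtain r where r: "0 < r" "r < 1" "s_fun \<alpha> r > 4" using s_fun_unbounded[OF \<alpha>] by blast
  obtain l where l: "gain r \<le> s_term \<alpha> l r" using gain_dominated r by metis
  have "s_term \<alpha> l r \<le> s_fun \<alpha> r" using sum_le_s_fun[OF r(1,2), of "{l}"] by simp
  then have "r1_defect r > 0" using l r by (simp add: r1_defect_def)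
  moreover have "gain 0 = 0" using p by (simp add: gain_def lambert_def)
  then have "r1_defect 0 < 0" by (simp add: r1_defect_def s_fun_0)
  ultimately obtain q where q: "0 \<le> q" "q \<le> r" "r1_defect q = 0"
    using IVT'[of r1_defect 0 0 r] r1_defect_continuous[OF r(1,2)] r by auto
  then have "q \<noteq> 0" using \<open>r1_defect 0 < 0\<close> by auto
  then have q01: "q \<in> {0<..<1}" using q r by auto
  have eq: "r1_eq p \<alpha> x \<longleftrightarrow> r1_defect x = 0" for x by (auto simp: r1_eq_iff r1_defect_def)
  show ?thesis
  proof (rule ex1I[of _ q])
    show "q \<in> {0<..<1} \<and> r1_eq p \<alpha> q" using q q01 eq by simp
    fix x assume "x \<in> {0<..<1} \<and> r1_eq p \<alpha> x"
    then have "0 < x" "x < 1" "r1_defect x = 0" using eq by auto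
    then show "x = q" using r1_defect_strict_mono[of x q] r1_defect_strict_mono[of q x] q(3) q01
      by (cases x q rule: linorder_cases) auto
  qed
qed

lemma below_r1:
  assumes q: "0 < q" "q < r1 p \<alpha>"
  shows "q < 1" "r1_defect q < 0"
proof -
  have "r1 p \<alpha> \<in> {0<..<1} \<and> r1_eq p \<alpha> (r1 p \<alpha>)"
    unfolding r1_def by (rule theI'[OF r1_unique])
  then have r: "r1 p \<alpha> < 1" "r1_defect (r1 p \<alpha>) = 0" by (auto simp: r1_eq_iff r1_defect_def)
  then show "q < 1" using q by simp
  show "r1_defect q < 0" using r1_defect_strict_mono[OF q r(1)] r by simp
qed

text \<open>If \<open>3\<^sup>r\<^sup>+\<^sup>1 \<le> p \<le> 3\<^sup>r\<^sup>+\<^sup>2\<close> then \<open>p\<^sup>2 \<ge> 9 \<cdot> 9\<^sup>r\<close>, and submultiplicativity of the coefficients bounds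
  the \<open>p\<close>-dependent term of the threshold by the coefficient with index \<open>9\<close>.\<close>

lemma below_r1_bounds:
  assumes q0: "0 < q" "q < r1 p \<alpha>"
  shows "s_term \<alpha> 1 q < 1" "s_fun \<alpha> q < 2 + s_term \<alpha> 4 q / 2"
proof -
  note q = q0(1) below_r1(1)[OF q0]
  have D: "s_fun \<alpha> q < 2 + gain q / 2" using below_r1(2)[OF q0] by (simp add: r1_defect_def)
  \<comment> \<open>With x and y the terms of index 3 and 2 l + 1: 1 + x + y \<le> s_fun < 2 + gain
    / 2 \<le> 2 + y / 2, hence x < 1.\<close>
  obtain l where l: "l \<ge> 4" "gain q \<le> s_term \<alpha> l q" using gain_dominated q by metis
  have "(\<Sum>i\<in>{0, 1, l}. s_term \<alpha> i q) \<le> s_fun \<alpha> q" by (rule sum_le_s_fun[OF q]) simp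
  then have "1 + (s_term \<alpha> 1 q + s_term \<alpha> l q) \<le> s_fun \<alpha> q" using l s_term_0[OF q] by simp
  then show x1: "s_term \<alpha> 1 q < 1" using D l(2) s_term_nonneg[OF q, of \<alpha> l] by linarith
  have "\<exists>r. 3 ^ (r + 1) \<le> p \<and> p \<le> 3 ^ (r + 2)"
  proof -
    define r where "r = (LEAST r. p \<le> 3 ^ (r + 2))"
    have "p \<le> 3 ^ (p + 2)" using less_exp[of "p + 2"] power_mono[of 2 "3::nat" "p + 2"] by linarith
    then have r: "p \<le> 3 ^ (r + 2)" unfolding r_def by (rule LeastI)
    show ?thesis
    proof (cases r)
      case 0 then show ?thesis using r p by (intro exI[of _ 0]) auto
    next
      case (Suc k)
      then have "\<not> p \<le> 3 ^ (k + 2)" unfolding r_def using not_less_Least[of k "\<lambda>r. p \<le> 3 ^ (r + 2)"] by (metis lessI)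
      then show ?thesis using r Suc by (intro exI[of _ r]) auto
    qed
  qed
  then obtain r where r: "3 ^ (r + 1) \<le> p" "p \<le> 3 ^ (r + 2)" by blast
  have L3: "lambert (9 ^ k) q \<le> lambert 3 q ^ k" for k
  proof (induction k)
    case 0 then show ?case using lambert_1[OF q] by simp
  next
    case (Suc k)
    have "lambert (9 ^ Suc k) q \<le> lambert 9 q * lambert (9 ^ k) q"
      using lambert_mult_le[OF q, of 9 "9 ^ k"] by simp
    also have "\<dots> \<le> lambert 3 q * lambert 3 q ^ k"
      using Suc lambert_antimono[OF q, of 3 9] lambert_pos[OF q, of "9 ^ k"] lambert_pos[OF q, of 3] by (intro mult_mono) auto
    finally show ?case by simp
  qed
  have "9 * 9 ^ r = (3 ^ (r + 1) :: nat) ^ 2" by (simp add: power2_eq_square power_mult_distrib[symmetric])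
  also have "\<dots> \<le> p\<^sup>2" using r(1) by (intro power_mono) auto
  finally have "lambert (p\<^sup>2) q \<le> lambert (9 * 9 ^ r) q" by (intro lambert_antimono[OF q]) auto
  also have "\<dots> \<le> lambert 9 q * lambert (9 ^ r) q" by (rule lambert_mult_le[OF q]) auto
  also have "\<dots> \<le> lambert 9 q * lambert 3 q ^ r" using L3 lambert_pos[OF q, of 9] by simp
  finally have 1: "lambert (p\<^sup>2) q \<le> lambert 9 q * lambert 3 q ^ r" .
  have "real p powr \<alpha> \<le> (9 * 3 ^ r) powr \<alpha>"
  proof (rule powr_mono2)
    show "real p \<le> 9 * 3 ^ r" using of_nat_mono[OF r(2), where 'a = real] by simp
  qed (use \<alpha> in auto)
  also have "\<dots> = 9 powr \<alpha> * (3 powr \<alpha>) ^ r"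
    by (simp add: powr_mult powr_powr powr_realpow[symmetric] mult.commute)
  finally have 2: "real p powr \<alpha> \<le> 9 powr \<alpha> * (3 powr \<alpha>) ^ r" .
  have "gain q \<le> (9 powr \<alpha> * (3 powr \<alpha>) ^ r) * (lambert 9 q * lambert 3 q ^ r)"
    unfolding gain_def using 1 2 lambert_pos[OF q, of "p\<^sup>2"] p by (intro mult_mono) auto
  also have "\<dots> = s_term \<alpha> 4 q * s_term \<alpha> 1 q ^ r"
    by (simp add: s_term_def power_mult_distrib mult_ac)
  \<comment> \<open>The bound just proved for the term of index 3 removes its r-th power, and with
    it the dependence on the size of p.\<close>
  also have "\<dots> \<le> s_term \<alpha> 4 q * 1"
    using x1 s_term_nonneg[OF q] by (intro mult_left_mono power_le_one) auto
  finally show "s_fun \<alpha> q < 2 + s_term \<alpha> 4 q / 2" using D by simp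
qed

end

text \<open>Submultiplicativity for 9 = 3 * 3. Where the term of index 3 is below 1, this gives the
  ordering y \<le> x that \<open>three_nine_bound\<close> requires.\<close>

lemma s_term_4_le:
  assumes "0 < q" "q < 1"
  shows "s_term \<alpha> 4 q \<le> s_term \<alpha> 1 q ^ 2"
proof -
  have "9 powr \<alpha> = (3 powr \<alpha>) ^ 2"
    by (simp add: power2_eq_square powr_mult[symmetric])
  moreover have "lambert 9 q \<le> lambert 3 q ^ 2"
    using lambert_mult_le[OF assms, of 3 3] by (simp add: power2_eq_square)
  ultimately show ?thesis by (simp add: s_term_def power_mult_distrib)
qed

section \<open>Coercivity of the dilation matrix\<close>

text \<open>The substitution m = j n. It moves weights along the chains n, 3 n, 9 n, so that a
  quadratic form can be collected entry by entry.\<close>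

lemma sum_multiples:
  fixes f g :: "nat \<Rightarrow> real"
  assumes j: "j \<ge> 1" and g: "\<And>m. m > N \<Longrightarrow> g m = 0"
  shows "(\<Sum>n=1..N. f n * g (j * n)) = (\<Sum>m=1..N. (if j dvd m then f (m div j) else 0) * g m)"
proof -
  have "(\<Sum>n=1..N. f n * g (j * n)) = (\<Sum>n\<in>{n\<in>{1..N}. j * n \<le> N}. f n * g (j * n))"
  proof (rule sum.mono_neutral_right)
    show "\<forall>i\<in>{1..N} - {n\<in>{1..N}. j * n \<le> N}. f i * g (j * i) = 0"
    proof
      fix i assume "i \<in> {1..N} - {n\<in>{1..N}. j * n \<le> N}"
      then have "j * i > N" by auto
      then show "f i * g (j * i) = 0" using g by simp
    qed
  qed auto
  also have "\<dots> = (\<Sum>m\<in>{m\<in>{1..N}. j dvd m}. f (m div j) * g m)"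
  proof (rule sum.reindex_bij_witness[of _ "\<lambda>m. m div j" "\<lambda>n. j * n"])
    fix m assume m: "m \<in> {m \<in> {1..N}. j dvd m}"
    then obtain n where n: "m = j * n" by auto
    then have "n \<le> m" using j by simp
    then have "n \<le> N" using m by simp
    then show "m div j \<in> {n \<in> {1..N}. j * n \<le> N}" "j * (m div j) = m" using m n j by auto
  qed (use j in auto)
  also have "\<dots> = (\<Sum>m=1..N. (if j dvd m then f (m div j) else 0) * g m)"
    by (rule sum.mono_neutral_cong_left) auto
  finally show ?thesis .
qed

lemma Re_of_real_mult: "Re (of_real x * z) = x * Re z"
  by simp

lemma Re_mult_cnj_bound: "\<bar>Re (a * cnj b)\<bar> \<le> ((cmod a)\<^sup>2 + (cmod b)\<^sup>2) / 2"
proof -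
  have "\<bar>Re (a * cnj b)\<bar> \<le> cmod a * cmod b"
    using abs_Re_le_cmod[of "a * cnj b"] by (simp add: norm_mult)
  then show ?thesis using sum_squares_bound[of "cmod a" "cmod b"] by simp
qed

text \<open>Expansion of 0 \<le> |a + b + d|^2: two very negative neighbouring products force the
  outer product up.\<close>

lemma Re_triple_bound:
  "Re (a * cnj d) \<ge> - ((cmod a)\<^sup>2 + (cmod b)\<^sup>2 + (cmod d)\<^sup>2) / 2 - Re (a * cnj b) - Re (b * cnj d)"
proof -
  have "0 \<le> (cmod (a + b + d))\<^sup>2" by simp
  also have "\<dots> = (cmod a)\<^sup>2 + (cmod b)\<^sup>2 + (cmod d)\<^sup>2 + 2 * (Re (a * cnj b) + Re (b * cnj d) + Re (a * cnj d))"
    unfolding cmod_power2 by (simp add: power2_eq_square algebra_simps)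
  finally show ?thesis by (simp add: diff_divide_distrib)
qed

text \<open>The terms with ratios \<open>3\<close> and \<open>9\<close> cannot be extremal simultaneously: along a chain
  \<open>n, 3 n, 9 n\<close> the three products are constrained by \<open>0 \<le> \<bar>a\<^sub>n + a\<^sub>3\<^sub>n + a\<^sub>9\<^sub>n\<bar>\<^sup>2\<close>, which is used with
  weight \<open>y\<^sub>n / 4\<close> and saves half of the coefficient \<open>Y\<close>.\<close>

lemma three_nine_bound:
  fixes a :: "nat \<Rightarrow> complex" and x y :: "nat \<Rightarrow> real"
  assumes a: "\<And>n. n > N \<Longrightarrow> a n = 0"
    and xy: "\<And>n. n \<ge> 1 \<Longrightarrow> 0 \<le> y n \<and> y n \<le> x n \<and> x n \<le> X \<and> y n \<le> Y" and YX: "Y \<le> X"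
  shows "(\<Sum>n=1..N. x n * Re (a n * cnj (a (3 * n))) + y n * Re (a n * cnj (a (9 * n))))
    \<ge> - (X + Y / 2) * (\<Sum>n=1..N. (cmod (a n))\<^sup>2)"
proof -
  define A where "A n = (cmod (a n))\<^sup>2" for n
  define \<rho> where "\<rho> n = Re (a n * cnj (a (3 * n)))" for n
  define y1 where "y1 n = (if 3 dvd n then y (n div 3) else 0)" for n
  define y2 where "y2 n = (if 9 dvd n then y (n div 9) else 0)" for n
  \<comment> \<open>The net coefficient of the ratio-3 product at n after the triple bound: half of
    \<open>y n\<close> is spent on the chain starting at n, half of \<open>y1 n\<close> on the chain
    starting at n / 3. It may be negative, hence the absolute values below.\<close>
  define d where "d n = x n - y n / 2 - y1 n / 2" for n
  define d1 where "d1 n = (if 3 dvd n then \<bar>d (n div 3)\<bar> else 0)" for n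
  have A: "A m = 0" and \<rho>: "\<rho> m = 0" if "m > N" for m using a[OF that] by (auto simp: A_def \<rho>_def)
  have Y1: "(\<Sum>n=1..N. y n * \<rho> (3 * n)) = (\<Sum>n=1..N. y1 n * \<rho> n)"
    "(\<Sum>n=1..N. y n * A (3 * n)) = (\<Sum>n=1..N. y1 n * A n)"
    "(\<Sum>n=1..N. y n * A (9 * n)) = (\<Sum>n=1..N. y2 n * A n)"
    "(\<Sum>n=1..N. \<bar>d n\<bar> * A (3 * n)) = (\<Sum>n=1..N. d1 n * A n)"
    using sum_multiples[of 3 N \<rho> y] sum_multiples[of 3 N A y] sum_multiples[of 9 N A y] sum_multiples[of 3 N A "\<lambda>n. \<bar>d n\<bar>"] A \<rho>
    by (simp_all add: y1_def y2_def d1_def)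
  have "- (X + Y / 2) * (\<Sum>n=1..N. A n) \<le> (\<Sum>n=1..N. - ((\<bar>d n\<bar> + d1 n) / 2 + y n / 2 + y1 n / 4 + y2 n / 2) * A n)"
    unfolding sum_distrib_left
  proof (rule sum_mono, rule mult_right_mono)
    fix n assume "n \<in> {1..N}"
    then have n: "n \<ge> 1" by simp
    have b: "0 \<le> y n" "y n \<le> x n" "x n \<le> X" "y n \<le> Y" using xy[OF n] by auto
    \<comment> \<open>Twice the total weight that falls on |a n|^2. Where an absolute value opens
      with a minus sign, y \<le> x and Y \<le> X restore the bound.\<close>
    have "\<bar>d n\<bar> + d1 n + y n + y1 n / 2 + y2 n \<le> 2 * X + Y"
    proof (cases "3 dvd n")
      case False
      then have "\<not> 9 dvd n" using dvd_trans[of 3 9 n] by auto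
      then show ?thesis using False b by (simp add: d_def d1_def y1_def y2_def)
    next
      case True
      then have n3: "n div 3 \<ge> 1" using n by auto
      have y1: "y1 n = y (n div 3)" and d1: "d1 n = \<bar>d (n div 3)\<bar>" using True by (auto simp: y1_def d1_def)
      have y2: "y2 n = y1 (n div 3)"
      proof -
        obtain m where m: "n = 3 * m" using True by auto
        have "9 dvd n \<longleftrightarrow> 3 dvd m" using m by presburger
        then show ?thesis by (auto simp: y2_def y1_def m)
      qed
      have y2b: "0 \<le> y2 n" "y2 n \<le> Y"
      proof -
        have "9 dvd n \<Longrightarrow> n div 9 \<ge> 1" using n by auto
        then show "0 \<le> y2 n" "y2 n \<le> Y" using xy[of "n div 9"] b by (auto simp: y2_def)
      qed
      have b3: "0 \<le> y (n div 3)" "y (n div 3) \<le> x (n div 3)" "x (n div 3) \<le> X" "y (n div 3) \<le> Y"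
        using xy[OF n3] by auto
      have "d (n div 3) = x (n div 3) - y (n div 3) / 2 - y2 n / 2" by (simp add: d_def y2)
      then show ?thesis unfolding y1 d1 d_def[of n] using b b3 y2b YX by linarith
    qed
    then show "- (X + Y / 2) \<le> - ((\<bar>d n\<bar> + d1 n) / 2 + y n / 2 + y1 n / 4 + y2 n / 2)" by (simp add: field_simps)
  qed (simp add: A_def)
  also have "\<dots> = (\<Sum>n=1..N. - \<bar>d n\<bar> * (A n + A (3 * n)) / 2 - y n * A n / 2 - y n * A (3 * n) / 4 - y n * A (9 * n) / 2)"
    using Y1(2-4)
    by (simp add: sum.distrib sum_subtractf sum_negf algebra_simps add_divide_distrib sum_divide_distrib[symmetric])
  also have "\<dots> \<le> (\<Sum>n=1..N. d n * \<rho> n - y n * A n / 2 - y n * A (3 * n) / 4 - y n * A (9 * n) / 2)"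
  proof (rule sum_mono)
    fix n
    have "\<bar>\<rho> n\<bar> \<le> (A n + A (3 * n)) / 2" using Re_mult_cnj_bound by (simp add: \<rho>_def A_def)
    then have "\<bar>d n\<bar> * \<bar>\<rho> n\<bar> \<le> \<bar>d n\<bar> * ((A n + A (3 * n)) / 2)" by (rule mult_left_mono) simp
    moreover have "- (\<bar>d n\<bar> * \<bar>\<rho> n\<bar>) \<le> d n * \<rho> n" by (metis abs_mult abs_ge_minus_self minus_le_iff)
    ultimately show "- \<bar>d n\<bar> * (A n + A (3 * n)) / 2 - y n * A n / 2 - y n * A (3 * n) / 4 - y n * A (9 * n) / 2
      \<le> d n * \<rho> n - y n * A n / 2 - y n * A (3 * n) / 4 - y n * A (9 * n) / 2" by simp
  qed
  also have "\<dots> = (\<Sum>n=1..N. x n * \<rho> n - y n * \<rho> n / 2 - y n * \<rho> (3 * n) / 2 - y n * A n / 2 - y n * A (3 * n) / 4 - y n * A (9 * n) / 2)"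
    using Y1(1)
    by (simp add: d_def sum.distrib sum_subtractf algebra_simps sum_divide_distrib[symmetric])
  also have "\<dots> \<le> (\<Sum>n=1..N. x n * \<rho> n + y n * Re (a n * cnj (a (9 * n))))"
  proof (rule sum_mono)
    fix n assume "n \<in> {1..N}"
    then have yn: "0 \<le> y n" using xy[of n] by auto
    define w where "w = Re (a n * cnj (a (9 * n)))"
    have "- (A n + A (3 * n) + A (9 * n)) / 2 - \<rho> n - \<rho> (3 * n) \<le> w"
      using Re_triple_bound[of "a n" "a (3 * n)" "a (9 * n)"] by (simp add: A_def \<rho>_def w_def)
    moreover have "- (A n + A (9 * n)) / 2 \<le> w"
      using Re_mult_cnj_bound[of "a n" "a (9 * n)"] unfolding A_def w_def by linarith
    \<comment> \<open>The mean of the two preceding lower bounds for w.\<close>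
    ultimately have "- A n / 2 - A (3 * n) / 4 - A (9 * n) / 2 - \<rho> n / 2 - \<rho> (3 * n) / 2 \<le> w" by (simp add: field_simps)
    from mult_left_mono[OF this yn]
    show "x n * \<rho> n - y n * \<rho> n / 2 - y n * \<rho> (3 * n) / 2 - y n * A n / 2 - y n * A (3 * n) / 4 - y n * A (9 * n) / 2
      \<le> x n * \<rho> n + y n * Re (a n * cnj (a (9 * n)))"
      unfolding w_def[symmetric] by (simp add: algebra_simps)
  qed
  finally show ?thesis by (simp add: A_def \<rho>_def)
qed

section \<open>The matrix of the expansion problem\<close>

text \<open>The sine coefficient at m of the n-th function, normalised to 1 on the diagonal and
  multiplied by (m / n) powr \<alpha>, the weight which turns H^\<alpha> into l^2; that power is
  part of \<open>s_term\<close>. For m = (2 l + 1) n, \<open>m div n div 2\<close> is l.\<close>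

definition dil_matrix :: "(nat \<Rightarrow> real) \<Rightarrow> real \<Rightarrow> nat \<Rightarrow> nat \<Rightarrow> real" where
  "dil_matrix q \<alpha> n m = (if n dvd m \<and> odd (m div n) then s_term \<alpha> (m div n div 2) (q n) else 0)"

context
  fixes q :: "nat \<Rightarrow> real" and Q \<alpha> :: real
  assumes q: "\<And>n. n \<ge> 1 \<Longrightarrow> 0 < q n \<and> q n \<le> Q" and Q: "0 < Q" "Q < 1"
begin

lemma q_unit: "n \<ge> 1 \<Longrightarrow> 0 < q n \<and> q n < 1"
  using q Q by (meson le_less_trans)

lemma dil_matrix_diag: "n \<ge> 1 \<Longrightarrow> dil_matrix q \<alpha> n n = 1"
  using q_unit by (simp add: dil_matrix_def s_term_0)

lemma dil_matrix_lower: "m \<ge> 1 \<Longrightarrow> m < n \<Longrightarrow> dil_matrix q \<alpha> n m = 0"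
  by (simp add: dil_matrix_def)

text \<open>The entries are grouped by the ratio k / n = 2 l + 1. Every ratio that occurs has l < R,
  and larger l contribute nothing since b vanishes beyond R.\<close>

lemma dil_matrix_bilinear:
  fixes a b :: "nat \<Rightarrow> complex"
  assumes b: "\<And>k. k > R \<Longrightarrow> b k = 0" and L: "R \<le> L"
  shows "(\<Sum>k=1..R. cnj (b k) * (\<Sum>n=1..R. of_real (dil_matrix q \<alpha> n k) * a n)) =
    (\<Sum>l<L. \<Sum>n=1..R. of_real (s_term \<alpha> l (q n)) * (a n * cnj (b ((2 * l + 1) * n))))"
proof -
  have *: "(\<Sum>k=1..R. of_real (dil_matrix q \<alpha> n k) * cnj (b k)) = (\<Sum>l<L. of_real (s_term \<alpha> l (q n)) * cnj (b ((2 * l + 1) * n)))"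
    if n: "n \<ge> 1" for n
  proof -
    have "(\<Sum>k=1..R. of_real (dil_matrix q \<alpha> n k) * cnj (b k)) =
       (\<Sum>k\<in>{k\<in>{1..R}. n dvd k \<and> odd (k div n)}. of_real (s_term \<alpha> (k div n div 2) (q n)) * cnj (b k))"
      by (rule sum.mono_neutral_cong_right) (auto simp: dil_matrix_def)
    also have "\<dots> = (\<Sum>l\<in>{l\<in>{..<L}. (2 * l + 1) * n \<le> R}. of_real (s_term \<alpha> l (q n)) * cnj (b ((2 * l + 1) * n)))"
    proof (rule sum.reindex_bij_witness[of _ "\<lambda>l. (2 * l + 1) * n" "\<lambda>k. k div n div 2"])
      fix k assume k: "k \<in> {k\<in>{1..R}. n dvd k \<and> odd (k div n)}"
      then obtain l where l: "k div n = 2 * l + 1" by (auto elim: oddE)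
      then have kl: "k = (2 * l + 1) * n" using k by (metis (mono_tags, lifting) dvd_div_mult_self mem_Collect_eq)
      then have "l < k" using n by (cases n) auto
      then show "k div n div 2 \<in> {l\<in>{..<L}. (2 * l + 1) * n \<le> R}" "(2 * (k div n div 2) + 1) * n = k"
        "of_real (s_term \<alpha> (k div n div 2) (q n)) * cnj (b ((2 * (k div n div 2) + 1) * n)) = of_real (s_term \<alpha> (k div n div 2) (q n)) * cnj (b k)"
        using k l kl L by auto
    next
      fix l assume l: "l \<in> {l\<in>{..<L}. (2 * l + 1) * n \<le> R}"
      have dv: "(2 * l + 1) * n div n = 2 * l + 1" using n by (intro nonzero_mult_div_cancel_right) simp
      show "(2 * l + 1) * n div n div 2 = l" "(2 * l + 1) * n \<in> {k\<in>{1..R}. n dvd k \<and> odd (k div n)}"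
        unfolding mem_Collect_eq dv using l n by auto
    qed
    also have "\<dots> = (\<Sum>l<L. of_real (s_term \<alpha> l (q n)) * cnj (b ((2 * l + 1) * n)))"
      by (rule sum.mono_neutral_left) (use b in \<open>auto simp: not_le\<close>)
    finally show ?thesis .
  qed
  have "(\<Sum>k=1..R. cnj (b k) * (\<Sum>n=1..R. of_real (dil_matrix q \<alpha> n k) * a n)) =
      (\<Sum>n=1..R. \<Sum>k=1..R. cnj (b k) * (of_real (dil_matrix q \<alpha> n k) * a n))"
    unfolding sum_distrib_left by (rule sum.swap)
  also have "\<dots> = (\<Sum>n=1..R. a n * (\<Sum>k=1..R. of_real (dil_matrix q \<alpha> n k) * cnj (b k)))"
    unfolding sum_distrib_left by (intro sum.cong refl) (simp add: mult_ac)
  also have "\<dots> = (\<Sum>n=1..R. a n * (\<Sum>l<L. of_real (s_term \<alpha> l (q n)) * cnj (b ((2 * l + 1) * n))))"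
    by (rule sum.cong) (use * in auto)
  also have "\<dots> = (\<Sum>n=1..R. \<Sum>l<L. of_real (s_term \<alpha> l (q n)) * (a n * cnj (b ((2 * l + 1) * n))))"
    unfolding sum_distrib_left by (intro sum.cong refl) (simp only: mult_ac)
  also have "\<dots> = (\<Sum>l<L. \<Sum>n=1..R. of_real (s_term \<alpha> l (q n)) * (a n * cnj (b ((2 * l + 1) * n))))"
    by (rule sum.swap)
  finally show ?thesis .
qed

text \<open>A single ratio is a weighted dilation of norm at most
  \<open>s_term \<alpha> l Q\<close>. The parameter t of Young's inequality stays free: t = 1 serves
  coercivity, t = \<open>s_fun \<alpha> Q\<close> serves boundedness.\<close>

lemma dilation_term_bound:
  fixes a b :: "nat \<Rightarrow> complex"
  assumes b: "\<And>k. k > R \<Longrightarrow> b k = 0" and t: "t > 0"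
  shows "\<bar>\<Sum>n=1..R. s_term \<alpha> l (q n) * Re (a n * cnj (b ((2 * l + 1) * n)))\<bar>
    \<le> s_term \<alpha> l Q * ((t * (\<Sum>n=1..R. (cmod (a n))\<^sup>2) + (\<Sum>n=1..R. (cmod (b n))\<^sup>2) / t) / 2)"
proof -
  have sl: "0 \<le> s_term \<alpha> l (q n)" "s_term \<alpha> l (q n) \<le> s_term \<alpha> l Q" if "n \<ge> 1" for n
    using s_term_nonneg q_unit[OF that] s_term_mono q[OF that] Q by auto
  have sQ: "0 \<le> s_term \<alpha> l Q" using s_term_nonneg Q by simp
  have "\<bar>\<Sum>n=1..R. s_term \<alpha> l (q n) * Re (a n * cnj (b ((2 * l + 1) * n)))\<bar>
    \<le> (\<Sum>n=1..R. \<bar>s_term \<alpha> l (q n) * Re (a n * cnj (b ((2 * l + 1) * n)))\<bar>)" by (rule sum_abs)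
  also have "\<dots> \<le> (\<Sum>n=1..R. s_term \<alpha> l Q * ((t * (cmod (a n))\<^sup>2 + (cmod (b ((2 * l + 1) * n)))\<^sup>2 / t) / 2))"
  proof (rule sum_mono)
    fix n assume "n \<in> {1..R}"
    then have n: "n \<ge> 1" by simp
    define u v where "u = cmod (a n)" and "v = cmod (b ((2 * l + 1) * n))"
    have "\<bar>Re (a n * cnj (b ((2 * l + 1) * n)))\<bar> \<le> u * v"
      using abs_Re_le_cmod[of "a n * cnj (b ((2 * l + 1) * n))"] by (simp add: norm_mult u_def v_def)
    also have "u * v \<le> (t * u\<^sup>2 + v\<^sup>2 / t) / 2"
      using sum_squares_bound[of "t * u" v] t by (simp add: field_simps power2_eq_square)
    finally have "\<bar>Re (a n * cnj (b ((2 * l + 1) * n)))\<bar> \<le> (t * u\<^sup>2 + v\<^sup>2 / t) / 2" .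
    then show "\<bar>s_term \<alpha> l (q n) * Re (a n * cnj (b ((2 * l + 1) * n)))\<bar> \<le> s_term \<alpha> l Q * ((t * (cmod (a n))\<^sup>2 + (cmod (b ((2 * l + 1) * n)))\<^sup>2 / t) / 2)"
      unfolding abs_mult u_def v_def using sl[OF n] sQ by (intro mult_mono) auto
  qed
  also have "\<dots> = s_term \<alpha> l Q * ((t * (\<Sum>n=1..R. (cmod (a n))\<^sup>2) + (\<Sum>n=1..R. (cmod (b ((2 * l + 1) * n)))\<^sup>2) / t) / 2)"
    by (simp only: sum_distrib_left[symmetric] sum_divide_distrib[symmetric] sum.distrib)
  also have "\<dots> \<le> s_term \<alpha> l Q * ((t * (\<Sum>n=1..R. (cmod (a n))\<^sup>2) + (\<Sum>n=1..R. (cmod (b n))\<^sup>2) / t) / 2)"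
  proof -
    have "(\<Sum>n=1..R. 1 * (cmod (b ((2 * l + 1) * n)))\<^sup>2) = (\<Sum>m=1..R. (if 2 * l + 1 dvd m then 1 else 0) * (cmod (b m))\<^sup>2)"
      by (rule sum_multiples) (use b in auto)
    also have "\<dots> \<le> (\<Sum>m=1..R. (cmod (b m))\<^sup>2)" by (rule sum_mono) simp
    finally show ?thesis using sQ t by (intro mult_left_mono divide_right_mono add_left_mono) auto
  qed
  finally show ?thesis .
qed

text \<open>The form is tested with \<open>b\<close>, the image of a; with t = s the estimate
  becomes B \<le> (s^2 S + B) / 2.\<close>

lemma dil_matrix_bounded:
  fixes a :: "nat \<Rightarrow> complex"
  shows "(\<Sum>k=1..R. (cmod (\<Sum>n=1..R. of_real (dil_matrix q \<alpha> n k) * a n))\<^sup>2) \<le> (s_fun \<alpha> Q)\<^sup>2 * (\<Sum>n=1..R. (cmod (a n))\<^sup>2)"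
proof -
  define T where "T k = (\<Sum>n=1..R. of_real (dil_matrix q \<alpha> n k) * a n)" for k
  define b where "b k = (if k \<le> R then T k else 0)" for k
  define s where "s = s_fun \<alpha> Q"
  define S where "S = (\<Sum>n=1..R. (cmod (a n))\<^sup>2)"
  define B where "B = (\<Sum>k=1..R. (cmod (b k))\<^sup>2)"
  have "1 \<le> s" using sum_le_s_fun[OF Q, of "{0}" \<alpha>] s_term_0[OF Q] by (simp add: s_def)
  then have s0: "s > 0" by simp
  have nn: "0 \<le> (s * S + B / s) / 2" using s0 by (simp add: S_def B_def sum_nonneg)
  have "of_real B = (\<Sum>k=1..R. cnj (b k) * (\<Sum>n=1..R. of_real (dil_matrix q \<alpha> n k) * a n))"
    unfolding B_def of_real_sum T_def[symmetric]
  proof (rule sum.cong)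
    fix k assume "k \<in> {1..R}"
    then have "b k = T k" by (simp add: b_def)
    then show "of_real ((cmod (b k))\<^sup>2) = cnj (b k) * T k"
      by (simp only: complex_norm_square mult.commute)
  qed simp
  also have "\<dots> = (\<Sum>l<R. \<Sum>n=1..R. of_real (s_term \<alpha> l (q n)) * (a n * cnj (b ((2 * l + 1) * n))))"
    by (rule dil_matrix_bilinear) (auto simp: b_def)
  finally have "B = Re (\<Sum>l<R. \<Sum>n=1..R. of_real (s_term \<alpha> l (q n)) * (a n * cnj (b ((2 * l + 1) * n))))"
    by (metis Re_complex_of_real)
  also have "\<dots> = (\<Sum>l<R. \<Sum>n=1..R. s_term \<alpha> l (q n) * Re (a n * cnj (b ((2 * l + 1) * n))))"
    by (simp only: Re_sum Re_of_real_mult)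
  also have "\<dots> \<le> (\<Sum>l<R. s_term \<alpha> l Q * ((s * S + B / s) / 2))"
  proof (rule sum_mono)
    fix l
    have "\<bar>\<Sum>n=1..R. s_term \<alpha> l (q n) * Re (a n * cnj (b ((2 * l + 1) * n)))\<bar> \<le> s_term \<alpha> l Q * ((s * S + B / s) / 2)"
      unfolding S_def B_def by (rule dilation_term_bound) (use s0 in \<open>auto simp: b_def\<close>)
    then show "(\<Sum>n=1..R. s_term \<alpha> l (q n) * Re (a n * cnj (b ((2 * l + 1) * n)))) \<le> s_term \<alpha> l Q * ((s * S + B / s) / 2)" by linarith
  qed
  also have "\<dots> = (\<Sum>l<R. s_term \<alpha> l Q) * ((s * S + B / s) / 2)" by (simp only: sum_distrib_right)
  also have "\<dots> \<le> s * ((s * S + B / s) / 2)"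
    unfolding s_def[symmetric] using sum_le_s_fun[OF Q, of "{..<R}" \<alpha>] nn by (intro mult_right_mono) (auto simp: s_def)
  also have "\<dots> = (s\<^sup>2 * S + B) / 2" using s0 by (simp add: field_simps power2_eq_square)
  finally have "B \<le> s\<^sup>2 * S" by simp
  moreover have "B = (\<Sum>k=1..R. (cmod (T k))\<^sup>2)" unfolding B_def by (rule sum.cong) (auto simp: b_def)
  ultimately show ?thesis by (simp add: T_def s_def S_def)
qed

text \<open>The diagonal contributes 1, the ratios 3 and 9 cost h 1 + h 4 / 2 instead of h 1 + h 4,
  and every other ratio costs its full norm.\<close>

lemma dil_matrix_coercive:
  fixes a :: "nat \<Rightarrow> complex"
  assumes s1: "s_term \<alpha> 1 Q < 1"
  shows "Re (\<Sum>k=1..R. cnj (a k) * (\<Sum>n=1..R. of_real (dil_matrix q \<alpha> n k) * a n))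
    \<ge> (2 + s_term \<alpha> 4 Q / 2 - s_fun \<alpha> Q) * (\<Sum>n=1..R. (cmod (a n))\<^sup>2)"
proof -
  define b where "b k = (if k \<le> R then a k else 0)" for k
  define S where "S = (\<Sum>n=1..R. (cmod (b n))\<^sup>2)"
  define h where "h l = s_term \<alpha> l Q" for l
  define V where "V l = (\<Sum>n=1..R. s_term \<alpha> l (q n) * Re (b n * cnj (b ((2 * l + 1) * n))))" for l
  \<comment> \<open>At least 5, so that l = 0, 1, 4, that is the ratios 1, 3 and 9, are in
    range.\<close>
  define L where "L = max R 5"
  have L5: "{0, 1, 4} \<subseteq> {..<L}" by (auto simp: L_def)
  have b0: "b k = 0" if "k > R" for k using that by (simp add: b_def)
  have S: "S = (\<Sum>n=1..R. (cmod (a n))\<^sup>2)" unfolding S_def by (rule sum.cong) (auto simp: b_def)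
  have S0: "S \<ge> 0" by (simp add: S_def sum_nonneg)
  have "(\<Sum>k=1..R. cnj (a k) * (\<Sum>n=1..R. of_real (dil_matrix q \<alpha> n k) * a n)) =
      (\<Sum>k=1..R. cnj (b k) * (\<Sum>n=1..R. of_real (dil_matrix q \<alpha> n k) * b n))"
    by (intro sum.cong refl arg_cong2[where f = "(*)"]) (auto simp: b_def)
  also have "\<dots> = (\<Sum>l<L. \<Sum>n=1..R. of_real (s_term \<alpha> l (q n)) * (b n * cnj (b ((2 * l + 1) * n))))"
    by (rule dil_matrix_bilinear) (auto simp: b_def L_def)
  finally have "Re (\<Sum>k=1..R. cnj (a k) * (\<Sum>n=1..R. of_real (dil_matrix q \<alpha> n k) * a n)) = (\<Sum>l<L. V l)"
    by (simp only: Re_sum Re_of_real_mult V_def)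
  also have "\<dots> = V 0 + (V 1 + V 4) + (\<Sum>l\<in>{..<L} - {0, 1, 4}. V l)"
  proof -
    have "(\<Sum>l<L. V l) = (\<Sum>l\<in>{0, 1, 4}. V l) + (\<Sum>l\<in>{..<L} - {0, 1, 4}. V l)"
      using sum.subset_diff[OF L5, of V] by simp
    then show ?thesis by simp
  qed
  also have "\<dots> \<ge> S + - (h 1 + h 4 / 2) * S + (\<Sum>l\<in>{..<L} - {0, 1, 4}. - h l * S)"
  proof (intro add_mono sum_mono)
    show "S \<le> V 0"
    proof -
      have "s_term \<alpha> 0 (q n) * Re (b n * cnj (b ((2 * 0 + 1) * n))) = (cmod (b n))\<^sup>2" if "n \<in> {1..R}" for n
        unfolding cmod_power2 using s_term_0[of "q n" \<alpha>] q_unit[of n] that by (simp add: power2_eq_square)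
      then show ?thesis unfolding V_def S_def by (intro eq_refl sum.cong) auto
    qed
    have h4: "h 4 \<le> h 1"
    proof -
      have "h 4 \<le> (h 1)\<^sup>2" unfolding h_def by (rule s_term_4_le[OF Q])
      also have "\<dots> \<le> h 1" using s1 s_term_nonneg[OF Q, of \<alpha> 1] by (simp add: h_def power2_eq_square mult_left_le)
      finally show ?thesis .
    qed
    have "- (h 1 + h 4 / 2) * (\<Sum>n=1..R. (cmod (b n))\<^sup>2) \<le>
       (\<Sum>n=1..R. s_term \<alpha> 1 (q n) * Re (b n * cnj (b (3 * n))) + s_term \<alpha> 4 (q n) * Re (b n * cnj (b (9 * n))))"
    proof (rule three_nine_bound[OF b0 _ h4])
      fix n :: nat assume n: "n \<ge> 1"
      have x: "s_term \<alpha> 1 (q n) \<le> h 1" "s_term \<alpha> 4 (q n) \<le> h 4"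
        unfolding h_def using s_term_mono q[OF n] Q by auto
      have "s_term \<alpha> 4 (q n) \<le> (s_term \<alpha> 1 (q n))\<^sup>2" using s_term_4_le q_unit[OF n] by simp
      also have "\<dots> \<le> s_term \<alpha> 1 (q n)"
        using x s1 s_term_nonneg[of "q n" \<alpha> 1] q_unit[OF n] by (simp add: h_def power2_eq_square mult_left_le)
      finally show "0 \<le> s_term \<alpha> 4 (q n) \<and> s_term \<alpha> 4 (q n) \<le> s_term \<alpha> 1 (q n) \<and> s_term \<alpha> 1 (q n) \<le> h 1 \<and> s_term \<alpha> 4 (q n) \<le> h 4"
        using x s_term_nonneg[of "q n" \<alpha> 4] q_unit[OF n] by simp
    qed
    then show "- (h 1 + h 4 / 2) * S \<le> V 1 + V 4" unfolding V_def S_def by (simp add: sum.distrib)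
    fix l
    have "\<bar>V l\<bar> \<le> s_term \<alpha> l Q * ((1 * S + S / 1) / 2)"
      unfolding V_def S_def by (rule dilation_term_bound) (auto simp: b0)
    then show "- h l * S \<le> V l" by (simp add: h_def)
  qed
  also have "S + - (h 1 + h 4 / 2) * S + (\<Sum>l\<in>{..<L} - {0, 1, 4}. - h l * S) =
     (2 + h 4 / 2 - (\<Sum>l<L. h l)) * S"
  proof -
    have "(\<Sum>l<L. h l) = (\<Sum>l\<in>{0, 1, 4}. h l) + (\<Sum>l\<in>{..<L} - {0, 1, 4}. h l)"
      using sum.subset_diff[OF L5, of h] by simp
    moreover have "h 0 = 1" using s_term_0[OF Q] by (simp add: h_def)
    moreover have "(\<Sum>l\<in>{..<L} - {0, 1, 4}. - h l * S) = - (\<Sum>l\<in>{..<L} - {0, 1, 4}. h l) * S"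
      by (simp only: sum_distrib_right[symmetric] sum_negf)
    ultimately show ?thesis by (simp only:) (simp add: algebra_simps)
  qed
  also have "\<dots> \<ge> (2 + h 4 / 2 - s_fun \<alpha> Q) * S"
    using sum_le_s_fun[OF Q, of "{..<L}" \<alpha>] S0 by (intro mult_right_mono) (auto simp: h_def)
  finally show ?thesis unfolding S h_def .
qed

end

section \<open>Expansions for coercive triangular matrices\<close>

text \<open>Forward substitution for a triangular system with unit diagonal.\<close>

fun tri_solve :: "(nat \<Rightarrow> nat \<Rightarrow> complex) \<Rightarrow> (nat \<Rightarrow> complex) \<Rightarrow> nat \<Rightarrow> complex" where
  "tri_solve G F k = F k - (\<Sum>n<k. G n k * tri_solve G F n)"

declare tri_solve.simps [simp del]

context
  fixes G :: "nat \<Rightarrow> nat \<Rightarrow> complex" and F :: "nat \<Rightarrow> complex" and M \<delta> :: real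
  assumes lower: "\<And>n k. k < n \<Longrightarrow> G n k = 0" and diag: "\<And>k. G k k = 1"
    and bounded: "\<And>R a. (\<Sum>k<R. (cmod (\<Sum>n<R. G n k * a n))\<^sup>2) \<le> M * (\<Sum>n<R. (cmod (a n))\<^sup>2)"
    and coercive: "\<And>R a. \<delta> * (\<Sum>n<R. (cmod (a n))\<^sup>2) \<le> Re (\<Sum>k<R. cnj (a k) * (\<Sum>n<R. G n k * a n))"
    and \<delta>: "\<delta> > 0" and F: "summable (\<lambda>k. (cmod (F k))\<^sup>2)"
begin

lemma tri_sum_extend:
  assumes "k < R"
  shows "(\<Sum>n<R. G n k * a n) = (\<Sum>n<k. G n k * a n) + a k"
proof -
  have "(\<Sum>n<R. G n k * a n) = (\<Sum>n<Suc k. G n k * a n)"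
    by (rule sum.mono_neutral_right) (use assms lower in auto)
  then show ?thesis by (simp add: diag)
qed

text \<open>A fixed finite combination looks the same in all sections R \<ge> N, so
  \<open>bounded\<close> controls every partial sum by the same constant.\<close>

lemma residual_summable: "summable (\<lambda>k. (cmod (F k - (\<Sum>n<N. G n k * b n)))\<^sup>2)"
proof -
  define b' where "b' n = (if n < N then b n else 0)" for n
  define T where "T k = (\<Sum>n<N. G n k * b n)" for k
  have T: "T k = (\<Sum>n<R. G n k * b' n)" if "R \<ge> N" for k R
    unfolding T_def by (rule sum.mono_neutral_cong_left) (use that in \<open>auto simp: b'_def\<close>)
  have "summable (\<lambda>k. (cmod (T k))\<^sup>2)"
  proof (rule bounded_imp_summable)
    fix m
    define R where "R = max (Suc m) N"
    have "(\<Sum>k\<le>m. (cmod (T k))\<^sup>2) \<le> (\<Sum>k<R. (cmod (T k))\<^sup>2)"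
      by (rule sum_mono2) (auto simp: R_def)
    also have "\<dots> = (\<Sum>k<R. (cmod (\<Sum>n<R. G n k * b' n))\<^sup>2)" using T[of R] by (simp add: R_def)
    also have "\<dots> \<le> M * (\<Sum>n<R. (cmod (b' n))\<^sup>2)" by (rule bounded)
    also have "(\<Sum>n<R. (cmod (b' n))\<^sup>2) = (\<Sum>n<N. (cmod (b n))\<^sup>2)"
      by (rule sum.mono_neutral_cong_right) (auto simp: R_def b'_def)
    finally show "(\<Sum>k\<le>m. (cmod (T k))\<^sup>2) \<le> M * (\<Sum>n<N. (cmod (b n))\<^sup>2)" .
  qed simp
  with F have "summable (\<lambda>k. 2 * (cmod (F k))\<^sup>2 + 2 * (cmod (T k))\<^sup>2)"
    by (intro summable_add summable_mult)
  then show ?thesis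
  proof (rule summable_comparison_test'[where N = 0])
    fix k
    have "cmod (F k - T k) \<le> cmod (F k) + cmod (T k)" by (rule norm_triangle_ineq4)
    then have "(cmod (F k - T k))\<^sup>2 \<le> (cmod (F k) + cmod (T k))\<^sup>2" by (intro power_mono) auto
    also have "\<dots> \<le> 2 * (cmod (F k))\<^sup>2 + 2 * (cmod (T k))\<^sup>2"
      using sum_squares_bound[of "cmod (F k)" "cmod (T k)"] by (simp add: power2_sum)
    finally show "norm ((cmod (F k - (\<Sum>n<N. G n k * b n)))\<^sup>2) \<le> 2 * (cmod (F k))\<^sup>2 + 2 * (cmod (T k))\<^sup>2"
      by (simp add: T_def)
  qed
qed

text \<open>Existence: forward substitution solves each finite section exactly, so coercivity bounds
  its norm by that of F, independently of the section; the residual after N terms is the image of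
  the tail. Uniqueness: the residual at k no longer changes once N > k, hence it is 0, and the
  system determines the coefficients one by one.\<close>

theorem triangular_expansion_unique:
  "\<exists>!a. (\<lambda>N. \<Sum>k. (cmod (F k - (\<Sum>n<N. G n k * a n)))\<^sup>2) \<longlonglongrightarrow> 0"
proof (rule ex1I)
  let ?a = "tri_solve G F"
  have rec: "F k = (\<Sum>n<R. G n k * ?a n)" if "k < R" for k R
    using tri_sum_extend[OF that, of ?a] tri_solve.simps[of G F k] by simp
  define B where "B = (\<Sum>k. (cmod (F k))\<^sup>2)"
  \<comment> \<open>Young's inequality with weight \<delta> lets half of the coercive term absorb
    the solution on the right.\<close>
  have Sa: "(\<Sum>n<R. (cmod (?a n))\<^sup>2) \<le> B / \<delta>\<^sup>2" for R
  proof -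
    define S where "S = (\<Sum>n<R. (cmod (?a n))\<^sup>2)"
    have "\<delta> * S \<le> Re (\<Sum>k<R. cnj (?a k) * (\<Sum>n<R. G n k * ?a n))" unfolding S_def by (rule coercive)
    also have "(\<Sum>k<R. cnj (?a k) * (\<Sum>n<R. G n k * ?a n)) = (\<Sum>k<R. cnj (?a k) * F k)"
      by (rule sum.cong) (use rec in auto)
    also have "Re \<dots> = (\<Sum>k<R. Re (cnj (?a k) * F k))" by (rule Re_sum)
    also have "\<dots> \<le> (\<Sum>k<R. \<delta> * (cmod (?a k))\<^sup>2 / 2 + (cmod (F k))\<^sup>2 / (2 * \<delta>))"
    proof (rule sum_mono)
      fix k
      have "Re (cnj (?a k) * F k) \<le> cmod (?a k) * cmod (F k)"
        using complex_Re_le_cmod[of "cnj (?a k) * F k"] by (simp add: norm_mult)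
      also have "\<dots> \<le> \<delta> * (cmod (?a k))\<^sup>2 / 2 + (cmod (F k))\<^sup>2 / (2 * \<delta>)"
        using sum_squares_bound[of "\<delta> * cmod (?a k)" "cmod (F k)"] \<delta> by (simp add: field_simps power2_eq_square)
      finally show "Re (cnj (?a k) * F k) \<le> \<delta> * (cmod (?a k))\<^sup>2 / 2 + (cmod (F k))\<^sup>2 / (2 * \<delta>)" .
    qed
    also have "\<dots> = \<delta> * S / 2 + (\<Sum>k<R. (cmod (F k))\<^sup>2) / (2 * \<delta>)"
      by (simp add: S_def sum.distrib sum_distrib_left sum_divide_distrib)
    also have "\<dots> \<le> \<delta> * S / 2 + B / (2 * \<delta>)"
      unfolding B_def using \<delta> by (intro add_left_mono divide_right_mono sum_le_suminf F) auto
    finally show ?thesis using \<delta> unfolding S_def[symmetric] by (simp add: field_simps power2_eq_square)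
  qed
  have sa: "summable (\<lambda>n. (cmod (?a n))\<^sup>2)"
  proof (rule bounded_imp_summable)
    show "(\<Sum>k\<le>m. (cmod (?a k))\<^sup>2) \<le> B / \<delta>\<^sup>2" for m
      using Sa[of "Suc m"] by (simp only: lessThan_Suc_atMost)
  qed simp
  define tail where "tail N = (\<Sum>n. (cmod (?a n))\<^sup>2) - (\<Sum>n<N. (cmod (?a n))\<^sup>2)" for N
  have "(\<lambda>N. \<Sum>n<N. (cmod (?a n))\<^sup>2) \<longlonglongrightarrow> (\<Sum>n. (cmod (?a n))\<^sup>2)"
    using summable_sums[OF sa] by (simp add: sums_def)
  then have "tail \<longlonglongrightarrow> (\<Sum>n. (cmod (?a n))\<^sup>2) - (\<Sum>n. (cmod (?a n))\<^sup>2)"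
    unfolding tail_def by (intro tendsto_intros)
  then have tail: "(\<lambda>N. \<bar>M\<bar> * tail N) \<longlonglongrightarrow> 0" using tendsto_mult_right_zero by simp
  have le: "(\<Sum>k. (cmod (F k - (\<Sum>n<N. G n k * ?a n)))\<^sup>2) \<le> \<bar>M\<bar> * tail N" for N
  proof (rule suminf_le_const[OF residual_summable])
    fix m
    define R where "R = max m N"
    define a' where "a' n = (if n < N then 0 else ?a n)" for n
    have e: "F k - (\<Sum>n<N. G n k * ?a n) = (\<Sum>n<R. G n k * a' n)" if "k < R" for k
    proof -
      have "(\<Sum>n<N. G n k * ?a n) = (\<Sum>n<R. G n k * (?a n - a' n))"
        by (rule sum.mono_neutral_cong_left) (auto simp: R_def a'_def)
      then show ?thesis using rec[OF that] by (simp add: sum_subtractf right_diff_distrib)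
    qed
    have "(\<Sum>k<m. (cmod (F k - (\<Sum>n<N. G n k * ?a n)))\<^sup>2) \<le> (\<Sum>k<R. (cmod (F k - (\<Sum>n<N. G n k * ?a n)))\<^sup>2)"
      by (rule sum_mono2) (auto simp: R_def)
    also have "\<dots> = (\<Sum>k<R. (cmod (\<Sum>n<R. G n k * a' n))\<^sup>2)" by (rule sum.cong) (auto simp: e)
    also have "\<dots> \<le> M * (\<Sum>n<R. (cmod (a' n))\<^sup>2)" by (rule bounded)
    also have "(\<Sum>n<R. (cmod (a' n))\<^sup>2) = (\<Sum>n<R. (cmod (?a n))\<^sup>2) - (\<Sum>n<N. (cmod (?a n))\<^sup>2)"
    proof -
      have "(\<Sum>n<N. (cmod (?a n))\<^sup>2) = (\<Sum>n<R. (cmod (?a n))\<^sup>2 - (cmod (a' n))\<^sup>2)"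
        by (rule sum.mono_neutral_cong_left) (auto simp: R_def a'_def)
      then show ?thesis by (simp add: sum_subtractf)
    qed
    \<comment> \<open>The sign of M is not among the assumptions, while the next comparison
      multiplies an inequality by the constant.\<close>
    also have "M * \<dots> \<le> \<bar>M\<bar> * \<dots>"
      by (rule mult_right_mono) (auto simp: R_def intro!: sum_mono2)
    also have "\<dots> \<le> \<bar>M\<bar> * tail N"
      unfolding tail_def by (intro mult_left_mono diff_right_mono sum_le_suminf sa) auto
    finally show "(\<Sum>k<m. (cmod (F k - (\<Sum>n<N. G n k * ?a n)))\<^sup>2) \<le> \<bar>M\<bar> * tail N" .
  qed
  show "(\<lambda>N. \<Sum>k. (cmod (F k - (\<Sum>n<N. G n k * ?a n)))\<^sup>2) \<longlonglongrightarrow> 0"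
    by (rule tendsto_sandwich[OF _ _ tendsto_const tail])
       (auto intro!: always_eventually le suminf_nonneg residual_summable)
  fix b assume b: "(\<lambda>N. \<Sum>k. (cmod (F k - (\<Sum>n<N. G n k * b n)))\<^sup>2) \<longlonglongrightarrow> 0"
  have eq: "F k = (\<Sum>n<k. G n k * b n) + b k" for k
  proof -
    define e where "e = (cmod (F k - ((\<Sum>n<k. G n k * b n) + b k)))\<^sup>2"
    have "\<forall>\<^sub>F N in sequentially. e \<le> (\<Sum>j. (cmod (F j - (\<Sum>n<N. G n j * b n)))\<^sup>2)"
      using eventually_gt_at_top[of k]
    proof eventually_elim
      case (elim N)
      have "(\<Sum>j\<in>{k}. (cmod (F j - (\<Sum>n<N. G n j * b n)))\<^sup>2) \<le> (\<Sum>j. (cmod (F j - (\<Sum>n<N. G n j * b n)))\<^sup>2)"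
        by (rule sum_le_suminf[OF residual_summable]) auto
      then show ?case using tri_sum_extend[OF elim, of b] by (simp add: e_def)
    qed
    then have "e \<le> 0" by (rule tendsto_lowerbound[OF b]) simp
    then have "e = 0" by (simp add: e_def)
    then show ?thesis by (simp add: e_def)
  qed
  have "b k = ?a k" for k
  proof (induction k rule: less_induct)
    case (less k)
    have "b k = F k - (\<Sum>n<k. G n k * b n)" using eq[of k] by simp
    also have "(\<Sum>n<k. G n k * b n) = (\<Sum>n<k. G n k * ?a n)" by (rule sum.cong) (auto simp: less)
    finally show ?case using tri_solve.simps[of G F k] by simp
  qed
  then show "b = ?a" by blast
qed

end

context
  fixes q :: "nat \<Rightarrow> real" and Q \<alpha> :: real and F :: "nat \<Rightarrow> complex"
  assumes q: "\<And>n. n \<ge> 1 \<Longrightarrow> 0 < q n \<and> q n \<le> Q" and Q: "0 < Q" "Q < 1"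
    and s1: "s_term \<alpha> 1 Q < 1" and s: "s_fun \<alpha> Q < 2 + s_term \<alpha> 4 Q / 2"
    and F: "summable (\<lambda>k. (cmod (F k))\<^sup>2)"
begin

text \<open>Passage from indices n \<ge> 1 to the indices from 0 in which coefficients are counted
  in \<open>H_basis\<close>.\<close>

lemma dil_matrix_shift:
  "(\<Sum>k<R. (cmod (\<Sum>n<R. of_real (dil_matrix q \<alpha> (Suc n) (Suc k)) * a n))\<^sup>2) \<le> (s_fun \<alpha> Q)\<^sup>2 * (\<Sum>n<R. (cmod (a n))\<^sup>2)"
  "(2 + s_term \<alpha> 4 Q / 2 - s_fun \<alpha> Q) * (\<Sum>n<R. (cmod (a n))\<^sup>2) \<le>
    Re (\<Sum>k<R. cnj (a k) * (\<Sum>n<R. of_real (dil_matrix q \<alpha> (Suc n) (Suc k)) * a n))"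
  using dil_matrix_bounded[OF q Q, where R = R and \<alpha> = \<alpha> and a = "\<lambda>n. a (n - 1)"]
    dil_matrix_coercive[OF q Q s1, where R = R and a = "\<lambda>n. a (n - 1)"]
  by (simp_all add: sum.atLeast1_atMost_eq)

lemma dil_matrix_expansion:
  "\<exists>!a. (\<lambda>N. \<Sum>k. (cmod (F k - (\<Sum>n<N. of_real (dil_matrix q \<alpha> (Suc n) (Suc k)) * a n)))\<^sup>2) \<longlonglongrightarrow> 0"
  by (rule triangular_expansion_unique[OF _ _ dil_matrix_shift _ F])
     (use s in \<open>auto simp: dil_matrix_lower[OF q Q] dil_matrix_diag[OF q Q]\<close>)

lemma dil_matrix_residual_summable:
  "summable (\<lambda>k. (cmod (F k - (\<Sum>n<N. of_real (dil_matrix q \<alpha> (Suc n) (Suc k)) * b n)))\<^sup>2)"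
  by (rule residual_summable[OF _ _ dil_matrix_shift _ F])
     (use s in \<open>auto simp: dil_matrix_lower[OF q Q] dil_matrix_diag[OF q Q]\<close>)

end

section \<open>The Gross--Pitaevskii eigenfunctions\<close>

text \<open>The modulus times \<open>sn_scale c\<close> is \<open>sn_amp c\<close>, and K is
  \<open>sn_scale c\<close> times pi/2; so amplitude and argument depend on the modulus only through
  F.\<close>

lemma gp_u_eq:
  assumes c: "c > 0"
  shows "gp_u n (sn_mod c) x = sqrt 2 * pi * real n * sn_real c (pi * real n * x)"
proof -
  have b: "sn_scale c > 0" "sn_amp c > 0" using sn_scale_pos[OF c] sn_amp_pos[OF c] by auto
  have "2 * ellK (sn_mod c) * real n * x = sn_scale c * (pi * real n * x)"
    by (simp add: ellK_sn_mod[OF c])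
  then have "jacobi_sn (2 * ellK (sn_mod c) * real n * x) (sn_mod c) = sn_real c (pi * real n * x) / sn_amp c"
    by (simp only: jacobi_sn_eq[OF c])
  moreover have "(2::real) powr (3/2) = 2 * sqrt 2"
    using powr_add[of "2::real" 1 "1/2"] by (simp add: powr_half_sqrt)
  moreover have "sn_mod c * sn_scale c = sn_amp c" using b by (simp add: sn_mod_def[OF c])
  moreover have "gp_u n (sn_mod c) x = 2 powr (3/2) * real n * (sn_mod c * sn_scale c) * (pi / 2) *
      jacobi_sn (2 * ellK (sn_mod c) * real n * x) (sn_mod c)"
    by (simp add: gp_u_def ellK_sn_mod[OF c])
  ultimately show ?thesis using b by simp
qed

lemma sn_real_npi: "c > 0 \<Longrightarrow> sn_real c (pi * real n) = 0"
proof -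
  assume c: "c > 0"
  have "sin (real (2 * l + 1) * (pi * real n)) = 0" for l
  proof -
    have "real (2 * l + 1) * (pi * real n) = real ((2 * l + 1) * n) * pi" by (simp only: of_nat_mult mult_ac)
    then show ?thesis by (simp only: sin_npi)
  qed
  then show ?thesis using sn_real_sums[OF c, of "pi * real n"] sums_unique by fastforce
qed

text \<open>With r = pi n the function is sqrt 2 r F (r x). The factor sqrt 2 turns 2 F^3 into the
  cube of u, and r^2 C is the eigenvalue because C is the sum of the squares of
  \<open>sn_amp c\<close> and \<open>sn_scale c\<close>.\<close>

lemma gp_eigenfunction_sn:
  assumes c: "c > 0" and n: "n \<ge> 1"
  shows "gp_eigenfunction (gp_eta n (sn_mod c)) (gp_u n (sn_mod c))"
proof -
  define r where "r = pi * real n"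
  define u where "u = gp_u n (sn_mod c)"
  have u: "u = (\<lambda>x. sqrt 2 * r * sn_real c (r * x))"
    by (simp add: u_def fun_eq_iff gp_u_eq[OF c] r_def)
  have r: "r > 0" using n by (simp add: r_def)
  have 1: "\<exists>x\<in>{0..1}. u x \<noteq> 0"
  proof
    \<comment> \<open>The end of the first quarter period, where F equals \<open>sn_amp c\<close>;
      this shows that u is not identically 0.\<close>
    have "r * (1 / (2 * real n)) = pi / 2" using n by (simp add: r_def)
    then have "u (1 / (2 * real n)) = sqrt 2 * r * sn_amp c"
      unfolding u by (simp only: sn_amp_def[OF c])
    then show "u (1 / (2 * real n)) \<noteq> 0" using r sn_amp_pos[OF c] by simp
    show "1 / (2 * real n) \<in> {0..1}" using n by (simp add: field_simps)
  qed
  have 2: "u 0 = 0" "u 1 = 0" using sn_real_0[OF c] sn_real_npi[OF c, of n] by (simp_all add: u r_def)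
  define v where "v x = sqrt 2 * r * (r * sn_real' c (r * x))" for x
  define w where "w x = sqrt 2 * r * (r * (r * (2 * sn_real c (r * x) ^ 3 - wave_const c * sn_real c (r * x))))" for x
  have d: "((\<lambda>x. r * x) has_real_derivative r) (at x)" for x by (auto intro!: derivative_eq_intros)
  have dv: "(u has_real_derivative v x) (at x)" for x
    unfolding u v_def using DERIV_cmult[OF DERIV_chain2[OF sn_real_derivative[OF c] d], of "sqrt 2 * r" x] by (simp only: mult_ac)
  have dw: "(v has_real_derivative w x) (at x)" for x
    unfolding v_def[abs_def] w_def
    using DERIV_cmult[OF DERIV_cmult[OF DERIV_chain2[OF sn_real'_derivative[OF c] d]], of "sqrt 2 * r" r x] by (simp only: mult_ac)
  have eta: "gp_eta n (sn_mod c) = r\<^sup>2 * wave_const c"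
  proof -
    have "sn_mod c * sn_scale c = sn_amp c" using sn_scale_pos[OF c] by (simp add: sn_mod_def[OF c])
    moreover have "gp_eta n (sn_mod c) = r\<^sup>2 * ((sn_mod c * sn_scale c)\<^sup>2 + (sn_scale c)\<^sup>2)"
      by (simp add: gp_eta_def ellK_sn_mod[OF c] r_def power2_eq_square algebra_simps)
    ultimately show ?thesis by (simp add: wave_const_eq[OF c])
  qed
  have "w x - u x ^ 3 + gp_eta n (sn_mod c) * u x = 0" for x
  proof -
    have "sqrt 2 ^ 3 = 2 * sqrt 2" by (simp add: power3_eq_cube)
    then show ?thesis unfolding eta u w_def power_mult_distrib
      by (simp add: power2_eq_square power3_eq_cube algebra_simps)
  qed
  then show ?thesis
    unfolding gp_eigenfunction_def u_def[symmetric]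
    using 1 2 dv dw has_field_derivative_at_within by blast
qed

section \<open>Sine coefficients of the eigenfunctions\<close>

text \<open>The number c with q = exp (- 2 c).\<close>

definition nome_rate :: "real \<Rightarrow> real" where "nome_rate q = - ln q / 2"

lemma nome_rate_pos: "0 < q \<Longrightarrow> q < 1 \<Longrightarrow> nome_rate q > 0"
  by (simp add: nome_rate_def)

lemma modulus_eq_sn_mod:
  assumes "0 < \<mu>" "\<mu> < 1" "nome \<mu> = q" "0 < q" "q < 1"
  shows "\<mu> = sn_mod (nome_rate q)"
proof (rule nome_inj)
  have c: "nome_rate q > 0" using nome_rate_pos assms by simp
  show "0 < sn_mod (nome_rate q)" "sn_mod (nome_rate q) < 1" using sn_mod_bounds[OF c] by auto
  show "nome \<mu> = nome (sn_mod (nome_rate q))"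
    using assms nome_sn_mod[OF c] by (simp add: nome_rate_def)
qed (use assms in auto)

text \<open>With m = 2 l + 1, 1 - q^m = 2 exp (- m c) sinh (m c); the exponentials cancel against
  q^l.\<close>

lemma lambert_csch:
  assumes q: "0 < q" "q < 1"
  shows "csch_odd (nome_rate q) (int l) = lambert (2 * l + 1) q / sinh (nome_rate q)"
proof -
  define c where "c = nome_rate q"
  have c: "c > 0" using nome_rate_pos[OF q] by (simp add: c_def)
  define m where "m = real (2 * l + 1)"
  have m: "m * c > 0" using c by (simp add: m_def)
  have E: "exp (- (m * c)) * exp (m * c) = 1" "exp (- c) * exp c = 1" by (simp_all flip: exp_add)
  have q1: "q = exp (- c) * exp (- c)"
    using q by (simp add: c_def nome_rate_def flip: exp_add)
  have qm: "q ^ (2 * l + 1) = exp (- (m * c)) * exp (- (m * c))"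
  proof -
    have "exp (- (m * c)) = exp (- c) ^ (2 * l + 1)"
      using exp_of_nat_mult[of "2 * l + 1" "- c"] by (simp only: m_def mult_minus_right)
    then show ?thesis unfolding q1 by (simp only: power_mult_distrib)
  qed
  have ql: "q ^ l * exp (- c) = exp (- (m * c))"
  proof -
    have "q = exp (- 2 * c)" unfolding q1 by (simp flip: exp_add)
    then have "q ^ l = exp (real l * (- 2 * c))" by (simp only: exp_of_nat_mult)
    then show ?thesis by (simp add: m_def algebra_simps flip: exp_add)
  qed
  have "(1 - q) * q ^ l / (1 - q ^ (2 * l + 1)) = sinh c / sinh (m * c)"
  proof -
    have a: "1 - q = 2 * exp (- c) * sinh c"
      using E(2) unfolding q1 by (simp add: sinh_field_def right_diff_distrib)
    have b: "1 - q ^ (2 * l + 1) = 2 * exp (- (m * c)) * sinh (m * c)"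
      using E(1) unfolding qm by (simp add: sinh_field_def right_diff_distrib)
    have "(1 - q) * q ^ l = 2 * sinh c * exp (- (m * c))" unfolding a ql[symmetric] by simp
    then show ?thesis unfolding b by simp
  qed
  then have "lambert (2 * l + 1) q = sinh c / sinh (m * c)" using lambert_odd[OF q(1), of l] by simp
  then show ?thesis using c by (simp add: csch_odd_def[OF c] c_def[symmetric] m_def)
qed

definition eigen_wave :: "real \<Rightarrow> nat \<Rightarrow> real \<Rightarrow> complex" where
  "eigen_wave q n x = of_real (gp_u n (sn_mod (nome_rate q)) x)"

text \<open>The sine coefficient of the n-th eigenfunction at its own index n, since
  \<open>lambert 1 q\<close> is 1.\<close>

definition eigen_norm :: "real \<Rightarrow> nat \<Rightarrow> real" where
  "eigen_norm q n = 2 * pi * real n / sinh (nome_rate q)"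

lemma eigen_wave_series:
  fixes q :: real and n :: nat
  assumes q: "0 < q" "q < 1"
  defines "\<beta> \<equiv> (\<lambda>l. of_real (sqrt 2 * (eigen_norm q n * lambert (2 * l + 1) q)) :: complex)"
  shows "eigen_wave q n = (\<lambda>x. \<Sum>l. \<beta> l * of_real (sin (real ((2 * l + 1) * n) * pi * x)))"
    and "summable (\<lambda>l. norm (\<beta> l))"
proof -
  define c where "c = nome_rate q"
  have c: "c > 0" using nome_rate_pos[OF q] by (simp add: c_def)
  have \<beta>: "\<beta> l = of_real (sqrt 2 * pi * real n * (2 * csch_odd c (int l)))" for l
    unfolding \<beta>_def c_def lambert_csch[OF q] by (simp add: eigen_norm_def mult_ac)
  have "(\<lambda>l. \<beta> l * of_real (sin (real ((2 * l + 1) * n) * pi * x))) sums eigen_wave q n x" for x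
  proof -
    have "(\<lambda>l. sqrt 2 * pi * real n * (2 * csch_odd c (int l) * sin (real (2 * l + 1) * (pi * real n * x)))) sums gp_u n (sn_mod c) x"
      unfolding gp_u_eq[OF c] by (rule sums_mult[OF sn_real_sums[OF c]])
    then have "(\<lambda>l. of_real (sqrt 2 * pi * real n * (2 * csch_odd c (int l) * sin (real (2 * l + 1) * (pi * real n * x)))) :: complex) sums eigen_wave q n x"
      unfolding eigen_wave_def c_def[symmetric] by (simp only: sums_of_real_iff)
    moreover have "real (2 * l + 1) * (pi * real n * x) = real ((2 * l + 1) * n) * pi * x" for l
      by (simp only: of_nat_mult mult_ac)
    ultimately show ?thesis unfolding \<beta> by (simp only: of_real_mult mult_ac)
  qed
  then show "eigen_wave q n = (\<lambda>x. \<Sum>l. \<beta> l * of_real (sin (real ((2 * l + 1) * n) * pi * x)))"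
    by (simp add: fun_eq_iff sums_iff)
  have "summable (\<lambda>l. \<bar>sqrt 2 * pi * real n * 2\<bar> * norm (csch_odd c (int l)))"
    by (rule summable_mult[OF summable_csch_odd[OF c]])
  then show "summable (\<lambda>l. norm (\<beta> l))" unfolding \<beta> norm_of_real by (simp add: abs_mult mult_ac)
qed

text \<open>The nonzero coefficients sit at k = (2 l + 1) n. The weight k powr \<alpha> splits into
  (2 l + 1) powr \<alpha>, which belongs to the matrix, and n powr \<alpha>, which joins a scale
  factor independent of k.\<close>

lemma sine_coeff_eigen_wave:
  assumes q: "\<And>n. n \<ge> 1 \<Longrightarrow> 0 < q n \<and> q n \<le> Q" and Q: "0 < Q" "Q < 1" and n: "n \<ge> 1" and k: "k \<ge> 1"
  shows "of_real (real k powr \<alpha>) * sine_coeff (eigen_wave (q n) n) k =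
    of_real (dil_matrix q \<alpha> n k) * of_real (eigen_norm (q n) n * real n powr \<alpha>)"
proof -
  have qn: "0 < q n" "q n < 1" using q[OF n] Q by auto
  have "sine_coeff (eigen_wave (q n) n) k = (\<Sum>l. if (2 * l + 1) * n = k then
      of_real (sqrt 2 * (eigen_norm (q n) n * lambert (2 * l + 1) (q n))) / of_real (sqrt 2) else 0)"
    unfolding eigen_wave_series(1)[OF qn]
    by (rule sine_coeff_sine_series[OF eigen_wave_series(2)[OF qn] _ k]) (use n in auto)
  also have "\<dots> = (\<Sum>l. if (2 * l + 1) * n = k then of_real (eigen_norm (q n) n * lambert (2 * l + 1) (q n)) else 0)"
    by (intro suminf_cong) simp
  finally have sc: "sine_coeff (eigen_wave (q n) n) k =
    (\<Sum>l. if (2 * l + 1) * n = k then of_real (eigen_norm (q n) n * lambert (2 * l + 1) (q n)) else 0)" .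
  show ?thesis
  proof (cases "n dvd k \<and> odd (k div n)")
    case False
    have "(2 * l + 1) * n \<noteq> k" for l
    proof
      assume *: "(2 * l + 1) * n = k"
      have "(2 * l + 1) * n div n = 2 * l + 1" using n by (intro nonzero_mult_div_cancel_right) simp
      then show False using False * by (metis dvd_triv_right even_plus_one_iff dvd_triv_left)
    qed
    then show ?thesis using False unfolding sc dil_matrix_def by auto
  next
    case True
    then obtain l0 where l0: "k div n = 2 * l0 + 1" by (auto elim: oddE)
    then have k0: "k = (2 * l0 + 1) * n" using True by (metis dvd_div_mult_self)
    have "((2 * l + 1) * n = k) = (l = l0)" for l using n unfolding k0 by simp
    then have "sine_coeff (eigen_wave (q n) n) k = (\<Sum>l. if l = l0 then of_real (eigen_norm (q n) n * lambert (2 * l + 1) (q n)) else 0)"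
      unfolding sc by (simp only:)
    also have "\<dots> = of_real (eigen_norm (q n) n * lambert (2 * l0 + 1) (q n))"
      by (subst suminf_finite[of "{l0}"]) auto
    finally have "sine_coeff (eigen_wave (q n) n) k = of_real (eigen_norm (q n) n * lambert (2 * l0 + 1) (q n))" .
    moreover have "real k powr \<alpha> = real (2 * l0 + 1) powr \<alpha> * real n powr \<alpha>"
      unfolding k0 of_nat_mult by (rule powr_mult)
    moreover have "dil_matrix q \<alpha> n k = real (2 * l0 + 1) powr \<alpha> * lambert (2 * l0 + 1) (q n)"
      using True l0 by (simp add: dil_matrix_def s_term_def)
    ultimately show ?thesis by (simp add: mult_ac)
  qed
qed

lemma continuous_eigen_wave:
  assumes "0 < q" "q < 1"
  shows "continuous_on S (eigen_wave q n)"
  unfolding eigen_wave_series(1)[OF assms]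
  by (rule continuous_on_subset[OF continuous_on_sine_series[OF eigen_wave_series(2)[OF assms]]]) simp

section \<open>Membership in the spaces, norms, and the basis property\<close>

lemma L2_unit_continuous:
  assumes "continuous_on UNIV f"
  shows "f \<in> L2_unit"
proof -
  have "integrable (lebesgue_on {0<..<1}) f"
    by (rule integrable_on_unit(1)[OF continuous_on_subset[OF assms]]) simp
  moreover have "integrable (lebesgue_on {0<..<1}) (\<lambda>x. complex_of_real ((cmod (f x))\<^sup>2))"
    by (intro integrable_on_unit continuous_intros continuous_on_subset[OF assms]) simp
  ultimately show ?thesis
    unfolding L2_unit_def complex_of_real_integrable_eq by (auto intro: borel_measurable_integrable)
qed

text \<open>|f| \<le> 1 + |f|^2, and the interval has finite measure.\<close>

lemma L2_unit_sin_integrable: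
  assumes "f \<in> L2_unit"
  shows "integrable (lebesgue_on {0<..<1}) (\<lambda>x. f x * of_real (sin (a * x)))"
proof (rule Bochner_Integration.integrable_bound)
  let ?M = "lebesgue_on {0<..<1::real}"
  have f: "f \<in> borel_measurable ?M" "integrable ?M (\<lambda>x. (cmod (f x))\<^sup>2)" using assms by (auto simp: L2_unit_def)
  have "integrable ?M (\<lambda>x. norm (1 :: complex))" by (intro integrable_norm integrable_on_unit) simp
  then show "integrable ?M (\<lambda>x. 1 + (cmod (f x))\<^sup>2)" using f(2) by simp
  have "(\<lambda>x. complex_of_real (sin (a * x))) \<in> borel_measurable ?M"
    by (intro borel_measurable_integrable integrable_on_unit continuous_intros)
  then show "(\<lambda>x. f x * of_real (sin (a * x))) \<in> borel_measurable ?M" using f(1) by simp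
  show "AE x in ?M. norm (f x * of_real (sin (a * x))) \<le> norm (1 + (cmod (f x))\<^sup>2)"
  proof (rule AE_I2)
    fix x
    have "norm (f x * of_real (sin (a * x))) \<le> cmod (f x)" by (simp add: norm_mult mult_left_le)
    also have "\<dots> \<le> 1 + (cmod (f x))\<^sup>2"
      using sum_squares_bound[of 1 "cmod (f x)"] norm_ge_zero[of "f x"] unfolding power_one by linarith
    finally show "norm (f x * of_real (sin (a * x))) \<le> norm (1 + (cmod (f x))\<^sup>2)" by simp
  qed
qed

lemma sine_coeff_diff_sum:
  assumes f: "f \<in> L2_unit" and g: "\<And>n. g n \<in> L2_unit"
  shows "sine_coeff (\<lambda>x. f x - (\<Sum>n<N. c n * g n x)) k = sine_coeff f k - (\<Sum>n<N. sine_coeff (g n) k * c n)"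
proof -
  let ?M = "lebesgue_on {0<..<1::real}"
  let ?s = "\<lambda>x. complex_of_real (sin (real k * pi * x))"
  have "(LINT x|?M. (f x - (\<Sum>n<N. c n * g n x)) * ?s x) = (LINT x|?M. f x * ?s x - (\<Sum>n<N. c n * (g n x * ?s x)))"
    by (simp add: left_diff_distrib sum_distrib_right mult.assoc)
  also have "\<dots> = (LINT x|?M. f x * ?s x) - (LINT x|?M. (\<Sum>n<N. c n * (g n x * ?s x)))"
    by (intro Bochner_Integration.integral_diff Bochner_Integration.integrable_sum integrable_mult_right L2_unit_sin_integrable f g)
  also have "(LINT x|?M. (\<Sum>n<N. c n * (g n x * ?s x))) = (\<Sum>n<N. c n * (LINT x|?M. g n x * ?s x))"
    by (subst Bochner_Integration.integral_sum) (auto intro!: integrable_mult_right L2_unit_sin_integrable g)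
  finally show ?thesis
    unfolding sine_coeff_def by (simp add: right_diff_distrib sum_distrib_left mult_ac)
qed

lemma H_norm_eq:
  assumes "summable (\<lambda>k. (cmod (of_real (real (Suc k) powr \<alpha>) * sine_coeff g (Suc k)))\<^sup>2)"
  shows "H_norm \<alpha> g = sqrt (\<Sum>k. (cmod (of_real (real (Suc k) powr \<alpha>) * sine_coeff g (Suc k)))\<^sup>2)"
proof -
  define e where "e k = (cmod (of_real (real (Suc k) powr \<alpha>) * sine_coeff g (Suc k)))\<^sup>2" for k
  have "of_real (real (Suc k) powr (2 * \<alpha>)) * sine_coeff g (Suc k) * cnj (sine_coeff g (Suc k)) = complex_of_real (e k)" for k
  proof -
    have "real (Suc k) powr (2 * \<alpha>) = (real (Suc k) powr \<alpha>)\<^sup>2"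
      by (simp add: power2_eq_square powr_add[symmetric])
    then show ?thesis unfolding e_def complex_norm_square by (simp add: power2_eq_square mult_ac)
  qed
  then have "H_inner \<alpha> g g = (\<Sum>k. complex_of_real (e k))" unfolding H_inner_def by (simp only:)
  also have "\<dots> = of_real (suminf e)"
    by (rule suminf_of_real[symmetric]) (use assms in \<open>simp only: e_def\<close>)
  finally show ?thesis by (simp add: H_norm_def e_def[abs_def])
qed

lemma H_space_iff:
  "f \<in> H_space \<alpha> \<longleftrightarrow> f \<in> L2_unit \<and> summable (\<lambda>k. (cmod (of_real (real (Suc k) powr \<alpha>) * sine_coeff f (Suc k)))\<^sup>2)"
proof -
  have "real (Suc k) powr (2 * \<alpha>) = (real (Suc k) powr \<alpha>)\<^sup>2" for k
    by (simp add: power2_eq_square powr_add[symmetric])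
  then show ?thesis unfolding H_space_def by (simp add: norm_mult power_mult_distrib)
qed

text \<open>In weighted sine coefficients the expansion problem is the matrix problem with the
  unknowns multiplied by the nonzero factors \<open>g n\<close>, so existence and uniqueness carry
  over.\<close>

lemma H_basis_eigen_wave:
  assumes q: "\<And>n. n \<ge> 1 \<Longrightarrow> 0 < q n \<and> q n \<le> Q" and Q: "0 < Q" "Q < 1"
    and s: "s_term \<alpha> 1 Q < 1" "s_fun \<alpha> Q < 2 + s_term \<alpha> 4 Q / 2"
    and \<phi>: "\<And>n. n \<ge> 1 \<Longrightarrow> \<phi> n = eigen_wave (q n) n"
  shows "H_basis \<alpha> \<phi>"
  unfolding H_basis_def
proof (intro conjI allI impI ballI)
  have qn: "0 < q n" "q n < 1" if "n \<ge> 1" for n using q[OF that] Q by auto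
  define w where "w k = complex_of_real (real (Suc k) powr \<alpha>)" for k
  define g where "g n = eigen_norm (q (Suc n)) (Suc n) * real (Suc n) powr \<alpha>" for n
  define G where "G n k = complex_of_real (dil_matrix q \<alpha> (Suc n) (Suc k))" for n k
  have sc: "w k * sine_coeff (\<phi> (Suc n)) (Suc k) = G n k * of_real (g n)" for n k
    unfolding w_def g_def G_def using sine_coeff_eigen_wave[OF q Q, where n = "Suc n" and k = "Suc k" and \<alpha> = \<alpha>] \<phi>[of "Suc n"] by simp
  have g0: "g n \<noteq> 0" for n
    using nome_rate_pos[OF qn, of "Suc n"] by (simp add: g_def eigen_norm_def)
  have L2: "\<phi> n \<in> L2_unit" if "n \<ge> 1" for n
    unfolding \<phi>[OF that] by (rule L2_unit_continuous[OF continuous_eigen_wave[OF qn[OF that]]])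
  show "\<phi> n \<in> H_space \<alpha>" if n: "n \<ge> 1" for n
  proof -
    obtain m where m: "n = Suc m" using n by (cases n) auto
    \<comment> \<open>A single eigenfunction is the residual of the zero function for one nonzero
      coefficient, so the summability of residuals applies to it.\<close>
    have "summable (\<lambda>k. (cmod (0 - (\<Sum>i<Suc m. G i k * (if i = m then - of_real (g m) else 0))))\<^sup>2)"
      unfolding G_def by (rule dil_matrix_residual_summable[OF q Q s]) auto
    then have "summable (\<lambda>k. (cmod (G m k * of_real (g m)))\<^sup>2)" by (simp add: if_distrib sum.delta cong: if_cong)
    then show ?thesis using L2[OF n] unfolding H_space_iff m sc[symmetric] w_def by simp
  qed
  fix f assume f: "f \<in> H_space \<alpha>"
  define F where "F k = w k * sine_coeff f (Suc k)" for k
  have F: "summable (\<lambda>k. (cmod (F k))\<^sup>2)" and fL: "f \<in> L2_unit" using f unfolding H_space_iff F_def w_def by auto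
  define R where "R a N = (\<Sum>k. (cmod (F k - (\<Sum>n<N. G n k * a n)))\<^sup>2)" for a N
  have Rs: "summable (\<lambda>k. (cmod (F k - (\<Sum>n<N. G n k * a n)))\<^sup>2)" for a N
    unfolding G_def by (rule dil_matrix_residual_summable[OF q Q s F])
  have H: "H_norm \<alpha> (\<lambda>x. f x - (\<Sum>n<N. c n * \<phi> (Suc n) x)) = sqrt (R (\<lambda>n. of_real (g n) * c n) N)" for c N
  proof -
    have "w k * sine_coeff (\<lambda>x. f x - (\<Sum>n<N. c n * \<phi> (Suc n) x)) (Suc k) = F k - (\<Sum>n<N. G n k * (of_real (g n) * c n))" for k
    proof -
      have "w k * sine_coeff (\<lambda>x. f x - (\<Sum>n<N. c n * \<phi> (Suc n) x)) (Suc k) =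
          F k - (\<Sum>n<N. (w k * sine_coeff (\<phi> (Suc n)) (Suc k)) * c n)"
        by (subst sine_coeff_diff_sum[OF fL L2]) (simp_all add: F_def right_diff_distrib sum_distrib_left mult.assoc)
      then show ?thesis by (simp only: sc mult.assoc)
    qed
    then show ?thesis
      using H_norm_eq[of \<alpha> "\<lambda>x. f x - (\<Sum>n<N. c n * \<phi> (Suc n) x)"] Rs[of "\<lambda>n. of_real (g n) * c n" N]
      unfolding w_def[symmetric] R_def by simp
  qed
  have sq: "(\<lambda>N. sqrt (R a N)) \<longlonglongrightarrow> 0 \<longleftrightarrow> R a \<longlonglongrightarrow> 0" for a
  proof
    assume "(\<lambda>N. sqrt (R a N)) \<longlonglongrightarrow> 0"
    then have "(\<lambda>N. (sqrt (R a N))\<^sup>2) \<longlonglongrightarrow> 0\<^sup>2" by (rule tendsto_power)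
    moreover have "R a N \<ge> 0" for N unfolding R_def by (rule suminf_nonneg[OF Rs]) simp
    ultimately show "R a \<longlonglongrightarrow> 0" by simp
  next
    assume "R a \<longlonglongrightarrow> 0"
    then show "(\<lambda>N. sqrt (R a N)) \<longlonglongrightarrow> 0" using tendsto_real_sqrt by fastforce
  qed
  have "\<exists>!a. R a \<longlonglongrightarrow> 0"
    unfolding R_def[abs_def] G_def by (rule dil_matrix_expansion[OF q Q s F])
  then obtain a where a: "R a \<longlonglongrightarrow> 0" "\<And>b. R b \<longlonglongrightarrow> 0 \<Longrightarrow> b = a" by blast
  show "\<exists>!c. (\<lambda>N. H_norm \<alpha> (\<lambda>x. f x - (\<Sum>n<N. c n * \<phi> (Suc n) x))) \<longlonglongrightarrow> 0"
    unfolding H sq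
  proof (rule ex1I)
    show "R (\<lambda>n. of_real (g n) * (a n / of_real (g n))) \<longlonglongrightarrow> 0" using a(1) g0 by simp
    fix c assume "R (\<lambda>n. of_real (g n) * c n) \<longlonglongrightarrow> 0"
    then have "(\<lambda>n. of_real (g n) * c n) = a" by (rule a(2))
    then show "c = (\<lambda>n. a n / of_real (g n))" using g0 by (auto simp: fun_eq_iff field_simps)
  qed
qed

theorem theorem5p3:
  fixes p :: nat and \<alpha> :: real
  assumes "p \<ge> 1" and "p \<noteq> 1" and "p \<noteq> 2" and "\<alpha> \<ge> 0"
  shows "(\<exists>!q. q \<in> {0<..<1} \<and> r1_eq p \<alpha> q) \<and>
    (\<forall>q\<in>T1 p \<alpha>. \<forall>\<mu> :: nat \<Rightarrow> real. (\<forall>n\<ge>1. \<mu> n \<in> {0<..<1} \<and> nome (\<mu> n) = q n) \<longrightarrow>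
       (\<forall>n\<ge>1. gp_eigenfunction (gp_eta n (\<mu> n)) (gp_u n (\<mu> n))) \<and>
       H_basis \<alpha> (\<lambda>n x. complex_of_real (gp_u n (\<mu> n) x)))"
proof (intro conjI ballI allI impI)
  have p: "p \<ge> 3" using assms by simp
  show "\<exists>!q. q \<in> {0<..<1} \<and> r1_eq p \<alpha> q" by (rule r1_unique[OF p assms(4)])
  fix q and \<mu> :: "nat \<Rightarrow> real"
  assume "q \<in> T1 p \<alpha>" and \<mu>: "\<forall>n\<ge>1. \<mu> n \<in> {0<..<1} \<and> nome (\<mu> n) = q n"
  then have q01: "\<And>n. n \<ge> 1 \<Longrightarrow> 0 < q n \<and> q n < 1" and sup: "(SUP n\<in>{1..}. q n) < r1 p \<alpha>"
    by (auto simp: T1_def)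
  \<comment> \<open>One bound for all nomes, still below the threshold: the terms increase with q,
    so the estimates are needed at Q only.\<close>
  define Q where "Q = (SUP n\<in>{1..}. q n)"
  have "bdd_above (q ` {1..})" using q01 by (intro bdd_aboveI2[where M = 1]) (auto intro: less_imp_le)
  then have q: "0 < q n \<and> q n \<le> Q" if "n \<ge> 1" for n
    using q01[OF that] that unfolding Q_def by (auto intro: cSUP_upper)
  have Q: "0 < Q" using q[of 1] by linarith
  have Qr: "Q < r1 p \<alpha>" using sup by (simp add: Q_def)
  note Q1 = below_r1(1)[OF p assms(4) Q Qr] and s = below_r1_bounds[OF p assms(4) Q Qr]
  have m: "\<mu> n = sn_mod (nome_rate (q n))" if "n \<ge> 1" for n
    using modulus_eq_sn_mod[of "\<mu> n" "q n"] \<mu> q01[OF that] that by auto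
  show "gp_eigenfunction (gp_eta n (\<mu> n)) (gp_u n (\<mu> n))" if "n \<ge> 1" for n
    unfolding m[OF that] using q01[OF that] that by (intro gp_eigenfunction_sn nome_rate_pos) auto
  show "H_basis \<alpha> (\<lambda>n x. complex_of_real (gp_u n (\<mu> n) x))"
  proof (rule H_basis_eigen_wave[OF q Q Q1 s])
    fix n :: nat assume "n \<ge> 1"
    then show "(\<lambda>x. complex_of_real (gp_u n (\<mu> n) x)) = eigen_wave (q n) n"
      by (simp only: m eigen_wave_def[abs_def])
  qed
qed

end
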